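(* Fix $\tau\in(0,1)$ and define, for $N\in\mathbb{N}$, the domains $$\mathcal{D}_N(\tau)=\left[-\tfrac1\tau,\tfrac1\tau\right]+i\left[\tfrac{1}{N^{1-\tau}},\tfrac1\tau\right],\qquad \mathcal{D}^*_N(\tau)=\left[-2+\tau,2-\tau\right]+i\left[\tfrac{1}{N^{1-\tau}},\tfrac1\tau\right].$$ Let $H=(H_N)_N$ be an ensemble of Curie-Weiss type, $G(z)=(H_N-z)^{-1}$, $s(z)=\frac1N\operatorname{tr}G(z)$, let $m$ be the Stieltjes transform of the semicircle distribution, and $\Lambda(z)=\max_{i,j}|G_{ij}(z)-m(z)\delta_{ij}|$. Write $\eta=\operatorname{Im}z$, $E=\operatorname{Re}z$ and $\kappa=\big||E|-2\big|$. Then $$\sup_{z\in\mathcal{D}_N(\tau)}\frac{\max(\Lambda(z),|s(z)-m(z)|)}{\left(\frac{\frac{1}{\sqrt{N\eta}}}{\sqrt{\kappa+\eta+\frac{1}{\sqrt{N\eta}}}}\right)}\prec1$$ as well as $$\sup_{z\in\mathcal{D}^*_N(\tau)}\frac{\max(\Lambda(z),|s(z)-m(z)|)}{\frac{1}{\sqrt{N\eta}}}\prec1.$$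
   Context: De-Finetti type: for a finite index set $I$, a family $Y_I=(Y_i)_{i\in I}$ of real random variables on a probability space $(\Omega,\mathcal{A},\mathbb{P})$ is of de-Finetti type with respect to the mixing space $(T,\mathcal{T},\mu,P)$ if $(T,\mathcal{T},\mu)$ is a probability space, $P:T\to\mathcal{M}_1(\mathbb{R})$, $t\mapsto P_t$, is measurable ($\mathcal{M}_1(\mathbb{R})$ = Borel probability measures on $\mathbb{R}$ with the Borel $\sigma$-algebra of the weak topology), and $\mathbb{P}(Y_I\in B)=\int_T P_t^{\otimes I}(B)\,d\mu(t)$ for all measurable $B\subseteq\mathbb{R}^I$. Curie-Weiss type: a sequence $(H_N)_N$ of real symmetric random $N\times N$ matrices is of Curie-Weiss type if (a) for all $N$, $(H_N(i,j))_{1\le i\le j\le N}=(\frac{1}{\sqrt N}X_N(i,j))_{1\le i\le j\le N}$, where $(X_N(i,j))_{1\le i\le j\le N}$ is of de-Finetti type with respect to some mixing space $(T_N,\mathcal{T}_N,\mu_N,P^{(N)})$; and (b) with $m_N^{(\ell)}(t)=\int_{\mathbb{R}}x^\ell\,dP^{(N)}_t(x)$, for every even $p\in\mathbb{N}$ there is $K_p\ge 0$ such that for all $N\in\mathbb{N}$: $\int_{T_N}|m_N^{(1)}(t)|^p\,d\mu_N(t)\le K_pN^{-p/2}$; $\int_{T_N}|1-m_N^{(2)}(t)|^p\,d\mu_N(t)\le K_pN^{-p/2}$; $\sup_{t\in T_N}\int_{\mathbb{R}}|y-m_N^{(1)}(t)|^p\,dP_t^{(N)}(y)\le K_p$; $\sup_{t\in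 T_N}\int_{\mathbb{R}}|y^2-m_N^{(2)}(t)|^p\,dP_t^{(N)}(y)\le K_p$. Stochastic domination: for complex random variables $X^{(N)}$ and non-negative random variables $Y^{(N)}$, $X^{(N)}\prec Y^{(N)}$ means: for all $\epsilon,D>0$ there is $C_{\epsilon,D}\ge0$ with $\mathbb{P}(|X^{(N)}|>N^\epsilon Y^{(N)})\le C_{\epsilon,D}N^{-D}$ for all $N\in\mathbb{N}$. The semicircle distribution has Lebesgue density $x\mapsto\frac{1}{2\pi}\sqrt{(4-x^2)_+}$; the Stieltjes transform of a probability measure $\nu$ on $\mathbb{R}$ is $z\mapsto\int\frac{1}{x-z}\,d\nu(x)$ for $\operatorname{Im}z>0$. *)

theory Defs
  imports "HOL-Probability.Probability" "Jordan_Normal_Form.Gauss_Jordan_Elimination"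
begin

definition prob_measures_R :: "real measure set" where
  "prob_measures_R = {\<mu>. sets \<mu> = sets borel \<and> prob_space \<mu>}"

text \<open>The weak topology is the coarsest one for which \<open>\<mu> \<mapsto> \<integral>f d\<mu>\<close> is continuous for every
  bounded continuous \<open>f\<close>. Taking \<open>f = 0\<close>, \<open>U = UNIV\<close> shows that its carrier is all of
  \<^const>\<open>prob_measures_R\<close>.\<close>

definition weak_topology :: "real measure topology" where
  "weak_topology = topology_generated_by
     {{\<mu> \<in> prob_measures_R. (\<integral>x. f x \<partial>\<mu>) \<in> U} | (f :: real \<Rightarrow> real) (U :: real set).
        continuous_on UNIV f \<and> bounded (range f) \<and> open U}"

definition weak_borel :: "real measure measure" where
  "weak_borel = sigma prob_measures_R {U. openin weak_topology U}"

definition de_finetti_type ::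
  "'a measure \<Rightarrow> 'i set \<Rightarrow> ('i \<Rightarrow> 'a \<Rightarrow> real) \<Rightarrow> 't measure \<Rightarrow> ('t \<Rightarrow> real measure) \<Rightarrow> bool" where
  "de_finetti_type M I Y T P \<longleftrightarrow>
     prob_space M \<and> finite I \<and> (\<forall>i\<in>I. Y i \<in> borel_measurable M) \<and>
     prob_space T \<and> P \<in> measurable T weak_borel \<and>
     (\<forall>B \<in> sets (PiM I (\<lambda>_. borel)).
        measure M {\<omega> \<in> space M. (\<lambda>i\<in>I. Y i \<omega>) \<in> B}
          = (\<integral>t. measure (PiM I (\<lambda>_. P t)) B \<partial>T))"

definition moment :: "('t \<Rightarrow> real measure) \<Rightarrow> nat \<Rightarrow> 't \<Rightarrow> real" where
  "moment P l t = (\<integral>x. x ^ l \<partial>(P t))"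

text \<open>The bounds are stated with the nonnegative integral, so that each of them includes the
  finiteness of the integral. In particular the last two bounds make all moments of all
  \<open>P N t\<close> finite, hence \<^const>\<open>moment\<close> never takes the default value of a divergent integral.
  Matrix indices start at 0. The sequences are indexed by \<open>N \<ge> 1\<close>.\<close>

definition curie_weiss_type ::
  "'a measure \<Rightarrow> (nat \<Rightarrow> 'a \<Rightarrow> real mat) \<Rightarrow> (nat \<Rightarrow> 't measure) \<Rightarrow> (nat \<Rightarrow> 't \<Rightarrow> real measure) \<Rightarrow> bool"
where
  "curie_weiss_type M H T P \<longleftrightarrow>
     (\<forall>N\<ge>1. \<forall>\<omega>\<in>space M. H N \<omega> \<in> carrier_mat N N \<and> transpose_mat (H N \<omega>) = H N \<omega>) \<and>
     (\<forall>N\<ge>1. \<exists>X :: nat \<times> nat \<Rightarrow> 'a \<Rightarrow> real.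
        de_finetti_type M {(i, j). i \<le> j \<and> j < N} X (T N) (P N) \<and>
        (\<forall>\<omega>\<in>space M. \<forall>i j. i \<le> j \<and> j < N \<longrightarrow> H N \<omega> $$ (i, j) = 1 / sqrt (real N) * X (i, j) \<omega>)) \<and>
     (\<forall>p::nat. even p \<and> 0 < p \<longrightarrow> (\<exists>K\<ge>0. \<forall>N\<ge>1.
        (\<integral>\<^sup>+t. ennreal (\<bar>moment (P N) 1 t\<bar> ^ p) \<partial>(T N)) \<le> ennreal (K * real N powr (- real p / 2)) \<and>
        (\<integral>\<^sup>+t. ennreal (\<bar>1 - moment (P N) 2 t\<bar> ^ p) \<partial>(T N)) \<le> ennreal (K * real N powr (- real p / 2)) \<and>
        (SUP t\<in>space (T N). \<integral>\<^sup>+y. ennreal (\<bar>y - moment (P N) 1 t\<bar> ^ p) \<partial>(P N t)) \<le> ennreal K \<and>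
        (SUP t\<in>space (T N). \<integral>\<^sup>+y. ennreal (\<bar>y\<^sup>2 - moment (P N) 2 t\<bar> ^ p) \<partial>(P N t)) \<le> ennreal K))"

text \<open>Measurability is part of the notion, since \<^const>\<open>measure\<close> is 0 on non-measurable sets.\<close>

definition stoch_dom ::
  "'a measure \<Rightarrow> (nat \<Rightarrow> 'a \<Rightarrow> complex) \<Rightarrow> (nat \<Rightarrow> 'a \<Rightarrow> real) \<Rightarrow> bool" where
  "stoch_dom M X Y \<longleftrightarrow>
     (\<forall>N\<ge>1. X N \<in> borel_measurable M \<and> Y N \<in> borel_measurable M \<and> (\<forall>\<omega>\<in>space M. 0 \<le> Y N \<omega>)) \<and>
     (\<forall>\<epsilon>>0. \<forall>D>0. \<exists>C\<ge>0. \<forall>N\<ge>1.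
        measure M {\<omega> \<in> space M. cmod (X N \<omega>) > real N powr \<epsilon> * Y N \<omega>} \<le> C * real N powr (- D))"

definition semicircle :: "real measure" where
  "semicircle = density lborel (\<lambda>x. ennreal (1 / (2 * pi) * sqrt (max 0 (4 - x\<^sup>2))))"

definition stieltjes :: "real measure \<Rightarrow> complex \<Rightarrow> complex" where
  "stieltjes \<nu> z = (\<integral>x. 1 / (complex_of_real x - z) \<partial>\<nu>)"

definition m_sc :: "complex \<Rightarrow> complex" where
  "m_sc = stieltjes semicircle"

text \<open>For a real symmetric \<open>A\<close> and \<open>Im z > 0\<close> the shifted matrix is invertible, so that
  \<^const>\<open>mat_inverse\<close> does not return \<open>None\<close>.\<close>

definition resolvent :: "real mat \<Rightarrow> complex \<Rightarrow> complex mat" where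
  "resolvent A z = the (mat_inverse (map_mat complex_of_real A - z \<cdot>\<^sub>m 1\<^sub>m (dim_row A)))"

definition s_emp :: "nat \<Rightarrow> real mat \<Rightarrow> complex \<Rightarrow> complex" where
  "s_emp N A z = 1 / of_nat N * (\<Sum>i<N. resolvent A z $$ (i, i))"

definition Lambda :: "nat \<Rightarrow> real mat \<Rightarrow> complex \<Rightarrow> real" where
  "Lambda N A z = Max {cmod (resolvent A z $$ (i, j) - (if i = j then m_sc z else 0)) | i j. i < N \<and> j < N}"

definition kappa :: "complex \<Rightarrow> real" where
  "kappa z = \<bar>\<bar>Re z\<bar> - 2\<bar>"

definition dom_D :: "real \<Rightarrow> nat \<Rightarrow> complex set" where
  "dom_D \<tau> N = {z. Re z \<in> {- 1 / \<tau> .. 1 / \<tau>} \<and> Im z \<in> {1 / real N powr (1 - \<tau>) .. 1 / \<tau>}}"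

definition dom_D_star :: "real \<Rightarrow> nat \<Rightarrow> complex set" where
  "dom_D_star \<tau> N = {z. Re z \<in> {- 2 + \<tau> .. 2 - \<tau>} \<and> Im z \<in> {1 / real N powr (1 - \<tau>) .. 1 / \<tau>}}"

end

theory Submission
  imports Defs "Jordan_Normal_Form.Determinant" "HOL-Real_Asymp.Real_Asymp"
begin

text \<open>
  Write \<open>\<eta> = Im z\<close> and \<open>\<psi> = 1 / sqrt (N \<eta>)\<close>. The resolvent entry at \<open>(i, i)\<close> satisfies Schur's formula
  \<open>1 / G\<^sub>i\<^sub>i = A\<^sub>i\<^sub>i - z - \<Sum>\<^sub>k\<^sub>l A\<^sub>i\<^sub>k R\<^sub>k\<^sub>l A\<^sub>i\<^sub>l\<close>, where \<open>R\<close> is the resolvent of the minor without index \<open>i\<close>.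
  Conditionally on the mixing variable \<open>t\<close> the entries are independent, so row \<open>i\<close> is independent of \<open>R\<close>
  and the quadratic form is close to \<open>tr R / N\<close>, hence to \<open>s\<close>. This gives \<open>1 / G\<^sub>i\<^sub>i = - z - s + O(\<psi>)\<close> up to
  powers \<open>N\<^sup>\<epsilon>\<close>, and averaging over \<open>i\<close> gives the self-consistent equation \<open>s\<^sup>2 + z s + 1 = O(\<psi>)\<close>.

  The conditional mean \<open>\<mu>\<close> of an entry need not be zero, nor its conditional second moment \<open>v\<close> one. Expanding
  the quadratic form around the mean produces terms that are controlled by \<open>\<mu> sqrt N\<close>, \<open>(v - 1) sqrt N\<close> and the
  Frobenius norm of \<open>R\<close> alone, by the Cauchy--Schwarz inequality. Their moments over the mixing space are bounded in
  \<open>N\<close>, so the mixture concentrates as well as a matrix with centred independent entries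
  (\<open>real_quadratic_fluctuation\<close>, \<open>curie_weiss_bad_events\<close>). The Ward identity turns the Frobenius norm of \<open>R\<close> into
  \<open>sqrt (Im tr R / \<eta>)\<close>, which yields exactly the scale \<open>\<psi>\<close>.

  The numbers \<open>m\<close> and \<open>m' = - z - m\<close> are the roots of \<open>w\<^sup>2 + z w + 1\<close> (\<open>m_sc_properties\<close>), so the self-consistent
  equation says that \<open>(s - m) (s - m')\<close> is small, while \<open>|m - m'|\<^sup>2 = |z\<^sup>2 - 4|\<close> is at least \<open>\<kappa> + \<eta>\<close>. Hence \<open>s\<close> is
  close to one of the roots. For \<open>\<eta> \<ge> 1\<close> this root is \<open>m\<close>, because \<open>Im m' < 0 < Im s\<close> keeps \<open>s\<close> away from \<open>m'\<close>;
  for smaller \<open>\<eta>\<close> it stays \<open>m\<close> by continuity along vertical lines (\<open>gap_bootstrap\<close>). The outcome is the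
  deterministic statement \<open>deterministic_local_law\<close>: concentration at every \<open>z\<close> of the domain implies the law there.

  Concentration holds with overwhelming probability at the points of a grid of polynomial size, and everything is
  Lipschitz in \<open>z\<close> with a polynomial constant, so it holds simultaneously on the whole domain
  (\<open>overwhelming_local_law\<close>). On the smaller domain \<open>\<kappa> \<ge> \<tau>\<close> makes the two error scales comparable, so
  this one bound gives both claims.
\<close>

section \<open>Green functions on finite index sets\<close>

text \<open>Keeping the index set as a parameter makes the resolvent of a principal minor an instance of the same notion, with \<open>S -
  {i}\<close> in place of \<open>S\<close>.\<close>

definition green :: "'i set \<Rightarrow> ('i \<Rightarrow> 'i \<Rightarrow> real) \<Rightarrow> complex \<Rightarrow> ('i \<Rightarrow> 'i \<Rightarrow> complex) \<Rightarrow> bool" where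
  "green S A z G \<longleftrightarrow>
     (\<forall>i\<in>S. \<forall>j\<in>S. (\<Sum>k\<in>S. of_real (A i k) * G k j) - z * G i j = of_bool (i = j))"

definition symm_on :: "'i set \<Rightarrow> ('i \<Rightarrow> 'i \<Rightarrow> real) \<Rightarrow> bool" where
  "symm_on S A \<longleftrightarrow> (\<forall>i\<in>S. \<forall>j\<in>S. A i j = A j i)"

lemma symm_onD: "symm_on S A \<Longrightarrow> i \<in> S \<Longrightarrow> j \<in> S \<Longrightarrow> A i j = A j i"
  by (auto simp: symm_on_def)

lemma symm_on_subset: "symm_on S A \<Longrightarrow> S' \<subseteq> S \<Longrightarrow> symm_on S' A"
  by (auto simp: symm_on_def)

lemma greenD:
  assumes "green S A z G" "i \<in> S" "j \<in> S"
  shows "(\<Sum>k\<in>S. of_real (A i k) * G k j) = of_bool (i = j) + z * G i j"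
proof -
  have "(\<Sum>k\<in>S. of_real (A i k) * G k j) - z * G i j = of_bool (i = j)"
    using assms by (auto simp: green_def)
  thus ?thesis by (simp add: algebra_simps)
qed

lemma sum_of_bool_pick:
  fixes f :: "'i \<Rightarrow> complex"
  assumes "finite S" "i \<in> S"
  shows "(\<Sum>l\<in>S. of_bool (l = i) * f l) = f i"
proof -
  have "(\<Sum>l\<in>S. of_bool (l = i) * f l) = (\<Sum>l\<in>S. if l = i then f l else 0)"
    by (intro sum.cong) auto
  thus ?thesis using assms by simp
qed

text \<open>A real symmetric form takes real values on complex vectors, so only the shift by \<open>z\<close> contributes an imaginary
  part. Both the injectivity of \<open>A - z\<close> and the Ward identity come from this.\<close>

lemma Im_shifted_form:
  assumes "symm_on S A"
  shows "Im (\<Sum>l\<in>S. cnj (v l) * ((\<Sum>m\<in>S. of_real (A l m) * v m) - z * v l))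
           = - Im z * (\<Sum>l\<in>S. (cmod (v l))\<^sup>2)"
proof -
  have real: "cnj q = q \<Longrightarrow> Im q = 0" for q
    by (simp add: complex_eq_iff)
  let ?q = "\<Sum>l\<in>S. \<Sum>m\<in>S. cnj (v l) * (of_real (A l m) * v m)"
  have "cnj ?q = (\<Sum>l\<in>S. \<Sum>m\<in>S. v l * (of_real (A l m) * cnj (v m)))"
    by simp
  also have "\<dots> = (\<Sum>m\<in>S. \<Sum>l\<in>S. v l * (of_real (A l m) * cnj (v m)))"
    by (rule sum.swap)
  also have "\<dots> = ?q"
    by (intro sum.cong refl) (use symm_onD[OF assms] in \<open>simp add: mult_ac\<close>)
  finally have "Im ?q = 0"
    by (rule real)
  hence "Im (?q - z * of_real (\<Sum>l\<in>S. (cmod (v l))\<^sup>2)) = - Im z * (\<Sum>l\<in>S. (cmod (v l))\<^sup>2)"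
    unfolding minus_complex.sel times_complex.sel by simp
  also have "?q - z * of_real (\<Sum>l\<in>S. (cmod (v l))\<^sup>2)
      = (\<Sum>l\<in>S. cnj (v l) * ((\<Sum>m\<in>S. of_real (A l m) * v m) - z * v l))"
    by (simp add: right_diff_distrib sum_subtractf sum_distrib_left complex_norm_square mult_ac
        del: of_real_power)
  finally show ?thesis .
qed

lemma shifted_kernel_trivial:
  assumes "finite S" "symm_on S A" "Im z > 0"
    and "\<And>l. l \<in> S \<Longrightarrow> (\<Sum>m\<in>S. of_real (A l m) * v m) = z * v l" and "k \<in> S"
  shows "v k = 0"
proof -
  have "- Im z * (\<Sum>l\<in>S. (cmod (v l))\<^sup>2) = 0"
    using assms(4) by (subst Im_shifted_form[OF assms(2), symmetric]) simp
  hence "(\<Sum>l\<in>S. (cmod (v l))\<^sup>2) = 0" using assms(3) by simp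
  thus ?thesis using assms(1,5) by (simp add: sum_nonneg_eq_0_iff)
qed

lemma green_unique:
  assumes "finite S" "symm_on S A" "Im z > 0" "green S A z G" "green S A z G'" "i \<in> S" "j \<in> S"
  shows "G i j = G' i j"
proof -
  have "G i j - G' i j = 0"
  proof (rule shifted_kernel_trivial[OF assms(1-3), of "\<lambda>i. G i j - G' i j"])
    fix l assume "l \<in> S"
    thus "(\<Sum>m\<in>S. of_real (A l m) * (G m j - G' m j)) = z * (G l j - G' l j)"
      using greenD[OF assms(4) _ assms(7)] greenD[OF assms(5) _ assms(7)]
      by (simp add: algebra_simps sum_subtractf)
  qed fact
  thus ?thesis by simp
qed

text \<open>The resolvent identity, obtained by evaluating the pairing of a column of \<open>G\<close> with a column of \<open>G'\<close>
  under \<open>A\<close> in two ways. For \<open>z = w\<close> it gives the symmetry of the Green function.\<close>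

lemma green_pairing:
  assumes "finite S" "symm_on S A" "green S A z G" "green S A w G'" "i \<in> S" "j \<in> S"
  shows "G' i j - G j i = (w - z) * (\<Sum>k\<in>S. G k i * G' k j)"
proof -
  let ?q = "\<Sum>l\<in>S. (\<Sum>k\<in>S. of_real (A l k) * G k i) * G' l j"
  have "?q = (\<Sum>l\<in>S. (of_bool (l = i) + z * G l i) * G' l j)"
    using greenD[OF assms(3) _ assms(5)] by (intro sum.cong) auto
  also have "\<dots> = G' i j + z * (\<Sum>k\<in>S. G k i * G' k j)"
    using sum_of_bool_pick[OF assms(1,5)]
    by (simp add: distrib_right sum.distrib sum_distrib_left mult.assoc)
  finally have 1: "?q = G' i j + z * (\<Sum>k\<in>S. G k i * G' k j)" .
  have "?q = (\<Sum>l\<in>S. \<Sum>k\<in>S. of_real (A l k) * G k i * G' l j)"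
    by (simp add: sum_distrib_right)
  also have "\<dots> = (\<Sum>k\<in>S. \<Sum>l\<in>S. of_real (A l k) * G k i * G' l j)"
    by (rule sum.swap)
  also have "\<dots> = (\<Sum>k\<in>S. G k i * (\<Sum>l\<in>S. of_real (A k l) * G' l j))"
    unfolding sum_distrib_left
    by (intro sum.cong refl) (simp add: symm_onD[OF assms(2)] mult_ac)
  also have "\<dots> = (\<Sum>k\<in>S. G k i * (of_bool (k = j) + w * G' k j))"
    using greenD[OF assms(4) _ assms(6)] by (intro sum.cong) auto
  also have "\<dots> = G j i + w * (\<Sum>k\<in>S. G k i * G' k j)"
    using sum_of_bool_pick[OF assms(1,6), of "\<lambda>k. G k i"]
    by (simp add: distrib_left sum.distrib sum_distrib_left mult_ac)
  finally show ?thesis using 1 by (simp add: algebra_simps)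
qed

lemma green_sym:
  assumes "finite S" "symm_on S A" "green S A z G" "i \<in> S" "j \<in> S"
  shows "G i j = G j i"
  using green_pairing[OF assms(1,2,3,3,4,5)] by simp

text \<open>The Ward identity: apply \<open>Im_shifted_form\<close> to the column \<open>v = G e\<^sub>j\<close>, for which \<open>(A -
  z) v = e\<^sub>j\<close>.\<close>

lemma green_ward:
  assumes "finite S" "symm_on S A" "green S A z G" "j \<in> S"
  shows "Im (G j j) = Im z * (\<Sum>l\<in>S. (cmod (G l j))\<^sup>2)"
proof -
  have "(\<Sum>l\<in>S. cnj (G l j) * ((\<Sum>m\<in>S. of_real (A l m) * G m j) - z * G l j))
      = (\<Sum>l\<in>S. cnj (G l j) * of_bool (l = j))"
    using greenD[OF assms(3) _ assms(4)] by (intro sum.cong) auto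
  also have "\<dots> = cnj (G j j)"
    using sum_of_bool_pick[OF assms(1,4), of "\<lambda>l. cnj (G l j)"] by (simp add: mult.commute)
  finally show ?thesis
    using Im_shifted_form[OF assms(2), of "\<lambda>l. G l j" z] by simp
qed

text \<open>The Ward identity bounds \<open>|G\<^sub>j\<^sub>j|\<^sup>2\<close> by \<open>Im G\<^sub>j\<^sub>j / Im z\<close>, hence by
  \<open>|G\<^sub>j\<^sub>j| / Im z\<close>; the column norm follows by using the identity once more.\<close>

lemma green_cmod_le:
  assumes "finite S" "symm_on S A" "green S A z G" "Im z > 0" "j \<in> S"
  shows "(\<Sum>l\<in>S. (cmod (G l j))\<^sup>2) \<le> 1 / (Im z)\<^sup>2" and "i \<in> S \<Longrightarrow> cmod (G i j) \<le> 1 / Im z"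
proof -
  let ?s = "\<Sum>l\<in>S. (cmod (G l j))\<^sup>2"
  have le: "(cmod (G i j))\<^sup>2 \<le> ?s" if "i \<in> S" for i
    using that assms(1) by (intro member_le_sum) auto
  have "Im z * (cmod (G j j))\<^sup>2 \<le> Im (G j j)"
    using le[OF assms(5)] assms(4) by (simp add: green_ward[OF assms(1-3,5)])
  also have "\<dots> \<le> cmod (G j j)" using abs_Im_le_cmod[of "G j j"] by linarith
  finally have "cmod (G j j) * (Im z * cmod (G j j)) \<le> cmod (G j j) * 1"
    by (simp add: power2_eq_square mult_ac)
  hence g: "cmod (G j j) \<le> 1 / Im z"
    using assms(4) by (cases "G j j = 0") (auto simp: field_simps)
  have "Im z * ?s = Im (G j j)" by (simp add: green_ward[OF assms(1-3,5)])
  also have "\<dots> \<le> 1 / Im z" using abs_Im_le_cmod[of "G j j"] g by linarith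
  finally show s: "?s \<le> 1 / (Im z)\<^sup>2"
    using assms(4) by (simp add: field_simps power2_eq_square)
  show "cmod (G i j) \<le> 1 / Im z" if "i \<in> S"
  proof (rule power2_le_imp_le)
    show "(cmod (G i j))\<^sup>2 \<le> (1 / Im z)\<^sup>2"
      using order_trans[OF le[OF that] s] by (simp add: power_divide)
  qed (use assms(4) in simp)
qed

lemma green_lipschitz:
  assumes "finite S" "symm_on S A" "green S A z G" "green S A w G'" "Im z > 0" "Im w > 0"
    and "i \<in> S" "j \<in> S"
  shows "cmod (G' i j - G i j) \<le> cmod (w - z) / (Im z * Im w)"
proof -
  have "cmod (\<Sum>k\<in>S. G k i * G' k j) \<le> (\<Sum>k\<in>S. \<bar>cmod (G k i)\<bar> * \<bar>cmod (G' k j)\<bar>)"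
    by (rule order_trans[OF norm_sum]) (simp add: norm_mult)
  also have "\<dots> \<le> L2_set (\<lambda>k. cmod (G k i)) S * L2_set (\<lambda>k. cmod (G' k j)) S"
    by (rule L2_set_mult_ineq)
  also have "\<dots> \<le> (1 / Im z) * (1 / Im w)"
  proof (intro mult_mono)
    show "L2_set (\<lambda>k. cmod (G k i)) S \<le> 1 / Im z"
      unfolding L2_set_def using green_cmod_le(1)[OF assms(1,2,3,5,7)] assms(5)
      by (intro real_le_lsqrt) (auto simp: power_divide)
    show "L2_set (\<lambda>k. cmod (G' k j)) S \<le> 1 / Im w"
      unfolding L2_set_def using green_cmod_le(1)[OF assms(1,2,4,6,8)] assms(6)
      by (intro real_le_lsqrt) (auto simp: power_divide)
  qed (use assms in auto)
  finally have "cmod (\<Sum>k\<in>S. G k i * G' k j) \<le> 1 / (Im z * Im w)" by simp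
  hence "cmod (w - z) * cmod (\<Sum>k\<in>S. G k i * G' k j) \<le> cmod (w - z) * (1 / (Im z * Im w))"
    by (intro mult_left_mono) auto
  thus ?thesis
    using green_pairing[OF assms(1,2,3,4,7,8)] green_sym[OF assms(1,2,3,7,8)]
    by (simp add: norm_mult)
qed

lemma green_diag_nonzero:
  assumes "finite S" "symm_on S A" "green S A z G" "Im z > 0" "i \<in> S"
  shows "Im (G i i) > 0" "G i i \<noteq> 0"
proof -
  have "(\<Sum>l\<in>S. (cmod (G l i))\<^sup>2) \<noteq> 0"
  proof
    assume "(\<Sum>l\<in>S. (cmod (G l i))\<^sup>2) = 0"
    hence "\<forall>l\<in>S. G l i = 0" using assms(1) by (simp add: sum_nonneg_eq_0_iff)
    thus False using greenD[OF assms(3,5,5)] assms(5) by simp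
  qed
  hence "(\<Sum>l\<in>S. (cmod (G l i))\<^sup>2) > 0" by (simp add: less_le sum_nonneg)
  thus "Im (G i i) > 0" using green_ward[OF assms(1-3,5)] assms(4) by simp
  thus "G i i \<noteq> 0" by auto
qed

lemma green_row_off:
  assumes "finite S" "green S A z G" "i \<in> S" "j \<in> S" "l \<in> S"
  shows "(\<Sum>k\<in>S-{i}. of_real (A j k) * G k l)
           = of_bool (j = l) + z * G j l - of_real (A j i) * G i l"
  using greenD[OF assms(2,4,5)] assms(1,3) by (simp add: sum_diff1)

text \<open>Elimination of the index \<open>i\<close> from the linear system. By uniqueness this rank-one correction is the Green
  function of the minor.\<close>

lemma green_minor:
  assumes "finite S" "symm_on S A" "green S A z G" "Im z > 0" "i \<in> S"
  shows "green (S - {i}) A z (\<lambda>k l. G k l - G k i * G i l / G i i)"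
  unfolding green_def
proof (intro ballI)
  note nz = green_diag_nonzero[OF assms]
  fix j l assume jl: "j \<in> S - {i}" "l \<in> S - {i}"
  hence jS: "j \<in> S" and lS: "l \<in> S" by auto
  have "(\<Sum>k\<in>S-{i}. of_real (A j k) * (G k l - G k i * G i l / G i i))
      = (\<Sum>k\<in>S-{i}. of_real (A j k) * G k l)
        - (\<Sum>k\<in>S-{i}. of_real (A j k) * G k i) * (G i l / G i i)"
    by (simp add: algebra_simps sum_subtractf sum_distrib_left sum_distrib_right)
  also have "\<dots> - z * (G j l - G j i * G i l / G i i) = of_bool (j = l)"
    unfolding green_row_off[OF assms(1,3,5) jS lS] green_row_off[OF assms(1,3,5) jS assms(5)]
    using jl nz(2) by (simp add: field_simps)
  finally show "(\<Sum>k\<in>S-{i}. of_real (A j k) * (G k l - G k i * G i l / G i i))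
      - z * (G j l - G j i * G i l / G i i) = of_bool (j = l)" .
qed

lemma green_minor_eq:
  assumes "finite S" "symm_on S A" "green S A z G" "Im z > 0" "i \<in> S"
    and "green (S - {i}) A z R" "k \<in> S - {i}" "l \<in> S - {i}"
  shows "R k l = G k l - G k i * G i l / G i i"
  using green_unique[OF _ symm_on_subset[OF assms(2)] assms(4,6) green_minor[OF assms(1-5)] assms(7,8)]
    assms(1) by auto

text \<open>Schur's formulas express entries of \<open>G\<close> through row \<open>i\<close> of \<open>A\<close> and the Green function
  of the minor. They separate two sources of randomness that are independent when the entries of \<open>A\<close> are.\<close>

lemma green_schur_row:
  assumes "finite S" "symm_on S A" "green S A z G" "Im z > 0" "i \<in> S"
    and "green (S - {i}) A z R" "j \<in> S - {i}"
  shows "(\<Sum>k\<in>S-{i}. of_real (A i k) * R k j) = - (G i j / G i i)"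
proof -
  note nz = green_diag_nonzero[OF assms(1-5)]
  have jS: "j \<in> S" using assms(7) by auto
  have "(\<Sum>k\<in>S-{i}. of_real (A i k) * R k j)
      = (\<Sum>k\<in>S-{i}. of_real (A i k) * (G k j - G k i * G i j / G i i))"
    using green_minor_eq[OF assms(1-6) _ assms(7)] by (intro sum.cong) auto
  also have "\<dots> = (\<Sum>k\<in>S-{i}. of_real (A i k) * G k j)
        - (\<Sum>k\<in>S-{i}. of_real (A i k) * G k i) * (G i j / G i i)"
    by (simp add: algebra_simps sum_subtractf sum_distrib_left sum_distrib_right)
  also have "\<dots> = - (G i j / G i i)"
    unfolding green_row_off[OF assms(1,3,5,5) jS] green_row_off[OF assms(1,3,5,5,5)]
    using assms(7) nz(2) by (auto simp: field_simps)
  finally show ?thesis .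
qed

lemma green_schur_diag:
  assumes "finite S" "symm_on S A" "green S A z G" "Im z > 0" "i \<in> S"
    and "green (S - {i}) A z R"
  shows "1 / G i i = of_real (A i i) - z
           - (\<Sum>k\<in>S-{i}. \<Sum>l\<in>S-{i}. of_real (A i k) * R k l * of_real (A i l))"
proof -
  note nz = green_diag_nonzero[OF assms(1-5)]
  have "(\<Sum>k\<in>S-{i}. \<Sum>l\<in>S-{i}. of_real (A i k) * R k l * of_real (A i l))
      = (\<Sum>l\<in>S-{i}. (\<Sum>k\<in>S-{i}. of_real (A i k) * R k l) * of_real (A i l))"
    unfolding sum_distrib_right by (rule sum.swap)
  also have "\<dots> = (\<Sum>l\<in>S-{i}. - (of_real (A i l) * G l i) / G i i)"
    using green_schur_row[OF assms(1-6)] green_sym[OF assms(1-3,5)]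
    by (intro sum.cong) auto
  also have "\<dots> = - (\<Sum>l\<in>S-{i}. of_real (A i l) * G l i) / G i i"
    by (simp add: sum_divide_distrib sum_negf)
  also have "(\<Sum>l\<in>S-{i}. of_real (A i l) * G l i) = 1 + z * G i i - of_real (A i i) * G i i"
    using green_row_off[OF assms(1,3,5,5,5)] by simp
  finally show ?thesis using nz(2) by (simp add: field_simps)
qed

lemma green_shifted_inverse:
  fixes A :: "real mat" and B :: "complex mat"
  assumes A: "A \<in> carrier_mat n n" and B: "B \<in> carrier_mat n n"
    and inv: "(map_mat complex_of_real A - z \<cdot>\<^sub>m 1\<^sub>m n) * B = 1\<^sub>m n"
  shows "green {..<n} (\<lambda>i j. A $$ (i, j)) z (\<lambda>i j. B $$ (i, j))"
  unfolding green_def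
proof (intro ballI)
  fix i j assume ij: "i \<in> {..<n}" "j \<in> {..<n}"
  let ?M = "map_mat complex_of_real A - z \<cdot>\<^sub>m 1\<^sub>m n"
  have "of_bool (i = j) = (?M * B) $$ (i, j)"
    using ij by (simp add: inv)
  also have "\<dots> = (\<Sum>k<n. ?M $$ (i, k) * B $$ (k, j))"
    using ij A B by (simp add: scalar_prod_def atLeast0LessThan)
  also have "\<dots> = (\<Sum>k<n. (of_real (A $$ (i, k)) - (if i = k then z else 0)) * B $$ (k, j))"
    using ij A by (intro sum.cong) auto
  also have "\<dots> = (\<Sum>k<n. of_real (A $$ (i, k)) * B $$ (k, j)) - z * B $$ (i, j)"
    using ij by (simp add: left_diff_distrib sum_subtractf if_distrib[where f = "\<lambda>x. x * _"] cong: if_cong)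
  finally show "(\<Sum>k\<in>{..<n}. of_real (A $$ (i, k)) * B $$ (k, j)) - z * B $$ (i, j) = of_bool (i = j)"
    by simp
qed

definition real_symmetric :: "nat \<Rightarrow> real mat \<Rightarrow> bool" where
  "real_symmetric n A \<longleftrightarrow> A \<in> carrier_mat n n \<and> transpose_mat A = A"

lemma real_symmetric_symm_on:
  assumes "real_symmetric n A"
  shows "symm_on {..<n} (\<lambda>i j. A $$ (i, j))"
proof -
  have "A $$ (i, j) = A $$ (j, i)" if "i < n" "j < n" for i j
    using assms that index_transpose_mat(1)[of j A i]
    by (auto simp: real_symmetric_def)
  thus ?thesis by (auto simp: symm_on_def)
qed

lemma det_shifted_nonzero:
  assumes "real_symmetric n A" "Im z > 0"
  shows "det (map_mat complex_of_real A - z \<cdot>\<^sub>m 1\<^sub>m n) \<noteq> 0"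
proof
  let ?M = "map_mat complex_of_real A - z \<cdot>\<^sub>m 1\<^sub>m n"
  assume "det ?M = 0"
  have A: "A \<in> carrier_mat n n" using assms by (simp add: real_symmetric_def)
  have M: "?M \<in> carrier_mat n n" by (intro minus_carrier_mat smult_carrier_mat one_carrier_mat)
  from \<open>det ?M = 0\<close> obtain v where v: "v \<in> carrier_vec n" "v \<noteq> 0\<^sub>v n" "?M *\<^sub>v v = 0\<^sub>v n"
    using det_0_iff_vec_prod_zero[OF M] by auto
  have "v $ k = 0" if "k < n" for k
  proof (rule shifted_kernel_trivial[OF _ real_symmetric_symm_on[OF assms(1)] assms(2), of "\<lambda>k. v $ k"])
    fix l assume l: "l \<in> {..<n}"
    have "0 = (?M *\<^sub>v v) $ l" using v l by simp
    also have "\<dots> = (\<Sum>k<n. (of_real (A $$ (l, k)) - (if l = k then z else 0)) * v $ k)"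
      using l v(1) A by (auto simp: scalar_prod_def atLeast0LessThan intro!: sum.cong)
    also have "\<dots> = (\<Sum>k<n. of_real (A $$ (l, k)) * v $ k) - z * v $ l"
      using l by (simp add: left_diff_distrib sum_subtractf if_distrib[where f = "\<lambda>x. x * _"] cong: if_cong)
    finally show "(\<Sum>m\<in>{..<n}. of_real (A $$ (l, m)) * v $ m) = z * v $ l" by simp
  qed (use that in auto)
  hence "v = 0\<^sub>v n" using v(1) by (intro eq_vecI) auto
  with v(2) show False by simp
qed

text \<open>Cramer's rule shows that the entries of the resolvent are rational in the entries of the matrix, which is the source of their
  measurability.\<close>

lemma resolvent_eq_adj:
  assumes "real_symmetric n A" "Im z > 0"
  shows "resolvent A z = (1 / det (map_mat complex_of_real A - z \<cdot>\<^sub>m 1\<^sub>m n))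
            \<cdot>\<^sub>m adj_mat (map_mat complex_of_real A - z \<cdot>\<^sub>m 1\<^sub>m n)"
    and "resolvent A z \<in> carrier_mat n n"
    and "green {..<n} (\<lambda>i j. A $$ (i, j)) z (\<lambda>i j. resolvent A z $$ (i, j))"
proof -
  let ?M = "map_mat complex_of_real A - z \<cdot>\<^sub>m 1\<^sub>m n"
  let ?d = "det ?M"
  let ?J = "(1 / ?d) \<cdot>\<^sub>m adj_mat ?M"
  have A: "A \<in> carrier_mat n n" using assms by (simp add: real_symmetric_def)
  have M: "?M \<in> carrier_mat n n" by (intro minus_carrier_mat smult_carrier_mat one_carrier_mat)
  note d = det_shifted_nonzero[OF assms]
  note adj = adj_mat[OF M]
  have J: "?J \<in> carrier_mat n n" using adj(1) by simp
  have MJ: "?M * ?J = 1\<^sub>m n"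
    by (subst mult_smult_distrib[OF M adj(1)], subst adj(2)) (use d in \<open>auto intro!: eq_matI\<close>)
  have JM: "?J * ?M = 1\<^sub>m n"
    by (subst mult_smult_assoc_mat[OF adj(1) M], subst adj(3)) (use d in \<open>auto intro!: eq_matI\<close>)
  have "?M \<in> Units (ring_mat TYPE(complex) n ())"
    using M J MJ JM unfolding Units_def ring_mat_def by auto
  then obtain B where B: "mat_inverse ?M = Some B"
    using mat_inverse(1)[OF M, where b = "()"] by (cases "mat_inverse ?M") auto
  from mat_inverse(2)[OF M B] have B': "?M * B = 1\<^sub>m n" "B * ?M = 1\<^sub>m n" "B \<in> carrier_mat n n" by auto
  have dim: "dim_row A = n" using A by auto
  have r: "resolvent A z = B" by (simp add: resolvent_def dim B)
  have "B = B * (?M * ?J)" using B' MJ by simp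
  also have "\<dots> = (B * ?M) * ?J" by (rule assoc_mult_mat[OF B'(3) M J, symmetric])
  also have "\<dots> = ?J" unfolding B'(2) by (rule left_mult_one_mat[OF J])
  finally show "resolvent A z = ?J" using r by simp
  show "resolvent A z \<in> carrier_mat n n" using r B' by simp
  show "green {..<n} (\<lambda>i j. A $$ (i, j)) z (\<lambda>i j. resolvent A z $$ (i, j))"
    unfolding r by (rule green_shifted_inverse[OF A B'(3,1)])
qed

text \<open>Clearing row and column \<open>i\<close> keeps the dimension, and off the index \<open>i\<close> the resolvent of the cleared
  matrix is that of the minor. In this form it visibly depends only on the entries outside row \<open>i\<close>.\<close>

definition clear_row :: "nat \<Rightarrow> real mat \<Rightarrow> real mat" where
  "clear_row i A = mat (dim_row A) (dim_row A) (\<lambda>(j, k). if j = i \<or> k = i then 0 else A $$ (j, k))"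

lemma real_symmetric_clear_row:
  assumes "real_symmetric n A"
  shows "real_symmetric n (clear_row i A)"
  using assms real_symmetric_symm_on[OF assms]
  by (auto simp: real_symmetric_def clear_row_def symm_on_def intro!: eq_matI)

lemma green_clear_row:
  assumes "real_symmetric n A" "Im z > 0" "i < n"
  shows "green ({..<n} - {i}) (\<lambda>j k. A $$ (j, k)) z (\<lambda>j k. resolvent (clear_row i A) z $$ (j, k))"
  unfolding green_def
proof (intro ballI)
  let ?R = "\<lambda>j k. resolvent (clear_row i A) z $$ (j, k)"
  note g = resolvent_eq_adj(3)[OF real_symmetric_clear_row[OF assms(1)] assms(2), of i]
  have [simp]: "dim_row A = n" using assms(1) by (auto simp: real_symmetric_def)
  fix j l assume jl: "j \<in> {..<n} - {i}" "l \<in> {..<n} - {i}"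
  have "(\<Sum>k\<in>{..<n}-{i}. of_real (A $$ (j, k)) * ?R k l)
      = (\<Sum>k\<in>{..<n}-{i}. of_real (clear_row i A $$ (j, k)) * ?R k l)"
    using jl by (intro sum.cong) (auto simp: clear_row_def)
  also have "\<dots> = (\<Sum>k<n. of_real (clear_row i A $$ (j, k)) * ?R k l)"
    using assms(3) jl by (simp add: sum_diff1) (simp add: clear_row_def)
  also have "\<dots> = of_bool (j = l) + z * ?R j l"
    using greenD[OF g] jl by auto
  finally show "(\<Sum>k\<in>{..<n}-{i}. of_real (A $$ (j, k)) * ?R k l) - z * ?R j l = of_bool (j = l)"
    by simp
qed

section \<open>The Stieltjes transform of the semicircle distribution\<close>

lemma has_integral_sin_sin:
  "((\<lambda>x. sin x * sin (real (k + 1) * x)) has_integral (if k = 0 then pi / 2 else 0)) {0..pi}"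
proof (cases "k = 0")
  case True
  have "((\<lambda>x. sin x * sin x) has_integral ((\<lambda>x. x / 2 - sin (2 * x) / 4) pi - (\<lambda>x. x / 2 - sin (2 * x) / 4) 0)) {0..pi}"
  proof (rule fundamental_theorem_of_calculus)
    fix x :: real
    show "((\<lambda>x. x / 2 - sin (2 * x) / 4) has_vector_derivative sin x * sin x) (at x within {0..pi})"
      by (auto intro!: derivative_eq_intros simp: cos_double_sin power2_eq_square diff_divide_distrib
          simp flip: has_real_derivative_iff_has_vector_derivative)
  qed simp
  thus ?thesis using True by simp
next
  case False
  let ?F = "\<lambda>x. (sin (real k * x) / real k - sin (real (k + 2) * x) / real (k + 2)) / 2"
  have "((\<lambda>x. sin x * sin (real (k + 1) * x)) has_integral (?F pi - ?F 0)) {0..pi}"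
  proof (rule fundamental_theorem_of_calculus)
    fix x :: real
    have "cos (real k * x) - cos (real (k + 2) * x) = 2 * sin x * sin (real (k + 1) * x)"
    proof -
      have "real k * x = real (k + 1) * x - x" "real (k + 2) * x = real (k + 1) * x + x"
        by (simp_all add: algebra_simps)
      thus ?thesis by (simp only: cos_add cos_diff) simp
    qed
    thus "(?F has_vector_derivative sin x * sin (real (k + 1) * x)) (at x within {0..pi})"
      unfolding has_real_derivative_iff_has_vector_derivative[symmetric] using False
      by (auto intro!: derivative_eq_intros)
  qed simp
  moreover have "?F pi - ?F 0 = 0"
    unfolding sin_npi by simp
  ultimately show ?thesis using False by simp
qed

text \<open>A telescoping form, multiplied by \<open>sin x\<close>, of the generating function \<open>\<Sum>\<^sub>k t\<^sup>k
  U\<^sub>k(cos x) = 1 / (1 - 2 t cos x + t\<^sup>2)\<close> of the Chebyshev polynomials \<open>U\<^sub>k(cos x) = sin ((k +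
  1) x) / sin x\<close>.\<close>

lemma chebyshev_partial_sum:
  fixes t :: complex and x :: real
  shows "(1 - 2 * t * cos x + t\<^sup>2) * (\<Sum>k\<le>n. t ^ k * sin (real (k + 1) * x))
           = sin x - t ^ (n + 1) * sin (real (n + 2) * x) + t ^ (n + 2) * sin (real (n + 1) * x)"
proof (induction n)
  case 0
  have "sin (2 * x) = 2 * sin x * cos x" by (rule sin_double)
  thus ?case by (simp add: algebra_simps power2_eq_square)
next
  case (Suc n)
  have "sin (real (n + 3) * x) + sin (real (n + 1) * x) = 2 * cos x * sin (real (n + 2) * x)"
  proof -
    have "real (n + 3) * x = real (n + 2) * x + x" "real (n + 1) * x = real (n + 2) * x - x"
      by (simp_all add: algebra_simps)
    thus ?thesis by (simp only: sin_add sin_diff) simp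
  qed
  hence e: "complex_of_real (sin (real (n + 3) * x)) = 2 * cos x * sin (real (n + 2) * x) - sin (real (n + 1) * x)"
    by (simp add: algebra_simps flip: of_real_mult of_real_add of_real_diff)
  have i: "Suc n + 1 = n + 2" "Suc n + 2 = n + 3" by simp_all
  show ?case
    unfolding sum.atMost_Suc distrib_left Suc.IH i e
    by (simp add: algebra_simps power2_eq_square power_add numeral_3_eq_3)
qed

lemma cmod_chebyshev_denominator:
  fixes t :: complex and x :: real
  assumes "cmod t < 1"
  shows "(1 - cmod t)\<^sup>2 \<le> cmod (1 - 2 * t * cos x + t\<^sup>2)"
proof -
  have "1 - 2 * t * cos x + t\<^sup>2 = (1 - t * cis x) * (1 - t * cis (- x))"
  proof -
    have "cis x + cis (- x) = 2 * cos x" "cis x * cis (-x) = 1"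
      by (auto simp: complex_eq_iff cis_mult)
    thus ?thesis by (simp add: algebra_simps power2_eq_square flip: distrib_left)
  qed
  moreover have "1 - cmod t \<le> cmod (1 - t * cis y)" for y
    using norm_triangle_ineq2[of 1 "t * cis y"] by (simp add: norm_mult)
  ultimately show ?thesis
    using assms by (auto simp: norm_mult power2_eq_square intro!: mult_mono)
qed

text \<open>In the Chebyshev expansion of the kernel only the term \<open>k = 0\<close> survives integration against \<open>sin\<close>,
  by orthogonality; the remainder of the partial sum decays geometrically.\<close>

lemma integral_sin_squared_kernel:
  fixes t :: complex
  assumes "cmod t < 1"
  shows "integral {0..pi} (\<lambda>x. complex_of_real (sin x * sin x) / (1 - 2 * t * cos x + t\<^sup>2)) = of_real (pi / 2)"
proof -
  define D where "D x = 1 - 2 * t * cos x + t\<^sup>2" for x :: real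
  define f where "f x = complex_of_real (sin x * sin x) / D x" for x :: real
  define r where "r n x = (t ^ (n + 1) * sin (real (n + 2) * x) - t ^ (n + 2) * sin (real (n + 1) * x)) * sin x / D x"
    for n and x :: real
  have Dpos: "(1 - cmod t)\<^sup>2 > 0" using assms by simp
  have Dge: "(1 - cmod t)\<^sup>2 \<le> cmod (D x)" for x
    using cmod_chebyshev_denominator[OF assms] by (simp add: D_def)
  have D0: "D x \<noteq> 0" for x using Dge[of x] Dpos by auto
  have contD: "continuous_on S D" for S unfolding D_def by (intro continuous_intros)
  have contr: "continuous_on {0..pi} (r n)" for n
    unfolding r_def using D0 contD by (intro continuous_intros) auto
  have bound: "cmod (integral {0..pi} f - of_real (pi / 2)) \<le> 2 * cmod t ^ (n + 1) / (1 - cmod t)\<^sup>2 * (pi - 0)" for n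
  proof -
    have eq: "f x = (\<Sum>k\<le>n. t ^ k * of_real (sin x * sin (real (k + 1) * x))) + r n x" for x
    proof -
      have "D x * r n x = (t ^ (n + 1) * sin (real (n + 2) * x) - t ^ (n + 2) * sin (real (n + 1) * x)) * sin x"
        using D0[of x] by (simp add: r_def)
      hence "D x * (\<Sum>k\<le>n. t ^ k * sin (real (k + 1) * x)) * sin x + D x * r n x = of_real (sin x * sin x)"
        unfolding chebyshev_partial_sum[of t x n, folded D_def]
        by (simp only: left_diff_distrib distrib_right of_real_mult) simp
      hence "f x = (\<Sum>k\<le>n. t ^ k * sin (real (k + 1) * x)) * sin x + r n x"
        unfolding f_def using D0[of x] by (simp add: field_simps)
      thus ?thesis by (simp add: sum_distrib_right sum_distrib_left mult_ac)
    qed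
    have "((\<lambda>x. \<Sum>k\<le>n. t ^ k * of_real (sin x * sin (real (k + 1) * x))) has_integral
            (\<Sum>k\<le>n. t ^ k * of_real (if k = 0 then pi / 2 else 0))) {0..pi}"
      by (intro has_integral_sum has_integral_mult_right has_integral_of_real has_integral_sin_sin) auto
    moreover have "(\<Sum>k\<le>n. t ^ k * of_real (if k = 0 then pi / 2 else 0)) = complex_of_real (pi / 2)"
      by (subst sum.remove[of _ 0]) auto
    moreover have "(r n has_integral integral {0..pi} (r n)) {0..pi}"
      by (intro integrable_integral integrable_continuous_interval contr)
    ultimately have "(f has_integral (of_real (pi / 2) + integral {0..pi} (r n))) {0..pi}"
      unfolding eq[abs_def] by (simp add: has_integral_add)
    hence "integral {0..pi} f - of_real (pi / 2) = integral {0..pi} (r n)"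
      by (simp add: integral_unique)
    moreover have "cmod (integral {0..pi} (r n)) \<le> 2 * cmod t ^ (n + 1) / (1 - cmod t)\<^sup>2 * (pi - 0)"
    proof (intro integral_bound contr)
      fix x :: real
      have 1: "cmod (t ^ (n + 1) * of_real (sin y)) \<le> cmod t ^ (n + 1)" for y
        by (simp add: norm_mult norm_power mult_left_le)
      have "cmod (t ^ (n + 2) * of_real (sin y)) \<le> cmod t ^ (n + 2)" for y
        by (simp add: norm_mult norm_power mult_left_le)
      moreover have "cmod t ^ (n + 2) \<le> cmod t ^ (n + 1)"
        using assms by (intro power_decreasing) auto
      ultimately have 2: "cmod (t ^ (n + 2) * of_real (sin y)) \<le> cmod t ^ (n + 1)" for y
        using order_trans by blast
      have "cmod ((t ^ (n + 1) * sin (real (n + 2) * x) - t ^ (n + 2) * sin (real (n + 1) * x)) * sin x)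
          \<le> (cmod t ^ (n + 1) + cmod t ^ (n + 1)) * 1"
        unfolding norm_mult[of "_ - _"]
        by (intro mult_mono order_trans[OF norm_triangle_ineq4] add_mono 1 2) auto
      thus "cmod (r n x) \<le> 2 * cmod t ^ (n + 1) / (1 - cmod t)\<^sup>2"
        unfolding r_def norm_divide using Dge[of x] Dpos by (intro frac_le) auto
    qed auto
    ultimately show ?thesis by simp
  qed
  have "(\<lambda>n. 2 * cmod t ^ (n + 1) / (1 - cmod t)\<^sup>2 * (pi - 0)) \<longlonglongrightarrow> 2 * 0 / (1 - cmod t)\<^sup>2 * (pi - 0)"
    using assms by (intro tendsto_intros LIMSEQ_power_zero[THEN LIMSEQ_ignore_initial_segment]) auto
  hence "cmod (integral {0..pi} f - of_real (pi / 2)) \<le> 2 * 0 / (1 - cmod t)\<^sup>2 * (pi - 0)"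
    by (rule LIMSEQ_le_const) (use bound in auto)
  thus ?thesis by (simp add: f_def[abs_def] D_def)
qed

text \<open>With \<open>z = - (w + 1 / w)\<close> the substitution \<open>x = - 2 cos \<theta>\<close> turns \<open>x - z\<close> into
  \<open>(1 - 2 w cos \<theta> + w\<^sup>2) / w\<close>, the Chebyshev kernel.\<close>

lemma m_sc_eq:
  assumes w: "cmod w < 1" "w \<noteq> 0" and z: "z = - (w + 1 / w)" "Im z > 0"
  shows "m_sc z = w"
proof -
  define f where "f x = (1 / (2 * pi) * sqrt (max 0 (4 - x\<^sup>2))) *\<^sub>R (1 / (complex_of_real x - z))" for x :: real
  have nz: "complex_of_real x - z \<noteq> 0" for x using z(2) by auto
  have cont: "continuous_on S f" for S
    unfolding f_def using nz by (intro continuous_intros) auto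
  have "m_sc z = (LINT x|lborel. f x)"
    unfolding m_sc_def stieltjes_def semicircle_def f_def
    by (subst integral_density) auto
  also have "\<dots> = (LINT x:{-2..2}|lborel. f x)"
    unfolding set_lebesgue_integral_def
  proof (intro Bochner_Integration.integral_cong refl)
    fix x :: real
    have "f x = 0" if "x \<notin> {-2..2}"
    proof -
      have "x\<^sup>2 > 2\<^sup>2" using that abs_le_square_iff[of x 2] by auto
      thus ?thesis by (simp add: f_def)
    qed
    thus "f x = indicat_real {-2..2} x *\<^sub>R f x" by (auto simp: indicator_def)
  qed
  also have "\<dots> = integral {-2..2} f"
    by (intro set_borel_integral_eq_integral(2) borel_integrable_atLeastAtMost' cont)
  also have "\<dots> = integral {0..pi} (\<lambda>x. (2 * sin x) *\<^sub>R f (- 2 * cos x))"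
  proof -
    have "((\<lambda>x. (2 * sin x) *\<^sub>R f (- 2 * cos x)) has_integral (integral {- 2 * cos 0..- 2 * cos pi} f)) {0..pi}"
      by (rule has_integral_substitution[where c = "-2" and d = 2])
         (use cos_ge_minus_one in \<open>auto intro!: cont derivative_eq_intros simp: image_subset_iff minus_le_iff\<close>)
    thus ?thesis by (simp add: integral_unique)
  qed
  also have "\<dots> = integral {0..pi} (\<lambda>x. (2 * w / pi) * (complex_of_real (sin x * sin x) / (1 - 2 * w * cos x + w\<^sup>2)))"
  proof (intro integral_cong)
    fix x :: real assume x: "x \<in> {0..pi}"
    have s: "sin x \<ge> 0" using x by (intro sin_ge_zero) auto
    have "4 - (- 2 * cos x)\<^sup>2 = (2 * sin x)\<^sup>2"
      by (simp add: power_mult_distrib sin_squared_eq algebra_simps)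
    hence "sqrt (max 0 (4 - (- 2 * cos x)\<^sup>2)) = 2 * sin x"
      using s real_sqrt_unique[of "2 * sin x"] by (auto simp: max_def)
    moreover have "complex_of_real (- 2 * cos x) - z = (1 - 2 * w * cos x + w\<^sup>2) / w"
      using w(2) by (simp add: z(1) field_simps power2_eq_square)
    ultimately show "(2 * sin x) *\<^sub>R f (- 2 * cos x)
        = (2 * w / pi) * (complex_of_real (sin x * sin x) / (1 - 2 * w * cos x + w\<^sup>2))"
      unfolding f_def by (simp add: scaleR_conv_of_real field_simps)
  qed
  also have "\<dots> = w"
    unfolding integral_mult_right integral_sin_squared_kernel[OF w(1)] by simp
  finally show ?thesis .
qed

text \<open>The two roots of \<open>w\<^sup>2 + z w + 1\<close> have product 1. They cannot both have modulus 1, since then they would be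
  conjugate and their sum \<open>- z\<close> real; so one of them lies in the open unit disc.\<close>

lemma m_sc_properties:
  assumes "Im z > 0"
  shows m_sc_quadratic: "(m_sc z)\<^sup>2 + z * m_sc z + 1 = 0"
    and m_sc_cmod: "cmod (m_sc z) < 1" and m_sc_Im: "Im (m_sc z) > 0"
proof -
  define q where "q = csqrt (z\<^sup>2 - 4)"
  have q2: "q\<^sup>2 = z\<^sup>2 - 4" by (simp add: q_def)
  define a where "a = (- z + q) / 2"
  define b where "b = (- z - q) / 2"
  have ab: "a * b = 1" "a + b = - z"
    using q2 by (auto simp: a_def b_def field_simps power2_eq_square)
  have "cmod a \<noteq> 1"
  proof
    assume "cmod a = 1"
    hence "b = cnj a"
      using ab(1) complex_norm_square[of a]
      by (metis mult_left_cancel mult_zero_left norm_eq_zero of_real_1 power_one zero_neq_one)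
    hence "Im (a + b) = 0" by simp
    thus False using ab(2) assms by simp
  qed
  moreover have "cmod a * cmod b = 1" using ab(1) by (metis norm_mult norm_one)
  ultimately have "cmod a < 1 \<or> cmod b < 1"
    by (smt (verit) mult_le_cancel_left1 norm_ge_zero mult_left_le)
  then obtain w v where w: "cmod w < 1" "w * v = 1" "w + v = - z"
    using ab by (metis add.commute mult.commute)
  have w0: "w \<noteq> 0" using w(2) by auto
  have v: "v = 1 / w" using w(2) w0 by (simp add: field_simps)
  have z: "z = - (w + 1 / w)" using w(3) unfolding v[symmetric] by (metis minus_minus)
  have m: "m_sc z = w" by (rule m_sc_eq[OF w(1) w0 z assms])
  show "(m_sc z)\<^sup>2 + z * m_sc z + 1 = 0"
  proof -
    have "z * w = - (w * w) - 1" using w0 by (subst z) (simp add: field_simps)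
    thus ?thesis unfolding m by (simp add: power2_eq_square)
  qed
  show "cmod (m_sc z) < 1" using m w by simp
  have "Im z = Im w * (1 / (cmod w)\<^sup>2 - 1)"
    by (subst z) (simp add: Im_divide cmod_power2 algebra_simps flip: power2_eq_square)
  moreover have "1 / (cmod w)\<^sup>2 - 1 > 0"
    using w(1) w0 by (simp add: field_simps power_less_one_iff abs_square_less_1)
  ultimately show "Im (m_sc z) > 0" using assms m by (simp add: zero_less_mult_iff)
qed

text \<open>Subtracting the quadratic equations at \<open>z\<close> and \<open>w\<close> gives \<open>(m(w) - m(z)) (1 - m(z) m(w)) =
  m(z) m(w) (w - z)\<close>, and the second factor is at least \<open>1 - |m(z)| > 0\<close> in modulus.\<close>

lemma continuous_on_m_sc: "continuous_on {z. Im z > 0} m_sc"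
proof (intro continuous_at_imp_continuous_on ballI)
  fix z assume "z \<in> {z. Im z > 0}"
  hence z: "Im z > 0" by simp
  let ?m = "m_sc z"
  have pos: "1 - cmod ?m > 0" using m_sc_cmod[OF z] by simp
  have lip: "cmod (m_sc w - ?m) \<le> cmod (w - z) / (1 - cmod ?m)" if w: "Im w > 0" for w
  proof -
    let ?n = "m_sc w"
    have "(?n - ?m) * (1 - ?m * ?n) = ?m * ?n * (w - z)"
    proof -
      have e: "?m * ?m = - z * ?m - 1" "?n * ?n = - w * ?n - 1"
        using m_sc_quadratic[OF z] m_sc_quadratic[OF w]
        by (auto simp: power2_eq_square algebra_simps add_eq_0_iff2)
      have "(?n - ?m) * (1 - ?m * ?n) - ?m * ?n * (w - z)
          = ?n - ?m - ?m * (?n * ?n) + (?m * ?m) * ?n - ?m * ?n * (w - z)"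
        by (simp add: algebra_simps)
      also have "\<dots> = 0" unfolding e by (simp add: algebra_simps)
      finally show ?thesis by simp
    qed
    hence "cmod (?n - ?m) * cmod (1 - ?m * ?n) = cmod ?m * cmod ?n * cmod (w - z)"
      by (metis norm_mult)
    also have "\<dots> \<le> 1 * 1 * cmod (w - z)"
      using m_sc_cmod[OF z] m_sc_cmod[OF w] by (intro mult_mono) auto
    finally have 1: "cmod (?n - ?m) * cmod (1 - ?m * ?n) \<le> cmod (w - z)" by simp
    have "cmod ?m * cmod ?n \<le> cmod ?m * 1"
      using m_sc_cmod[OF w] by (intro mult_left_mono) auto
    hence "1 - cmod ?m \<le> cmod (1 - ?m * ?n)"
      using norm_triangle_ineq2[of 1 "?m * ?n"] by (simp add: norm_mult)
    hence "cmod (?n - ?m) * (1 - cmod ?m) \<le> cmod (w - z)"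
      using 1 by (meson mult_left_mono norm_ge_zero order_trans)
    thus ?thesis using pos by (simp add: field_simps)
  qed
  have ev: "\<forall>\<^sub>F w in at z. w \<in> {z. Im z > 0}"
    using z by (intro eventually_at_in_open' open_halfspace_Im_gt) auto
  have "((\<lambda>w. cmod (w - z) / (1 - cmod ?m)) \<longlongrightarrow> cmod (z - z) / (1 - cmod ?m)) (at z)"
    using pos by (intro tendsto_intros) auto
  hence lim: "((\<lambda>w. cmod (w - z) / (1 - cmod ?m)) \<longlongrightarrow> 0) (at z)" by simp
  have "((\<lambda>w. m_sc w - ?m) \<longlongrightarrow> 0) (at z)"
    by (rule Lim_null_comparison[OF _ lim], rule eventually_mono[OF ev]) (use lip in auto)
  thus "isCont m_sc z"
    unfolding isCont_def by (simp add: LIM_zero_iff)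
qed

section \<open>The local law as a consequence of concentration\<close>

definition minor_res :: "real mat \<Rightarrow> nat \<Rightarrow> complex \<Rightarrow> nat \<Rightarrow> nat \<Rightarrow> complex" where
  "minor_res A i z k l = resolvent (clear_row i A) z $$ (k, l)"

definition quad_fluct :: "nat \<Rightarrow> real mat \<Rightarrow> nat \<Rightarrow> complex \<Rightarrow> complex" where
  "quad_fluct n A i z =
     (\<Sum>k\<in>{..<n}-{i}. \<Sum>l\<in>{..<n}-{i}. of_real (A $$ (i, k)) * minor_res A i z k l * of_real (A $$ (i, l)))
     - (\<Sum>k\<in>{..<n}-{i}. minor_res A i z k k) / of_nat n"

definition minor_frob :: "nat \<Rightarrow> real mat \<Rightarrow> nat \<Rightarrow> complex \<Rightarrow> real" where
  "minor_frob n A i z = sqrt (\<Sum>k\<in>{..<n}-{i}. \<Sum>l\<in>{..<n}-{i}. (cmod (minor_res A i z k l))\<^sup>2)"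

definition lin_fluct :: "nat \<Rightarrow> real mat \<Rightarrow> nat \<Rightarrow> nat \<Rightarrow> complex \<Rightarrow> complex" where
  "lin_fluct n A i j z = (\<Sum>k\<in>{..<n}-{i}. of_real (A $$ (i, k)) * minor_res A i z k j)"

definition minor_col :: "nat \<Rightarrow> real mat \<Rightarrow> nat \<Rightarrow> nat \<Rightarrow> complex \<Rightarrow> real" where
  "minor_col n A i j z = sqrt (\<Sum>k\<in>{..<n}-{i}. (cmod (minor_res A i z k j))\<^sup>2)"

text \<open>Concentration of the entries and of the quadratic and linear forms in each row, on the scales that a row of independent
  entries of variance \<open>1 / n\<close> would give. The additional terms \<open>\<phi> / n\<close> leave room for passing
  from the points of a grid to all \<open>z\<close>.\<close>

definition controlled :: "nat \<Rightarrow> real mat \<Rightarrow> real \<Rightarrow> complex \<Rightarrow> bool" where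
  "controlled n A \<phi> z \<longleftrightarrow>
     (\<forall>i<n. \<bar>A $$ (i, i)\<bar> \<le> \<phi> / sqrt n) \<and>
     (\<forall>i<n. cmod (quad_fluct n A i z) \<le> \<phi> * minor_frob n A i z / n + \<phi> / n) \<and>
     (\<forall>i<n. \<forall>j<n. i \<noteq> j \<longrightarrow>
        cmod (lin_fluct n A i j z) \<le> \<phi> / sqrt n * minor_col n A i j z + \<phi> / n)"

lemma green_minor_res:
  assumes "real_symmetric n A" "Im z > 0" "i < n"
  shows "green ({..<n} - {i}) (\<lambda>j k. A $$ (j, k)) z (minor_res A i z)"
  using green_clear_row[OF assms] by (simp add: minor_res_def[abs_def])

text \<open>Removing an index changes the trace by \<open>\<Sum>\<^sub>k G\<^sub>k\<^sub>i\<^sup>2 / G\<^sub>i\<^sub>i\<close>, and the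
  Ward identity bounds the sum by \<open>Im G\<^sub>i\<^sub>i / Im z\<close>.\<close>

lemma minor_trace:
  assumes A: "real_symmetric n A" and z: "Im z > 0" and i: "i < n"
  defines "T \<equiv> of_nat n * s_emp n A z - (\<Sum>k\<in>{..<n}-{i}. minor_res A i z k k)"
  shows "cmod T \<le> 1 / Im z"
proof -
  let ?G = "\<lambda>j k. resolvent A z $$ (j, k)"
  let ?J = "{..<n} - {i}"
  note sym = real_symmetric_symm_on[OF A]
  note g = resolvent_eq_adj(3)[OF A z]
  have fin: "finite {..<n}" and iS: "i \<in> {..<n}" using i by auto
  note nz = green_diag_nonzero[OF fin sym g z iS]
  note eq = green_minor_eq[OF fin sym g z iS green_minor_res[OF A z i]]
  have "of_nat n * s_emp n A z = (\<Sum>k<n. ?G k k)"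
    using i by (simp add: s_emp_def)
  moreover have "(\<Sum>k\<in>?J. minor_res A i z k k) = (\<Sum>k\<in>?J. ?G k k - ?G k i * ?G i k / ?G i i)"
    by (intro sum.cong refl eq)
  moreover have "\<dots> = (\<Sum>k<n. ?G k k - ?G k i * ?G i k / ?G i i)"
    using nz i by (simp add: sum_diff1)
  ultimately have T: "T = (\<Sum>k<n. ?G k i * ?G k i / ?G i i)"
    unfolding T_def using green_sym[OF fin sym g _ iS] by (simp add: sum_subtractf)
  have "cmod T \<le> (\<Sum>k<n. (cmod (?G k i))\<^sup>2 / cmod (?G i i))"
    unfolding T by (rule order_trans[OF norm_sum]) (simp add: norm_divide norm_mult power2_eq_square)
  also have "\<dots> = (\<Sum>k<n. (cmod (?G k i))\<^sup>2) / cmod (?G i i)" by (simp add: sum_divide_distrib)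
  also have "(\<Sum>k<n. (cmod (?G k i))\<^sup>2) = Im (?G i i) / Im z"
    using green_ward[OF fin sym g iS] z by simp
  also have "\<dots> / cmod (?G i i) = (Im (?G i i) / cmod (?G i i)) / Im z" by simp
  also have "\<dots> \<le> 1 / Im z"
    using z nz abs_Im_le_cmod[of "?G i i"] by (intro divide_right_mono) auto
  finally show ?thesis .
qed

text \<open>By the Ward identity for the minor, its squared Frobenius norm is the imaginary part of its trace divided by \<open>Im
  z\<close>.\<close>

lemma minor_frob_sq:
  assumes A: "real_symmetric n A" and z: "Im z > 0" and i: "i < n"
  shows "(minor_frob n A i z)\<^sup>2 \<le> (n * Im (s_emp n A z) + 1 / Im z) / Im z"
proof -
  let ?J = "{..<n} - {i}"
  have symJ: "symm_on ?J (\<lambda>j k. A $$ (j, k))"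
    by (rule symm_on_subset[OF real_symmetric_symm_on[OF A]]) auto
  note g = green_minor_res[OF A z i]
  have fin: "finite ?J" by simp
  have "(minor_frob n A i z)\<^sup>2 = (\<Sum>k\<in>?J. \<Sum>l\<in>?J. (cmod (minor_res A i z k l))\<^sup>2)"
    by (simp add: minor_frob_def sum_nonneg)
  also have "\<dots> = (\<Sum>l\<in>?J. \<Sum>k\<in>?J. (cmod (minor_res A i z k l))\<^sup>2)" by (rule sum.swap)
  also have "\<dots> = (\<Sum>l\<in>?J. Im (minor_res A i z l l) / Im z)"
    using green_ward[OF fin symJ g] z by (intro sum.cong) auto
  also have "\<dots> = Im (\<Sum>l\<in>?J. minor_res A i z l l) / Im z" by (simp add: sum_divide_distrib)
  also have "\<dots> \<le> (n * Im (s_emp n A z) + 1 / Im z) / Im z"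
  proof (intro divide_right_mono)
    let ?T = "of_nat n * s_emp n A z - (\<Sum>k\<in>?J. minor_res A i z k k)"
    have "- Im ?T \<le> 1 / Im z"
      using minor_trace[OF A z i] abs_Im_le_cmod[of ?T] by linarith
    thus "Im (\<Sum>l\<in>?J. minor_res A i z l l) \<le> n * Im (s_emp n A z) + 1 / Im z" by simp
  qed (use z in simp)
  finally show ?thesis .
qed

text \<open>Schur's formula, with the diagonal entry, the fluctuation of the quadratic form and the change of the trace collected in the
  error.\<close>

lemma self_consistent_entry:
  assumes A: "real_symmetric n A" and z: "Im z > 0" and i: "i < n" and c: "controlled n A \<phi> z" and \<phi>: "0 \<le> \<phi>"
  shows "cmod (1 / resolvent A z $$ (i, i) + z + s_emp n A z)
    \<le> \<phi> / sqrt n + \<phi> * sqrt (Im (s_emp n A z) / (n * Im z) + 1 / (n * Im z)\<^sup>2) + \<phi> / n + 1 / (n * Im z)"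
proof -
  let ?J = "{..<n} - {i}"
  let ?G = "\<lambda>j k. resolvent A z $$ (j, k)"
  let ?s = "s_emp n A z"
  note sym = real_symmetric_symm_on[OF A]
  note g = resolvent_eq_adj(3)[OF A z]
  have fin: "finite {..<n}" and iS: "i \<in> {..<n}" and n: "n > 0" using i by auto
  define T where "T = of_nat n * ?s - (\<Sum>k\<in>?J. minor_res A i z k k)"
  have T: "cmod T \<le> 1 / Im z" unfolding T_def by (rule minor_trace[OF A z i])
  have "(\<Sum>k\<in>?J. minor_res A i z k k) / of_nat n = ?s - T / of_nat n"
    using n by (simp add: T_def field_simps)
  hence "1 / ?G i i + z + ?s = of_real (A $$ (i, i)) - quad_fluct n A i z + T / of_nat n"
    using green_schur_diag[OF fin sym g z iS green_minor_res[OF A z i]]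
    by (simp add: quad_fluct_def)
  hence "cmod (1 / ?G i i + z + ?s) \<le> cmod (of_real (A $$ (i, i)) - quad_fluct n A i z) + cmod (T / of_nat n)"
    by (simp add: norm_triangle_ineq)
  also have "\<dots> \<le> (\<bar>A $$ (i, i)\<bar> + cmod (quad_fluct n A i z)) + cmod T / n"
    by (intro add_mono order_trans[OF norm_triangle_ineq4]) (auto simp: norm_divide)
  also have "\<dots> \<le> (\<phi> / sqrt n + (\<phi> * minor_frob n A i z / n + \<phi> / n)) + (1 / Im z) / n"
    using c i T by (intro add_mono divide_right_mono) (auto simp: controlled_def)
  also have "\<phi> * minor_frob n A i z / n \<le> \<phi> * sqrt (Im ?s / (n * Im z) + 1 / (n * Im z)\<^sup>2)"
  proof -
    have "(minor_frob n A i z / n)\<^sup>2 = (minor_frob n A i z)\<^sup>2 / (n * n)"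
      by (simp add: power_divide power2_eq_square)
    also have "\<dots> \<le> (n * Im ?s + 1 / Im z) / Im z / (n * n)"
      by (intro divide_right_mono minor_frob_sq[OF A z i]) auto
    also have "\<dots> = Im ?s / (n * Im z) + 1 / (n * Im z)\<^sup>2"
      using n z by (simp add: field_simps power2_eq_square)
    finally have "minor_frob n A i z / n \<le> sqrt (Im ?s / (n * Im z) + 1 / (n * Im z)\<^sup>2)"
      by (rule real_le_rsqrt)
    hence "\<phi> * (minor_frob n A i z / n) \<le> \<phi> * sqrt (Im ?s / (n * Im z) + 1 / (n * Im z)\<^sup>2)"
      using \<phi> by (rule mult_left_mono)
    thus ?thesis by simp
  qed
  finally show ?thesis by (simp add: mult.commute)
qed

text \<open>An additive error in \<open>1 / u\<close> becomes an additive error in \<open>u\<close> once \<open>|w|\<close> is bounded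
  below.\<close>

lemma approx_inverse_entry:
  fixes u w :: complex
  assumes u: "u \<noteq> 0" and \<delta>: "cmod (1 / u + w) \<le> \<delta>" "\<delta> \<le> 1 / 4" and w: "3 / 4 \<le> cmod w"
  shows "cmod u \<le> 2" "cmod (u + 1 / w) \<le> 3 * \<delta>"
proof -
  have "cmod w \<le> cmod (1 / u + w) + cmod (1 / u)"
    using norm_triangle_ineq4[of "1 / u + w" "1 / u"] by simp
  hence "1 / 2 \<le> 1 / cmod u" using \<delta> w by (simp add: norm_divide)
  thus u2: "cmod u \<le> 2" using u by (simp add: field_simps)
  have w0: "w \<noteq> 0" using w by auto
  have "u + 1 / w = u * (1 / u + w) * (1 / w)" using u w0 by (simp add: field_simps)
  hence "cmod (u + 1 / w) = cmod u * cmod (1 / u + w) * (1 / cmod w)"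
    by (simp add: norm_mult norm_divide)
  also have "\<dots> \<le> 2 * \<delta> * (4 / 3)"
  proof (intro mult_mono u2 \<delta>(1))
    show "1 / cmod w \<le> 4 / 3" using w frac_le[of 1 1 "3 / 4" "cmod w"] by simp
  qed (use order_trans[OF norm_ge_zero \<delta>(1)] in auto)
  also have "\<dots> \<le> 3 * \<delta>" using order_trans[OF norm_ge_zero \<delta>(1)] by simp
  finally show "cmod (u + 1 / w) \<le> 3 * \<delta>" .
qed

text \<open>A single spectral parameter at which concentration holds and the error scale \<open>\<phi> \<psi>\<close> is small. All
  constants are chosen for convenience.\<close>

locale controlled_point =
  fixes n :: nat and A :: "real mat" and \<phi> \<tau> :: real and z :: complex
  assumes A: "real_symmetric n A" and n: "1 \<le> n" and \<tau>: "0 < \<tau>" "\<tau> < 1"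
    and \<eta>: "0 < Im z" "1 \<le> n * Im z" "Im z \<le> 1 / \<tau>" and E: "\<bar>Re z\<bar> \<le> 1 / \<tau>"
    and \<phi>: "1 \<le> \<phi>" and small: "\<phi> * (1 / sqrt (n * Im z)) \<le> \<tau>\<^sup>2 / 100000"
    and ctrl: "controlled n A \<phi> z"
begin

abbreviation "\<psi> \<equiv> 1 / sqrt (n * Im z)"
abbreviation "G j k \<equiv> resolvent A z $$ (j, k)"
abbreviation "s \<equiv> s_emp n A z"
abbreviation "m \<equiv> m_sc z"

lemma psi: "0 < \<psi>" "\<psi> \<le> 1" "\<psi>\<^sup>2 = 1 / (n * Im z)" "1 / sqrt n \<le> \<psi> / \<tau>" "1 / n \<le> \<psi> / \<tau>"
proof -
  show "0 < \<psi>" "\<psi> \<le> 1" using \<eta> n by auto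
  show "\<psi>\<^sup>2 = 1 / (n * Im z)" using \<eta> by (simp add: power_divide)
  have "sqrt (Im z) \<le> 1 / \<tau>"
  proof (rule real_le_lsqrt)
    have "1 / \<tau> \<le> (1 / \<tau>)\<^sup>2" using \<tau> by (simp add: power2_eq_square field_simps)
    thus "Im z \<le> (1 / \<tau>)\<^sup>2" using \<eta> by linarith
  qed (use \<tau> in auto)
  hence "1 / sqrt n * (sqrt (Im z) / sqrt (Im z)) \<le> 1 / sqrt n * ((1 / \<tau>) / sqrt (Im z))"
    using \<eta> by (intro mult_left_mono divide_right_mono) auto
  thus 1: "1 / sqrt n \<le> \<psi> / \<tau>" using \<eta> n by (simp add: real_sqrt_mult field_simps)
  have "sqrt n * 1 \<le> sqrt n * sqrt n" using n by (intro mult_left_mono) auto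
  hence "sqrt n \<le> n" by simp
  hence "1 / n \<le> 1 / sqrt n" using n by (intro frac_le) auto
  with 1 show "1 / n \<le> \<psi> / \<tau>" by linarith
qed

lemma symA: "symm_on {..<n} (\<lambda>i j. A $$ (i, j))"
  by (rule real_symmetric_symm_on[OF A])

lemma greenA: "green {..<n} (\<lambda>i j. A $$ (i, j)) z G"
  using resolvent_eq_adj(3)[OF A \<eta>(1)] .

lemma G_diag: "i < n \<Longrightarrow> Im (G i i) > 0" "i < n \<Longrightarrow> G i i \<noteq> 0"
  using green_diag_nonzero[OF _ symA greenA \<eta>(1), of i] by auto

lemma Im_s: "Im s > 0"
proof -
  have "Im s = (\<Sum>i<n. Im (G i i)) / n"
    by (simp add: s_emp_def Im_divide_of_nat)
  moreover have "(\<Sum>i<n. Im (G i i)) > 0"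
    using G_diag(1) n by (intro sum_pos) (auto simp: lessThan_empty_iff)
  ultimately show ?thesis using n by simp
qed

lemma s_le: "cmod s \<le> 1 / Im z"
proof -
  have "cmod (\<Sum>i<n. G i i) \<le> (\<Sum>i<n. 1 / Im z)"
    by (rule order_trans[OF norm_sum], intro sum_mono)
       (use green_cmod_le(2)[OF _ symA greenA \<eta>(1)] in auto)
  thus ?thesis using n by (simp add: s_emp_def norm_mult norm_divide field_simps)
qed

text \<open>The bound on \<open>s\<close> enters through \<open>Im s \<le> 5 / 4\<close>, which keeps the Frobenius norm of the minor at
  the scale \<open>n \<psi>\<close>. All other contributions are at most \<open>\<phi> \<psi> / \<tau>\<close>, because
  \<open>Im z \<le> 1 / \<tau>\<close> makes \<open>1 / sqrt n\<close> at most \<open>\<psi> / \<tau>\<close>.\<close>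

lemma error_le:
  assumes s: "cmod s \<le> 5 / 4" and i: "i < n"
  shows "cmod (1 / G i i + (z + s)) \<le> 5 * (\<phi> * \<psi>) / \<tau>"
proof -
  have "Im s / (n * Im z) + 1 / (n * Im z)\<^sup>2 = Im s * \<psi>\<^sup>2 + \<psi>\<^sup>2 * \<psi>\<^sup>2"
    using \<eta> by (simp add: psi(3) power2_eq_square)
  also have "\<dots> \<le> 5 / 4 * \<psi>\<^sup>2 + 1 * \<psi>\<^sup>2"
    using s abs_Im_le_cmod[of s] psi(1,2) by (intro add_mono mult_right_mono) (auto simp: power_le_one)
  also have "\<dots> = (3 / 2 * \<psi>)\<^sup>2" by (simp add: power2_eq_square)
  finally have "sqrt (Im s / (n * Im z) + 1 / (n * Im z)\<^sup>2) \<le> 3 / 2 * \<psi>"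
    using psi(1) by (intro real_le_lsqrt) auto
  hence 1: "\<phi> * sqrt (Im s / (n * Im z) + 1 / (n * Im z)\<^sup>2) \<le> \<phi> * (3 / 2 * \<psi>)"
    using \<phi> by (intro mult_left_mono) auto
  have \<phi>0: "0 \<le> \<phi>" using \<phi> by simp
  note 2 = mult_left_mono[OF psi(4) \<phi>0] mult_left_mono[OF psi(5) \<phi>0]
  have "\<psi> * \<psi> \<le> 1 * \<psi>" using psi by (intro mult_right_mono) auto
  also have "\<dots> \<le> \<phi> * \<psi>" using psi(1) \<phi> by (intro mult_right_mono) auto
  finally have 3: "1 / (n * Im z) \<le> \<phi> * \<psi>" using psi(3) by (simp add: power2_eq_square)
  have q: "0 < \<phi> * \<psi>" using \<phi> psi(1) by simp
  have "\<phi> * \<psi> * \<tau> \<le> \<phi> * \<psi> * 1" using q \<tau> by (intro mult_left_mono) auto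
  hence 4: "\<phi> * \<psi> \<le> \<phi> * \<psi> / \<tau>" by (simp only: pos_le_divide_eq[OF \<tau>(1)] mult_1_right)
  have "cmod (1 / G i i + (z + s)) = cmod (1 / G i i + z + s)" by (simp add: add.assoc)
  also have "\<dots> \<le> \<phi> / sqrt n + \<phi> * sqrt (Im s / (n * Im z) + 1 / (n * Im z)\<^sup>2) + \<phi> / n + 1 / (n * Im z)"
    using \<phi> by (intro self_consistent_entry[OF A \<eta>(1) i ctrl]) auto
  also have "\<dots> \<le> \<phi> * (\<psi> / \<tau>) + \<phi> * (3 / 2 * \<psi>) + \<phi> * (\<psi> / \<tau>) + \<phi> * \<psi>"
    using 1 2 3 by (intro add_mono) auto
  also have "\<dots> = 2 * (\<phi> * \<psi> / \<tau>) + 5 / 2 * (\<phi> * \<psi>)" by (simp add: algebra_simps)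
  also have "\<dots> \<le> 5 * (\<phi> * \<psi> / \<tau>)"
  proof -
    have "2 * X + 5 / 2 * Y \<le> 5 * X" if "Y \<le> X" "0 < Y" for X Y :: real
      using that by linarith
    from this[OF 4 q] show ?thesis .
  qed
  finally show ?thesis by simp
qed

lemma phi_psi_small: "5 * (\<phi> * \<psi>) / \<tau> \<le> 1 / 4" "\<phi> * \<psi> \<le> 1 / 100000" "60 * (\<phi> * \<psi>) / \<tau>\<^sup>2 \<le> 1 / 1500"
proof -
  have t: "\<tau>\<^sup>2 \<le> \<tau>" "\<tau>\<^sup>2 \<le> 1" using \<tau> by (auto simp: power2_eq_square mult_le_one mult_left_le)
  show "\<phi> * \<psi> \<le> 1 / 100000" using small t by simp
  have "\<phi> * \<psi> \<le> \<tau> / 100000" using small t by simp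
  hence "5 * (\<phi> * \<psi>) \<le> 1 / 4 * \<tau>" using \<tau>(1) by linarith
  thus "5 * (\<phi> * \<psi>) / \<tau> \<le> 1 / 4" using \<tau> by (simp only: pos_divide_le_eq)
  have "60 * (\<phi> * \<psi>) \<le> 1 / 1500 * \<tau>\<^sup>2" using small \<tau> zero_le_power2[of \<tau>] by linarith
  thus "60 * (\<phi> * \<psi>) / \<tau>\<^sup>2 \<le> 1 / 1500" using \<tau> by (simp only: pos_divide_le_eq zero_less_power)
qed

lemma entry_bounds:
  assumes s: "cmod s \<le> 5 / 4" and w: "3 / 4 \<le> cmod (z + s)" and i: "i < n"
  shows "cmod (G i i) \<le> 2" "cmod (G i i + 1 / (z + s)) \<le> 15 * (\<phi> * \<psi>) / \<tau>"
  using approx_inverse_entry[OF G_diag(2)[OF i] error_le[OF s i] phi_psi_small(1) w] by auto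

lemma self_consistent:
  assumes s: "cmod s \<le> 5 / 4" and w: "3 / 4 \<le> cmod (z + s)"
  shows "cmod (s\<^sup>2 + z * s + 1) \<le> 60 * (\<phi> * \<psi>) / \<tau>\<^sup>2"
proof -
  have w0: "z + s \<noteq> 0" using w by auto
  have "s + 1 / (z + s) = (\<Sum>i<n. G i i + 1 / (z + s)) / of_nat n"
    using n by (simp add: s_emp_def sum.distrib add_divide_distrib)
  hence "cmod (s + 1 / (z + s)) \<le> (\<Sum>i<n. 15 * (\<phi> * \<psi>) / \<tau>) / n"
    by (simp add: norm_divide del: sum_constant)
       (intro divide_right_mono order_trans[OF norm_sum] sum_mono, use entry_bounds[OF s w] in auto)
  hence 1: "cmod (s + 1 / (z + s)) \<le> 15 * (\<phi> * \<psi>) / \<tau>" using n by simp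
  have "cmod (z + s) \<le> \<bar>Re z\<bar> + \<bar>Im z\<bar> + cmod s"
    by (rule order_trans[OF norm_triangle_ineq add_right_mono[OF cmod_le]])
  also have "\<dots> \<le> 1 / \<tau> + 1 / \<tau> + 5 / 4" using E \<eta> s by (intro add_mono) auto
  also have "\<dots> \<le> 4 / \<tau>" using \<tau> by (simp add: field_simps)
  finally have 2: "cmod (z + s) \<le> 4 / \<tau>" .
  have "s\<^sup>2 + z * s + 1 = (s + 1 / (z + s)) * (z + s)"
    using w0 by (simp add: field_simps power2_eq_square)
  hence "cmod (s\<^sup>2 + z * s + 1) = cmod (s + 1 / (z + s)) * cmod (z + s)" by (simp add: norm_mult)
  also have "\<dots> \<le> 15 * (\<phi> * \<psi>) / \<tau> * (4 / \<tau>)"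
    using 1 2 \<phi> psi(1) \<tau> by (intro mult_mono) auto
  finally show ?thesis by (simp add: power2_eq_square)
qed

text \<open>The entry is \<open>- G\<^sub>i\<^sub>i L\<close> for a linear form \<open>L\<close> in row \<open>i\<close>, whose size is
  governed by \<open>Im R\<^sub>j\<^sub>j\<close> for the minor \<open>R\<close>. Since \<open>R\<^sub>j\<^sub>j =
  G\<^sub>j\<^sub>j - G\<^sub>i\<^sub>i L\<^sup>2\<close>, this is an inequality for \<open>|L|\<close> alone, and it closes
  because \<open>\<phi> \<psi>\<close> is small.\<close>

lemma off_diagonal:
  assumes s: "cmod s \<le> 5 / 4" and w: "3 / 4 \<le> cmod (z + s)" and ij: "i < n" "j < n" "i \<noteq> j"
  shows "cmod (G i j) \<le> 12 * (\<phi> * \<psi>) / \<tau>"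
proof -
  let ?J = "{..<n} - {i}"
  define L where "L = lin_fluct n A i j z"
  define x where "x = cmod L"
  define R where "R = minor_res A i z j j"
  define q where "q = \<phi> * \<psi>"
  have q: "0 < q" "q \<le> 1 / 4" using \<phi> psi(1) phi_psi_small(2) by (auto simp: q_def)
  have fin: "finite {..<n}" and iS: "i \<in> {..<n}" and jJ: "j \<in> ?J" and jS: "j \<in> {..<n}" using ij by auto
  note gm = green_minor_res[OF A \<eta>(1) ij(1)]
  have symJ: "symm_on ?J (\<lambda>j k. A $$ (j, k))" by (rule symm_on_subset[OF symA]) auto
  have finJ: "finite ?J" by simp
  have "L = - (G i j / G i i)"
    unfolding L_def lin_fluct_def by (rule green_schur_row[OF fin symA greenA \<eta>(1) iS gm jJ])
  hence Gij: "G i j = - (G i i * L)" using G_diag(2)[OF ij(1)] by simp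
  have "R = G j j - G j i * G i j / G i i"
    unfolding R_def by (rule green_minor_eq[OF fin symA greenA \<eta>(1) iS gm jJ jJ])
  also have "G j i = G i j" by (rule green_sym[OF fin symA greenA jS iS])
  finally have "R = G j j - G i i * L\<^sup>2"
    using Gij G_diag(2)[OF ij(1)] by (simp add: power2_eq_square)
  hence "cmod R \<le> cmod (G j j) + cmod (G i i) * x\<^sup>2"
    by (metis norm_mult norm_power norm_triangle_ineq4 x_def)
  also have "\<dots> \<le> 2 + 2 * x\<^sup>2"
    using entry_bounds(1)[OF s w] ij by (intro add_mono mult_right_mono) auto
  finally have "Im R \<le> 2 + 2 * x\<^sup>2" using abs_Im_le_cmod[of R] by linarith
  also have "\<dots> \<le> (2 + 2 * x)\<^sup>2" by (simp add: x_def power2_eq_square algebra_simps)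
  finally have sq: "sqrt (Im R) \<le> 2 + 2 * x" by (intro real_le_lsqrt) (auto simp: x_def)
  have "(minor_col n A i j z)\<^sup>2 = Im R / Im z"
    using green_ward[OF finJ symJ gm jJ] \<eta>(1) by (simp add: minor_col_def R_def sum_nonneg)
  hence "minor_col n A i j z = sqrt (Im R / Im z)"
    by (metis minor_col_def real_sqrt_unique real_sqrt_ge_zero sum_nonneg zero_le_power2)
  hence "\<phi> / sqrt n * minor_col n A i j z = q * sqrt (Im R)"
    by (simp add: q_def real_sqrt_mult real_sqrt_divide)
  moreover have "x \<le> \<phi> / sqrt n * minor_col n A i j z + \<phi> / n"
    using ctrl ij unfolding controlled_def x_def L_def by blast
  ultimately have "x \<le> q * sqrt (Im R) + \<phi> / n" by simp
  also have "q * sqrt (Im R) \<le> q * (2 + 2 * x)" using sq q by (intro mult_left_mono) auto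
  also have "\<phi> / n \<le> q / \<tau>" using mult_left_mono[OF psi(5), of \<phi>] \<phi> by (simp add: q_def)
  finally have "x \<le> 2 * q + 2 * q * x + q / \<tau>" by (simp add: algebra_simps)
  also have "2 * q * x \<le> 1 / 2 * x" using q by (intro mult_right_mono) (auto simp: x_def)
  also have "2 * q \<le> 2 * (q / \<tau>)" using q \<tau> by (simp add: field_simps mult_left_le_one_le)
  finally have x: "x \<le> 6 * (q / \<tau>)" by simp
  have "cmod (G i j) = cmod (G i i) * x" by (simp add: Gij norm_mult x_def)
  also have "\<dots> \<le> 2 * (6 * (q / \<tau>))"
    using entry_bounds(1)[OF s w ij(1)] x by (intro mult_mono) (auto simp: x_def)
  finally show ?thesis by (simp add: q_def)
qed

lemma m_facts:
  "m\<^sup>2 + z * m + 1 = 0" "cmod m < 1" "Im m > 0" "m \<noteq> 0" "z + m = - (1 / m)"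
proof -
  show 1: "m\<^sup>2 + z * m + 1 = 0" by (rule m_sc_quadratic[OF \<eta>(1)])
  show "cmod m < 1" "Im m > 0" using m_sc_cmod m_sc_Im \<eta>(1) by auto
  thus m0: "m \<noteq> 0" by auto
  have "m * (z + m) = - 1" using 1 by (simp add: algebra_simps power2_eq_square add_eq_0_iff)
  thus "z + m = - (1 / m)" using m0 by (simp add: field_simps)
qed

text \<open>At \<open>s = m\<close> one has \<open>|z + m| = 1 / |m| \<ge> 1\<close>; the distance \<open>1 / 4\<close> costs at most as
  much.\<close>

lemma near_m:
  assumes "cmod (s - m) \<le> 1 / 4"
  shows "cmod s \<le> 5 / 4" "3 / 4 \<le> cmod (z + s)"
proof -
  show "cmod s \<le> 5 / 4"
    using assms m_facts(2) norm_triangle_ineq[of "s - m" m] by simp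
  have "1 \<le> cmod (z + m)"
    unfolding m_facts(5) using m_facts(2,4) by (simp add: norm_divide)
  also have "cmod (z + m) \<le> cmod (z + s) + cmod (s - m)"
    using norm_triangle_ineq4[of "z + s" "s - m"] by simp
  finally show "3 / 4 \<le> cmod (z + s)" using assms by simp
qed

text \<open>The second root of \<open>w\<^sup>2 + z w + 1\<close>.\<close>

abbreviation "m' \<equiv> - z - m"

lemma roots: "(s - m) * (s - m') = s\<^sup>2 + z * s + 1" "(m - m')\<^sup>2 = z\<^sup>2 - 4"
proof -
  have e: "m * m = - z * m - 1"
    using m_facts(1) by (simp add: power2_eq_square algebra_simps add_eq_0_iff2)
  show "(s - m) * (s - m') = s\<^sup>2 + z * s + 1"
    by (simp add: power2_eq_square algebra_simps e)
  show "(m - m')\<^sup>2 = z\<^sup>2 - 4"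
  proof -
    have "(m - m')\<^sup>2 = 4 * (m\<^sup>2 + z * m + 1) + z\<^sup>2 - 4"
      by (simp add: power2_eq_square algebra_simps)
    thus ?thesis using m_facts(1) by simp
  qed
qed

lemma root_gap: "cmod (m - m') = sqrt (cmod (z\<^sup>2 - 4))"
  by (metis norm_ge_zero norm_power real_sqrt_unique roots(2))

lemma stability:
  assumes "cmod s \<le> 5 / 4" "3 / 4 \<le> cmod (z + s)"
  shows "cmod (s - m) * cmod (s - m') \<le> 60 * (\<phi> * \<psi>) / \<tau>\<^sup>2"
  using self_consistent[OF assms] roots(1) by (metis norm_mult)

text \<open>For \<open>Im z \<ge> 1\<close> the second root lies at distance at least \<open>Im z\<close> from the upper half plane,
  which contains \<open>s\<close>; so \<open>s\<close> can only be close to \<open>m\<close>.\<close>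

lemma high_start:
  assumes "1 \<le> Im z"
  shows "cmod (s - m) \<le> 60 * (\<phi> * \<psi>) / \<tau>\<^sup>2" "1 \<le> cmod (m - m')"
proof -
  have "1 / Im z \<le> 1" using assms by simp
  hence s: "cmod s \<le> 5 / 4" using s_le by linarith
  have "1 \<le> Im (z + s)" using assms Im_s by simp
  hence w: "3 / 4 \<le> cmod (z + s)" using abs_Im_le_cmod[of "z + s"] by linarith
  have "1 \<le> Im (s - m')" using assms Im_s m_facts(3) by simp
  hence 1: "1 \<le> cmod (s - m')" using abs_Im_le_cmod[of "s - m'"] by linarith
  have "cmod (s - m) * 1 \<le> cmod (s - m) * cmod (s - m')" using 1 by (intro mult_left_mono) auto
  also have "\<dots> \<le> 60 * (\<phi> * \<psi>) / \<tau>\<^sup>2" by (rule stability[OF s w])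
  finally show "cmod (s - m) \<le> 60 * (\<phi> * \<psi>) / \<tau>\<^sup>2" by simp
  have "1 \<le> Im (m - m')" using assms m_facts(3) by simp
  thus "1 \<le> cmod (m - m')" using abs_Im_le_cmod[of "m - m'"] by linarith
qed

lemma diagonal:
  assumes f: "cmod (s - m) \<le> 1 / 4" and i: "i < n"
  shows "cmod (G i i - m) \<le> 15 * (\<phi> * \<psi>) / \<tau> + 4 / 3 * cmod (s - m)"
proof -
  note near = near_m[OF f]
  have w0: "z + s \<noteq> 0" using near(2) by auto
  have "m = - (1 / (z + m))" using m_facts(5) by simp
  hence "1 / (z + s) + m = 1 / (z + s) - 1 / (z + m)" by simp
  also have "\<dots> = m * (s - m) * (1 / (z + s))"
    using m_facts(4) w0 unfolding m_facts(5)
    by (simp add: field_simps) (use m_facts(5) m_facts(4) in \<open>simp add: field_simps\<close>)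
  finally have "cmod (1 / (z + s) + m) = cmod m * cmod (s - m) * (1 / cmod (z + s))"
    by (simp add: norm_mult norm_divide)
  also have "\<dots> \<le> 1 * cmod (s - m) * (4 / 3)"
    using m_facts(2) frac_le[of 1 1 "3 / 4" "cmod (z + s)"] near(2) by (intro mult_mono) auto
  finally have 1: "cmod (1 / (z + s) + m) \<le> 4 / 3 * cmod (s - m)" by simp
  have "G i i - m = (G i i + 1 / (z + s)) - (1 / (z + s) + m)" by simp
  hence "cmod (G i i - m) \<le> cmod (G i i + 1 / (z + s)) + cmod (1 / (z + s) + m)"
    by (metis norm_triangle_ineq4)
  with 1 entry_bounds(2)[OF near i] show ?thesis by linarith
qed

end


text \<open>Here \<open>x\<close> is the imaginary part of the spectral parameter, \<open>f = |s - m|\<close>, \<open>a = |m - m'|\<close>, \<open>g = |s - m'|\<close>, and \<open>e\<close> bounds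
  \<open>|s - m| |s - m'|\<close>, but only under the condition \<open>f \<le> 1 / 4\<close>. Where \<open>a\<close> is large compared with \<open>sqrt e\<close>, the values
  between \<open>2 e / a\<close> and \<open>a / 2\<close> are forbidden for \<open>f\<close>; where it is not, \<open>f\<close> is at most \<open>9 sqrt e\<close> for either choice of the
  root. In both cases \<open>f\<close> cannot reach \<open>1 / 4\<close> when \<open>x\<close> decreases continuously from \<open>x1\<close>. Since \<open>a\<close> increases and \<open>e\<close>
  decreases, the region of the first kind is an interval that ends at \<open>x1\<close>.\<close>

lemma gap_bootstrap:
  fixes f a e :: "real \<Rightarrow> real"
  assumes le: "x0 \<le> x1"
    and cf: "continuous_on {x0..x1} f" and ca: "continuous_on {x0..x1} a"
    and ma: "\<And>x y. x0 \<le> x \<Longrightarrow> x \<le> y \<Longrightarrow> y \<le> x1 \<Longrightarrow> a x \<le> a y"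
    and me: "\<And>x y. x0 \<le> x \<Longrightarrow> x \<le> y \<Longrightarrow> y \<le> x1 \<Longrightarrow> e y \<le> e x"
    and e: "\<And>x. x0 \<le> x \<Longrightarrow> x \<le> x1 \<Longrightarrow> 0 < e x" "\<And>x. x0 \<le> x \<Longrightarrow> x \<le> x1 \<Longrightarrow> e x \<le> 1 / 1500"
    and f0: "\<And>x. x0 \<le> x \<Longrightarrow> x \<le> x1 \<Longrightarrow> 0 \<le> f x"
    and H: "\<And>x. x0 \<le> x \<Longrightarrow> x \<le> x1 \<Longrightarrow> f x \<le> 1 / 4 \<Longrightarrow>
              \<exists>g\<ge>0. f x * g \<le> e x \<and> a x \<le> f x + g \<and> f x \<le> a x + g"
    and start: "f x1 < 1 / 4" "f x1 < a x1 / 2"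
  shows "f x0 \<le> 1 / 4 \<and> (8 * sqrt (e x0) < a x0 \<longrightarrow> f x0 \<le> 2 * e x0 / a x0) \<and>
    (a x0 \<le> 8 * sqrt (e x0) \<longrightarrow> f x0 \<le> 9 * sqrt (e x0))"
proof -
  have se: "9 * sqrt (e x) < 1 / 4" if "x0 \<le> x" "x \<le> x1" for x
  proof -
    have "sqrt (e x) \<le> sqrt (1 / 1500)" using e(2)[OF that] by simp
    also have "\<dots> < 1 / 36" by (rule real_less_lsqrt) (auto simp: power2_eq_square)
    finally show ?thesis by simp
  qed
  have low: "f x \<le> 9 * sqrt (e x)" if x: "x0 \<le> x" "x \<le> x1" "f x \<le> 1 / 4" "a x \<le> 8 * sqrt (e x)" for x
  proof (rule ccontr)
    assume neg: "\<not> f x \<le> 9 * sqrt (e x)"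
    obtain g where g: "g \<ge> 0" "f x * g \<le> e x" "f x \<le> a x + g" using H[OF x(1-3)] by auto
    have s0: "sqrt (e x) > 0" using e(1)[OF x(1,2)] by simp
    have "sqrt (e x) < g" "sqrt (e x) < f x" "0 < f x" using neg g(3) x(4) s0 by linarith+
    hence "sqrt (e x) * sqrt (e x) < f x * g"
      using s0 mult_strict_mono[of "sqrt (e x)" "f x" "sqrt (e x)" g] by linarith
    thus False using g(2) e(1)[OF x(1,2)] by simp
  qed
  have high: "f x \<le> 2 * e x / a x" if x: "x0 \<le> x" "x \<le> x1" "f x \<le> 1 / 4" "f x \<le> a x / 2" "0 < a x" for x
  proof -
    obtain g where g: "g \<ge> 0" "f x * g \<le> e x" "a x \<le> f x + g" using H[OF x(1-3)] by auto
    have "f x * (a x / 2) \<le> f x * g" using g(3) x(4) f0[OF x(1,2)] by (intro mult_left_mono) auto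
    thus ?thesis using g(2) x(5) by (simp add: field_simps)
  qed
  have small: "2 * e x / a x < 1 / 4" "2 * e x / a x < a x / 2"
    if x: "x0 \<le> x" "x \<le> x1" "8 * sqrt (e x) < a x" for x
  proof -
    have s0: "sqrt (e x) > 0" using e(1)[OF x(1,2)] by simp
    hence a0: "a x > 0" using x(3) by linarith
    have "64 * e x = (8 * sqrt (e x)) * (8 * sqrt (e x))" using e(1)[OF x(1,2)] by simp
    also have "\<dots> < a x * a x" using x(3) s0 a0 by (intro mult_strict_mono) linarith+
    finally have 1: "64 * e x < a x * a x" .
    thus "2 * e x / a x < a x / 2" using a0 e(1)[OF x(1,2)] by (simp add: field_simps)
    have "e x = sqrt (e x) * sqrt (e x)" using e(1)[OF x(1,2)] by simp
    also have "\<dots> \<le> sqrt (e x) * (a x / 8)" using x(3) s0 by (intro mult_left_mono) auto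
    also have "\<dots> < (1 / 36) * (a x / 8)" using se[OF x(1,2)] a0 by (intro mult_strict_right_mono) auto
    finally show "2 * e x / a x < 1 / 4" using a0 by (simp add: field_simps)
  qed
  have sub: "x \<in> {x0..x1} \<Longrightarrow> continuous_on {x..x1} f \<and> continuous_on {x..x1} a" for x
    using cf ca by (auto intro: continuous_on_subset)
  \<comment> \<open>In the region of separated roots this level lies in the gap and cannot be crossed.\<close>
  have phase1: "f x < min (1 / 4) (a x / 2)" if x: "x0 \<le> x" "x \<le> x1" "8 * sqrt (e x) < a x" for x
  proof (rule ccontr)
    assume neg: "\<not> f x < min (1 / 4) (a x / 2)"
    let ?h = "\<lambda>y. f y - min (1 / 4) (a y / 2)"
    have "continuous_on {x..x1} ?h" using sub[of x] x by (intro continuous_intros) auto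
    moreover have "?h x1 \<le> 0" "0 \<le> ?h x" using neg start by auto
    ultimately obtain y where y: "x \<le> y" "y \<le> x1" "?h y = 0"
      using IVT2'[of ?h x1 0 x] x(2) by auto
    have y': "x0 \<le> y" using x y by simp
    have "sqrt (e y) \<le> sqrt (e x)" using me[OF x(1) y(1,2)] by simp
    hence "8 * sqrt (e y) < a y" using ma[OF x(1) y(1,2)] x(3) by linarith
    moreover from this have "0 < a y"
      using real_sqrt_gt_zero[OF e(1)[OF y' y(2)]] by linarith
    ultimately have "f y < min (1 / 4) (a y / 2)"
      using high[OF y' y(2)] small[OF y' y(2)] y(3) by (auto simp: min_def split: if_splits)
    thus False using y(3) by linarith
  qed
  \<comment> \<open>Outside that region the level \<open>1 / 4\<close> itself cannot be attained.\<close>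
  have phase2: "f x < 1 / 4" if x: "x0 \<le> x" "x \<le> x1" for x
  proof (rule ccontr)
    assume "\<not> f x < 1 / 4"
    then obtain y where y: "x \<le> y" "y \<le> x1" "f y = 1 / 4"
      using IVT2'[of f x1 "1 / 4" x] x(2) sub[of x] x start by auto
    have y': "x0 \<le> y" using x y by simp
    show False
    proof (cases "8 * sqrt (e y) < a y")
      case True
      thus False using phase1[OF y' y(2)] y(3) by simp
    next
      case False
      thus False using low[OF y' y(2)] se[OF y' y(2)] y(3) by simp
    qed
  qed
  have f: "f x0 \<le> 1 / 4" using phase2[of x0] le by simp
  moreover have "f x0 \<le> 2 * e x0 / a x0" if "8 * sqrt (e x0) < a x0"
  proof (rule high)
    have "0 < sqrt (e x0)" using e(1)[of x0] le by simp
    thus "0 < a x0" using that by linarith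
    show "f x0 \<le> a x0 / 2" using phase1[of x0] that le by simp
  qed (use le f in auto)
  moreover have "f x0 \<le> 9 * sqrt (e x0)" if "a x0 \<le> 8 * sqrt (e x0)"
    using low[of x0] that le f by simp
  ultimately show ?thesis by blast
qed

text \<open>Up to constants, both regimes of \<open>gap_bootstrap\<close> are bounded by the single expression \<open>e / sqrt (a\<^sup>2
  + e)\<close>.\<close>

lemma gap_ratio:
  fixes f a e d :: real
  assumes e: "0 < e" and d: "0 < d" "d \<le> a\<^sup>2 + e" and a: "0 \<le> a"
    and hi: "8 * sqrt e < a \<Longrightarrow> f \<le> 2 * e / a" and lo: "a \<le> 8 * sqrt e \<Longrightarrow> f \<le> 9 * sqrt e"
  shows "f \<le> 80 * e / sqrt d"
proof (cases "8 * sqrt e < a")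
  case True
  have s: "0 < sqrt e" using e by simp
  hence a0: "0 < a" using True by linarith
  have "(8 * sqrt e)\<^sup>2 \<le> a\<^sup>2" using True s by (intro power_mono) auto
  hence "64 * e \<le> a\<^sup>2" using e by (simp add: power_mult_distrib)
  moreover have "(2 * a)\<^sup>2 = 4 * a\<^sup>2" by (simp add: power_mult_distrib)
  ultimately have "d \<le> (2 * a)\<^sup>2" using d e zero_le_power2[of a] by linarith
  hence "sqrt d \<le> 2 * a" using a0 by (intro real_le_lsqrt) auto
  hence "2 * e * sqrt d \<le> 80 * e * a" using e a0 mult_left_mono[of "sqrt d" "2 * a" "2 * e"] mult_pos_pos[OF e a0] by linarith
  hence "2 * e / a \<le> 80 * e / sqrt d" using a0 d by (simp add: field_simps)
  with hi[OF True] show ?thesis by linarith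
next
  case False
  have s: "0 < sqrt e" using e by simp
  have "a\<^sup>2 \<le> (8 * sqrt e)\<^sup>2" using False a by (intro power_mono) auto
  hence "a\<^sup>2 \<le> 64 * e" using e by (simp add: power_mult_distrib)
  hence "d \<le> (80 / 9 * sqrt e)\<^sup>2" using d e by (simp add: power_mult_distrib power_divide)
  hence "sqrt d \<le> 80 / 9 * sqrt e" using s by (intro real_le_lsqrt) auto
  hence "9 * sqrt e * sqrt d \<le> 9 * sqrt e * (80 / 9 * sqrt e)" using s by (intro mult_left_mono) auto
  also have "\<dots> = 80 * e" using e by simp
  finally have "9 * sqrt e \<le> 80 * e / sqrt d" using d by (simp add: field_simps)
  with lo False show ?thesis by linarith
qed

text \<open>In \<open>z\<^sup>2 - 4 = (z - 2) (z + 2)\<close> the factor of the distant edge has modulus at least 2, that of the near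
  edge at least \<open>(\<kappa> + Im z) / 2\<close>.\<close>

lemma discriminant:
  assumes "0 < Im z"
  shows "kappa z + Im z \<le> cmod (z\<^sup>2 - 4)"
proof -
  have f: "cmod (z\<^sup>2 - 4) = cmod (z - 2) * cmod (z + 2)"
    by (simp add: power2_eq_square algebra_simps flip: norm_mult)
  have 1: "\<bar>Re z - 2\<bar> \<le> cmod (z - 2)" "\<bar>Im z\<bar> \<le> cmod (z - 2)" "\<bar>Re z + 2\<bar> \<le> cmod (z + 2)" "\<bar>Im z\<bar> \<le> cmod (z + 2)"
    using abs_Re_le_cmod[of "z - 2"] abs_Im_le_cmod[of "z - 2"] abs_Re_le_cmod[of "z + 2"] abs_Im_le_cmod[of "z + 2"]
    by auto
  show ?thesis
  proof (cases "0 \<le> Re z")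
    case True
    have "(kappa z + Im z) / 2 * 2 \<le> cmod (z - 2) * cmod (z + 2)"
      using 1 True assms by (intro mult_mono) (auto simp: kappa_def)
    thus ?thesis using f by simp
  next
    case False
    have "2 * ((kappa z + Im z) / 2) \<le> cmod (z - 2) * cmod (z + 2)"
      using 1 False assms by (intro mult_mono) (auto simp: kappa_def)
    thus ?thesis using f by simp
  qed
qed

lemma discriminant_mono:
  assumes "0 \<le> x" "x \<le> y"
  shows "cmod ((Complex E x)\<^sup>2 - 4) \<le> cmod ((Complex E y)\<^sup>2 - 4)"
proof -
  have f: "cmod (z\<^sup>2 - 4) = cmod (z - 2) * cmod (z + 2)" for z :: complex
    by (simp add: power2_eq_square algebra_simps flip: norm_mult)
  have "x\<^sup>2 \<le> y\<^sup>2" using assms by (intro power_mono) auto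
  thus ?thesis unfolding f
    by (intro mult_mono) (auto simp: cmod_def)
qed

lemma continuous_on_resolvent:
  assumes "real_symmetric n A" "i < n" "j < n"
  shows "continuous_on {z. Im z > 0} (\<lambda>z. resolvent A z $$ (i, j))"
proof (intro continuous_at_imp_continuous_on ballI)
  fix z assume "z \<in> {z. Im z > 0}"
  hence z: "Im z > 0" by simp
  have ev: "\<forall>\<^sub>F w in at z. w \<in> {z. Im z > 0}"
    using z by (intro eventually_at_in_open' open_halfspace_Im_gt) auto
  have "((\<lambda>w. cmod (w - z) / (Im z * Im w)) \<longlongrightarrow> cmod (z - z) / (Im z * Im z)) (at z)"
    using z by (intro tendsto_intros) auto
  hence lim: "((\<lambda>w. cmod (w - z) / (Im z * Im w)) \<longlongrightarrow> 0) (at z)" by simp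
  have "((\<lambda>w. resolvent A w $$ (i, j) - resolvent A z $$ (i, j)) \<longlongrightarrow> 0) (at z)"
    using green_lipschitz[OF _ real_symmetric_symm_on[OF assms(1)] resolvent_eq_adj(3)[OF assms(1)]
        resolvent_eq_adj(3)[OF assms(1)]] z assms
    by (intro Lim_null_comparison[OF _ lim] eventually_mono[OF ev]) auto
  thus "isCont (\<lambda>z. resolvent A z $$ (i, j)) z"
    unfolding isCont_def by (simp add: LIM_zero_iff)
qed

lemma continuous_on_s_emp:
  assumes "real_symmetric n A"
  shows "continuous_on {z. Im z > 0} (s_emp n A)"
  unfolding s_emp_def[abs_def] using assms
  by (intro continuous_intros continuous_on_resolvent) auto

definition rate :: "nat \<Rightarrow> complex \<Rightarrow> real" where
  "rate n z = (1 / sqrt (n * Im z)) / sqrt (kappa z + Im z + 1 / sqrt (n * Im z))"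

definition law_error :: "nat \<Rightarrow> real mat \<Rightarrow> complex \<Rightarrow> real" where
  "law_error N A z = max (Lambda N A z) (cmod (s_emp N A z - m_sc z))"

lemma Lambda_eq:
  "Lambda N A z = Max ((\<lambda>(i, j). cmod (resolvent A z $$ (i, j) - (if i = j then m_sc z else 0))) ` ({..<N} \<times> {..<N}))"
proof -
  have "{f i j | i j. i < N \<and> j < N} = (\<lambda>(i, j). f i j) ` ({..<N} \<times> {..<N})" for f :: "nat \<Rightarrow> nat \<Rightarrow> real"
    by auto
  thus ?thesis unfolding Lambda_def by (rule arg_cong)
qed

lemma law_error_le:
  assumes "1 \<le> N" "cmod (s_emp N A z - m_sc z) \<le> b"
    and "\<forall>i<N. \<forall>j<N. cmod (resolvent A z $$ (i, j) - (if i = j then m_sc z else 0)) \<le> b"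
  shows "law_error N A z \<le> b"
proof -
  have "{..<N} \<times> {..<N} \<noteq> {}" using assms(1) by (auto simp: lessThan_empty_iff)
  hence "Lambda N A z \<le> b" unfolding Lambda_eq using assms(3) by (subst Max_le_iff) auto
  thus ?thesis using assms(2) by (simp add: law_error_def)
qed

text \<open>The path from \<open>Re z + \<i> / \<tau>\<close> down to \<open>z\<close> stays in the domain. On it \<open>|z\<^sup>2 -
  4|\<close> decreases and \<open>\<psi>\<close> increases, as \<open>gap_bootstrap\<close> requires, and the top of the path
  has imaginary part at least 1.\<close>

lemma deterministic_local_law:
  fixes \<tau> \<phi> :: real
  assumes A: "real_symmetric n A" and n: "1 \<le> n" and \<tau>: "0 < \<tau>" "\<tau> < 1" and \<phi>: "1 \<le> \<phi>"
    and small: "\<phi> * real n powr (- \<tau> / 2) \<le> \<tau>\<^sup>2 / 100000"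
    and ctrl: "\<And>z. z \<in> dom_D \<tau> n \<Longrightarrow> controlled n A \<phi> z"
    and z: "z \<in> dom_D \<tau> n"
  shows "law_error n A z \<le> 10000 * \<phi> / \<tau>\<^sup>2 * rate n z"
proof -
  define E where "E = Re z"
  define x0 where "x0 = Im z"
  define x1 where "x1 = 1 / \<tau>"
  define w where "w x = Complex E x" for x
  have zw: "z = w x0" by (simp add: w_def E_def x0_def)
  have lowpos: "0 < 1 / real n powr (1 - \<tau>)" using n by simp
  have x01: "x0 \<le> x1" "1 / real n powr (1 - \<tau>) \<le> x0" "\<bar>E\<bar> \<le> 1 / \<tau>"
    using z by (auto simp: dom_D_def x0_def x1_def E_def)
  have x0: "x0 > 0" using x01 lowpos by linarith
  have wD: "w x \<in> dom_D \<tau> n" if "x0 \<le> x" "x \<le> x1" for x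
    using that x01 by (auto simp: dom_D_def w_def x1_def)
  have cp: "controlled_point n A \<phi> \<tau> (w x)" if x: "x0 \<le> x" "x \<le> x1" for x
  proof
    have "real n powr \<tau> = n * (1 / real n powr (1 - \<tau>))"
      using n by (simp add: powr_diff)
    also have "\<dots> \<le> n * x" using x x01 by (intro mult_left_mono) auto
    finally have nx: "real n powr \<tau> \<le> n * x" .
    have "1 \<le> real n powr \<tau>" using n \<tau> by (simp add: ge_one_powr_ge_zero)
    with nx show "1 \<le> n * Im (w x)" by (simp add: w_def)
    have "real n powr (\<tau> / 2) = sqrt (real n powr \<tau>)"
      using n by (simp add: powr_powr flip: powr_half_sqrt)
    also have "\<dots> \<le> sqrt (n * x)" using nx by simp
    finally have "1 / sqrt (n * x) \<le> 1 / real n powr (\<tau> / 2)"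
      using n by (intro frac_le) auto
    also have "\<dots> = real n powr (- \<tau> / 2)" by (simp add: powr_minus_divide)
    finally have "\<phi> * (1 / sqrt (n * x)) \<le> \<phi> * real n powr (- \<tau> / 2)" using \<phi> by (intro mult_left_mono) auto
    hence "\<phi> * (1 / sqrt (n * x)) \<le> \<tau>\<^sup>2 / 100000" using small by (rule order_trans)
    thus "\<phi> * (1 / sqrt (n * Im (w x))) \<le> \<tau>\<^sup>2 / 100000" by (simp only: w_def complex.sel)
    show "controlled n A \<phi> (w x)" by (intro ctrl wD x)
  qed (use x x01 x0 A n \<tau> \<phi> in \<open>auto simp: w_def x1_def\<close>)
  define f where "f x = cmod (s_emp n A (w x) - m_sc (w x))" for x
  define a where "a x = sqrt (cmod ((w x)\<^sup>2 - 4))" for x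
  define e where "e x = 60 * (\<phi> * (1 / sqrt (n * x))) / \<tau>\<^sup>2" for x :: real
  have wS: "w ` {x0..x1} \<subseteq> {z. Im z > 0}" using x0 by (auto simp: w_def)
  have cw: "continuous_on {x0..x1} w" unfolding w_def by (intro continuous_intros)
  have cf: "continuous_on {x0..x1} f"
    unfolding f_def
    by (intro continuous_intros continuous_on_compose2[OF continuous_on_s_emp[OF A] cw wS]
        continuous_on_compose2[OF continuous_on_m_sc cw wS])
  have ca: "continuous_on {x0..x1} a" unfolding a_def by (intro continuous_intros cw)
  have x1ge: "1 \<le> x1" using \<tau> by (simp add: x1_def)
  have "f x0 \<le> 1 / 4 \<and> (8 * sqrt (e x0) < a x0 \<longrightarrow> f x0 \<le> 2 * e x0 / a x0) \<and>
    (a x0 \<le> 8 * sqrt (e x0) \<longrightarrow> f x0 \<le> 9 * sqrt (e x0))"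
  proof (rule gap_bootstrap[OF x01(1) cf ca])
    show "a x \<le> a y" if "x0 \<le> x" "x \<le> y" "y \<le> x1" for x y
      unfolding a_def w_def using discriminant_mono[of x y E] that x0 by simp
    show "e y \<le> e x" if "x0 \<le> x" "x \<le> y" "y \<le> x1" for x y
      unfolding e_def using that x0 n \<phi> \<tau> by (intro divide_right_mono mult_left_mono frac_le) auto
    fix x assume x: "x0 \<le> x" "x \<le> x1"
    interpret controlled_point n A \<phi> \<tau> "w x" by (rule cp[OF x])
    have ew: "e x = 60 * (\<phi> * (1 / sqrt (n * Im (w x)))) / \<tau>\<^sup>2" by (simp add: e_def w_def)
    show "0 < e x" unfolding ew using psi(1) \<phi> \<tau> by simp
    show "e x \<le> 1 / 1500" unfolding ew by (rule phi_psi_small(3))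
    show "0 \<le> f x" by (simp add: f_def)
    assume fx: "f x \<le> 1 / 4"
    let ?g = "cmod (s - m')"
    have "f x * ?g \<le> e x"
      unfolding f_def ew using fx by (intro stability near_m) (auto simp: f_def)
    moreover have "a x \<le> f x + ?g"
      unfolding a_def f_def root_gap[symmetric]
      using norm_triangle_ineq4[of "s - m'" "s - m"] by (simp add: norm_minus_commute add_ac)
    moreover have "f x \<le> a x + ?g"
      unfolding a_def f_def root_gap[symmetric]
      using norm_triangle_ineq4[of "s - m'" "m - m'"] by simp
    ultimately show "\<exists>g\<ge>0. f x * g \<le> e x \<and> a x \<le> f x + g \<and> f x \<le> a x + g" by (intro exI[of _ ?g]) auto
  next
    interpret controlled_point n A \<phi> \<tau> "w x1" by (rule cp) (use x01 in auto)
    have hs: "f x1 \<le> 1 / 1500" "1 \<le> a x1"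
      using high_start phi_psi_small(3) x1ge unfolding f_def a_def root_gap[symmetric] by (auto simp: w_def)
    show "f x1 < 1 / 4" "f x1 < a x1 / 2" using hs by auto
  qed
  hence main: "f x0 \<le> 1 / 4" "8 * sqrt (e x0) < a x0 \<Longrightarrow> f x0 \<le> 2 * e x0 / a x0"
    "a x0 \<le> 8 * sqrt (e x0) \<Longrightarrow> f x0 \<le> 9 * sqrt (e x0)" by auto
  interpret controlled_point n A \<phi> \<tau> "z" using cp[of x0] x01 zw by simp
  have e0: "e x0 = 60 * (\<phi> * \<psi>) / \<tau>\<^sup>2" by (simp add: e_def x0_def)
  define d where "d = kappa z + Im z + \<psi>"
  have d0: "0 < d" unfolding d_def kappa_def using psi(1) \<eta>(1) by (intro add_nonneg_pos) auto
  have rate: "rate n z = \<psi> / sqrt d" by (simp add: rate_def d_def)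
  have t1: "\<tau>\<^sup>2 \<le> \<tau>" "\<tau>\<^sup>2 \<le> 1" using \<tau> by (auto simp: power2_eq_square mult_le_one mult_left_le)
  have q0: "0 < \<phi> * \<psi>" using \<phi> psi(1) by simp
  have "f x0 \<le> 80 * e x0 / sqrt d"
  proof (rule gap_ratio[OF _ d0 _ _ main(2,3)])
    show "0 < e x0" unfolding e0 by (rule divide_pos_pos) (use q0 in linarith, use \<tau> in simp)
    show "0 \<le> a x0" by (simp add: a_def)
    have "1 * \<psi> \<le> \<phi> * \<psi>" using psi(1) \<phi> by (intro mult_right_mono) auto
    also have "\<dots> \<le> 60 * (\<phi> * \<psi>)" using q0 by linarith
    also have "\<dots> \<le> 60 * (\<phi> * \<psi>) / \<tau>\<^sup>2"
      using frac_le[of "60 * (\<phi> * \<psi>)" "60 * (\<phi> * \<psi>)" "\<tau>\<^sup>2" 1] q0 t1 \<tau> by (simp only: div_by_1) simp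
    finally have "\<psi> \<le> e x0" unfolding e0 by simp
    moreover have "kappa z + Im z \<le> (a x0)\<^sup>2"
      using discriminant[OF \<eta>(1)] by (simp add: a_def zw)
    ultimately show "d \<le> (a x0)\<^sup>2 + e x0" by (simp add: d_def)
  qed
  also have "80 * e x0 / sqrt d = 4800 * \<phi> / \<tau>\<^sup>2 * rate n z" by (simp add: e0 rate)
  finally have fin: "cmod (s - m) \<le> 4800 * (\<phi> / \<tau>\<^sup>2 * rate n z)" by (simp add: f_def zw)
  have r0: "0 \<le> \<phi> / \<tau>\<^sup>2 * rate n z" unfolding rate using \<phi> psi(1) d0 by simp
  have trace: "cmod (s - m) \<le> 10000 * \<phi> / \<tau>\<^sup>2 * rate n z"
    using fin r0 by (simp add: mult.assoc)
  have psir: "\<phi> * \<psi> / \<tau> \<le> 5 * (\<phi> / \<tau>\<^sup>2 * rate n z)"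
  proof -
    have "kappa z \<le> 1 / \<tau> + 2" using E by (auto simp: kappa_def)
    hence "d \<le> 1 / \<tau> + 2 + 1 / \<tau> + 1" using \<eta>(3) psi(2) by (simp add: d_def)
    also have "\<dots> \<le> 5 / \<tau>" using \<tau> by (simp add: field_simps)
    also have "\<dots> \<le> (5 / \<tau>)\<^sup>2" using \<tau> by (simp add: power2_eq_square field_simps)
    finally have "sqrt d \<le> 5 / \<tau>" using \<tau> by (intro real_le_lsqrt) auto
    hence "rate n z * sqrt d \<le> rate n z * (5 / \<tau>)"
      unfolding rate using psi(1) d0 by (intro mult_left_mono) auto
    moreover have "rate n z * sqrt d = \<psi>" unfolding rate using d0 by simp
    ultimately have "\<psi> \<le> 5 / \<tau> * rate n z" by (simp only: mult.commute)
    hence "\<phi> / \<tau> * \<psi> \<le> \<phi> / \<tau> * (5 / \<tau> * rate n z)"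
      using \<phi> \<tau> by (intro mult_left_mono) auto
    thus ?thesis by (simp add: power2_eq_square mult_ac)
  qed
  have f4: "cmod (s - m) \<le> 1 / 4" using main(1) by (simp add: f_def zw)
  have entries: "cmod (resolvent A z $$ (i, j) - (if i = j then m_sc z else 0)) \<le> 10000 * \<phi> / \<tau>\<^sup>2 * rate n z"
    if ij: "i < n" "j < n" for i j
  proof (cases "i = j")
    case True
    have "cmod (G i i - m) \<le> 15 * (\<phi> * \<psi> / \<tau>) + 4 / 3 * cmod (s - m)"
      using diagonal[OF f4 ij(1)] by simp
    also have "\<dots> \<le> 10000 * (\<phi> / \<tau>\<^sup>2 * rate n z)" using psir fin r0 by linarith
    finally show ?thesis using True by (simp add: mult.assoc)
  next
    case False
    have "cmod (G i j) \<le> 12 * (\<phi> * \<psi> / \<tau>)"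
      using off_diagonal[OF near_m[OF f4] ij False] by simp
    also have "\<dots> \<le> 10000 * (\<phi> / \<tau>\<^sup>2 * rate n z)" using psir r0 by linarith
    finally show ?thesis using False by (simp add: mult.assoc)
  qed
  show ?thesis by (intro law_error_le[OF n trace] allI impI entries)
qed

section \<open>Moments of linear and quadratic forms in independent variables\<close>

lemma abs_mult_power_interpolate:
  fixes x y :: real
  assumes "2 \<le> j" "j \<le> 2 * p"
  shows "\<bar>x\<bar> ^ j * \<bar>y\<bar> ^ (2 * p - j) \<le> x ^ 2 * y ^ (2 * p - 2) + x ^ (2 * p)"
proof (cases "\<bar>x\<bar> \<le> \<bar>y\<bar>")
  case True
  have "\<bar>x\<bar> ^ j = \<bar>x\<bar> ^ 2 * \<bar>x\<bar> ^ (j - 2)"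
    using assms power_add[of "\<bar>x\<bar>" 2 "j - 2"] by (simp only: le_add_diff_inverse)
  hence "\<bar>x\<bar> ^ j * \<bar>y\<bar> ^ (2 * p - j) = \<bar>x\<bar> ^ 2 * (\<bar>x\<bar> ^ (j - 2) * \<bar>y\<bar> ^ (2 * p - j))"
    by (simp add: mult.assoc)
  also have "\<dots> \<le> \<bar>x\<bar> ^ 2 * (\<bar>y\<bar> ^ (j - 2) * \<bar>y\<bar> ^ (2 * p - j))"
    using True by (intro mult_left_mono mult_right_mono power_mono) auto
  also have "\<bar>y\<bar> ^ (j - 2) * \<bar>y\<bar> ^ (2 * p - j) = \<bar>y\<bar> ^ (2 * p - 2)"
    using assms by (simp flip: power_add)
  also have "\<bar>y\<bar> ^ (2 * p - 2) = y ^ (2 * p - 2)" by (intro power_even_abs) auto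
  also have "\<bar>x\<bar> ^ 2 * y ^ (2 * p - 2) \<le> x ^ 2 * y ^ (2 * p - 2) + x ^ (2 * p)" by simp
  finally show ?thesis .
next
  case False
  have "\<bar>x\<bar> ^ j * \<bar>y\<bar> ^ (2 * p - j) \<le> \<bar>x\<bar> ^ j * \<bar>x\<bar> ^ (2 * p - j)"
    using False by (intro mult_left_mono power_mono) auto
  also have "\<dots> = \<bar>x\<bar> ^ (2 * p)" using assms by (simp flip: power_add)
  also have "\<dots> = x ^ (2 * p)" by (intro power_even_abs) auto
  also have "\<dots> \<le> x ^ 2 * y ^ (2 * p - 2) + x ^ (2 * p)" by (simp add: zero_le_even_power)
  finally show ?thesis .
qed

text \<open>Binomial expansion with all terms of order at least 2 in \<open>w L\<close> collected into the two extreme ones. The linear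
  term is kept exactly, as it has mean zero for centred \<open>w\<close>.\<close>

lemma binomial_second_order:
  fixes S L w :: real
  assumes "1 \<le> p"
  shows "(S + w * L) ^ (2 * p) \<le> S ^ (2 * p) + real (2 * p) * S ^ (2 * p - 1) * L * w
           + 4 ^ p * (1 + w ^ (2 * p)) * (S ^ (2 * p - 2) * L ^ 2 + L ^ (2 * p))"
proof -
  define q where "q = 2 * p"
  have q: "q \<ge> 2" using assms by (simp add: q_def)
  let ?X = "S ^ (q - 2) * L ^ 2 + L ^ q"
  let ?t = "\<lambda>j. real (q choose j) * (w * L) ^ j * S ^ (q - j)"
  have X0: "?X \<ge> 0" by (simp add: q_def zero_le_even_power)
  have w2: "w ^ 2 \<le> 1 + w ^ q"
  proof (cases "\<bar>w\<bar> \<le> 1")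
    case True
    hence "w ^ 2 \<le> 1" by (simp add: abs_square_le_1)
    thus ?thesis by (simp add: q_def zero_le_even_power add_increasing2)
  next
    case False
    hence "\<bar>w\<bar> ^ 2 \<le> \<bar>w\<bar> ^ q" using q by (intro power_increasing) auto
    thus ?thesis by (simp add: q_def power_even_abs)
  qed
  have summand: "?t j \<le> real (q choose j) * ((1 + w ^ q) * ?X)" if "j \<in> {2..q}" for j
  proof -
    have "(w * L) ^ j * S ^ (q - j) \<le> \<bar>w * L\<bar> ^ j * \<bar>S\<bar> ^ (q - j)"
      by (metis abs_ge_self abs_mult power_abs)
    also have "\<dots> \<le> (w * L) ^ 2 * S ^ (q - 2) + (w * L) ^ q"
      using abs_mult_power_interpolate[of j p "w * L" S] that by (simp add: q_def)
    also have "\<dots> = w ^ 2 * (S ^ (q - 2) * L ^ 2) + w ^ q * L ^ q"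
      by (simp add: power_mult_distrib)
    also have "\<dots> \<le> (1 + w ^ q) * (S ^ (q - 2) * L ^ 2) + (1 + w ^ q) * L ^ q"
      using w2 by (intro add_mono mult_right_mono) (auto simp: q_def zero_le_even_power)
    also have "\<dots> = (1 + w ^ q) * ?X" by (simp add: algebra_simps)
    finally show ?thesis by (simp add: mult.assoc mult_left_mono)
  qed
  have "(S + w * L) ^ q = (w * L + S) ^ q" by (simp add: add.commute)
  also have "\<dots> = (\<Sum>j\<le>q. ?t j)" by (subst binomial_ring) simp
  also have "{..q} = {0, 1} \<union> {2..q}" using q by auto
  also have "(\<Sum>j\<in>\<dots>. ?t j) = S ^ q + real q * S ^ (q - 1) * L * w + (\<Sum>j\<in>{2..q}. ?t j)"
    by (subst sum.union_disjoint) (auto simp: mult_ac)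
  also have "(\<Sum>j\<in>{2..q}. ?t j) \<le> (\<Sum>j\<in>{2..q}. real (q choose j) * ((1 + w ^ q) * ?X))"
    by (intro sum_mono summand)
  also have "\<dots> \<le> (\<Sum>j\<le>q. real (q choose j) * ((1 + w ^ q) * ?X))"
    using X0 by (intro sum_mono2) (auto simp: q_def zero_le_even_power)
  also have "\<dots> = 4 ^ p * (1 + w ^ q) * ?X"
  proof -
    have "(\<Sum>j\<le>q. real (q choose j)) = 2 ^ q"
      using choose_row_sum[of q] by (metis of_nat_numeral of_nat_power of_nat_sum)
    thus ?thesis by (simp add: q_def power_mult mult.assoc flip: sum_distrib_right)
  qed
  finally show ?thesis by (simp add: q_def)
qed

text \<open>Young's inequality in the form that a discrete Gronwall argument can absorb: the weight \<open>a\<close> will be the share of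
  one index in the total variance.\<close>

lemma split_second_order:
  fixes S L a :: real
  assumes "1 \<le> p" "0 < a" "a \<le> 1"
  shows "S ^ (2 * p - 2) * L ^ 2 + L ^ (2 * p) \<le> a * S ^ (2 * p) + 2 * (L ^ (2 * p) / a ^ (p - 1))"
proof -
  have L0: "0 \<le> L ^ (2 * p)" "0 \<le> S ^ (2 * p)" by (simp_all add: zero_le_even_power)
  have "a ^ (p - 1) \<le> 1" using assms by (intro power_le_one) auto
  hence 1: "L ^ (2 * p) \<le> L ^ (2 * p) / a ^ (p - 1)"
    using L0 assms by (simp add: field_simps mult_left_le_one_le)
  obtain r where r: "p = Suc r" using assms(1) by (cases p) auto
  have "S ^ (2 * p - 2) * L ^ 2 \<le> a * S ^ (2 * p) + L ^ (2 * p) / a ^ (p - 1)"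
  proof (cases "L ^ 2 \<le> a * S ^ 2")
    case True
    hence "S ^ (2 * p - 2) * L ^ 2 \<le> S ^ (2 * p - 2) * (a * S ^ 2)"
      by (intro mult_left_mono) (auto simp: zero_le_even_power)
    also have "\<dots> = a * S ^ (2 * p)" by (simp add: r power2_eq_square)
    also have "\<dots> \<le> a * S ^ (2 * p) + L ^ (2 * p) / a ^ (p - 1)" using L0 assms by simp
    finally show ?thesis .
  next
    case False
    hence "S ^ 2 \<le> L ^ 2 / a" using assms by (simp add: field_simps)
    hence "(S ^ 2) ^ r \<le> (L ^ 2 / a) ^ r" by (intro power_mono) auto
    hence "(S ^ 2) ^ r * L ^ 2 \<le> (L ^ 2 / a) ^ r * L ^ 2" by (intro mult_right_mono) auto
    also have "(S ^ 2) ^ r = S ^ (2 * p - 2)" by (simp add: r flip: power_mult)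
    also have "(L ^ 2 / a) ^ r * L ^ 2 = L ^ (2 * p) / a ^ (p - 1)"
      by (simp add: r power_divide flip: power_mult power_add)
    also have "\<dots> \<le> a * S ^ (2 * p) + L ^ (2 * p) / a ^ (p - 1)" using L0 assms by simp
    finally show ?thesis .
  qed
  with 1 show ?thesis by linarith
qed

definition centred_with_moment :: "real measure \<Rightarrow> (real \<Rightarrow> real) \<Rightarrow> nat \<Rightarrow> real \<Rightarrow> bool" where
  "centred_with_moment P w p K \<longleftrightarrow> prob_space P \<and> sets P = sets borel \<and> w \<in> borel_measurable borel \<and>
     integrable P w \<and> (\<integral>y. w y \<partial>P) = 0 \<and>
     integrable P (\<lambda>y. w y ^ (2 * p)) \<and> (\<integral>y. w y ^ (2 * p) \<partial>P) \<le> K"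

lemma centred_affine_moment:
  assumes c: "centred_with_moment P w p K" and p: "1 \<le> p" and a: "0 < a" "a \<le> 1"
  shows "(\<integral>\<^sup>+y. ennreal ((S + w y * L) ^ (2 * p)) \<partial>P)
     \<le> ennreal (1 + 4 ^ p * (1 + K) * a) * ennreal (S ^ (2 * p))
       + ennreal (2 * (4 ^ p * (1 + K)) / a ^ (p - 1)) * ennreal (L ^ (2 * p))"
proof -
  interpret prob_space P using c by (simp add: centred_with_moment_def)
  let ?X = "S ^ (2 * p - 2) * L ^ 2 + L ^ (2 * p)"
  let ?f = "\<lambda>y. S ^ (2 * p) + real (2 * p) * S ^ (2 * p - 1) * L * w y + 4 ^ p * (1 + w y ^ (2 * p)) * ?X"
  have int: "integrable P w" "integrable P (\<lambda>y. w y ^ (2 * p))"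
    and w0: "(\<integral>y. w y \<partial>P) = 0" and K: "(\<integral>y. w y ^ (2 * p) \<partial>P) \<le> K"
    using c by (auto simp: centred_with_moment_def)
  have "0 \<le> (\<integral>y. w y ^ (2 * p) \<partial>P)" by (intro integral_nonneg_AE) (simp add: zero_le_even_power)
  hence K0: "K \<ge> 0" using K by linarith
  have nn: "0 \<le> S ^ (2 * p)" "0 \<le> L ^ (2 * p)" "0 \<le> ?X" by (simp_all add: zero_le_even_power)
  have le: "(S + w y * L) ^ (2 * p) \<le> ?f y" for y by (rule binomial_second_order[OF p])
  have intf: "integrable P ?f"
    using int by (intro Bochner_Integration.integrable_add integrable_mult_right integrable_mult_left) auto
  have "(\<integral>\<^sup>+y. ennreal ((S + w y * L) ^ (2 * p)) \<partial>P) \<le> (\<integral>\<^sup>+y. ennreal (?f y) \<partial>P)"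
    by (intro nn_integral_mono ennreal_leI le)
  also have "\<dots> = ennreal (\<integral>y. ?f y \<partial>P)"
    by (intro nn_integral_eq_integral intf AE_I2 order_trans[OF _ le]) (simp add: zero_le_even_power)
  also have "(\<integral>y. ?f y \<partial>P) = S ^ (2 * p) + 4 ^ p * (1 + (\<integral>y. w y ^ (2 * p) \<partial>P)) * ?X"
    using int w0 by (simp add: prob_space)
  also have "\<dots> \<le> S ^ (2 * p) + 4 ^ p * (1 + K) * (a * S ^ (2 * p) + 2 * (L ^ (2 * p) / a ^ (p - 1)))"
    using K K0 nn split_second_order[OF p a, of S L] by (intro add_left_mono mult_mono) auto
  also have "\<dots> = (1 + 4 ^ p * (1 + K) * a) * S ^ (2 * p) + 2 * (4 ^ p * (1 + K)) / a ^ (p - 1) * L ^ (2 * p)"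
    by (simp add: algebra_simps)
  finally show ?thesis using nn a K0
    by (simp add: ennreal_leI ennreal_mult'' flip: ennreal_plus ennreal_mult'')
qed

abbreviation iid :: "'i set \<Rightarrow> 'a measure \<Rightarrow> ('i \<Rightarrow> 'a) measure" where
  "iid I P \<equiv> PiM I (\<lambda>_. P)"

lemma product_prob: "prob_space P \<Longrightarrow> product_prob_space (\<lambda>_. P)"
  by (simp add: product_prob_space.intro product_prob_space_axioms.intro
      product_sigma_finite_def prob_space_imp_sigma_finite)

text \<open>The factors \<open>1 + c a\<close> of the successive steps multiply to at most \<open>exp c\<close>, since the shares
  \<open>a\<close> add up to at most 1.\<close>

lemma gronwall_step:
  fixes c \<kappa> A a :: real
  assumes "0 \<le> \<kappa>"
  shows "(1 + c * a) * (\<kappa> * (exp (c * A) - 1)) + \<kappa> * (c * a) \<le> \<kappa> * (exp (c * (A + a)) - 1)"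
proof -
  have "(1 + c * a) * exp (c * A) \<le> exp (c * a) * exp (c * A)"
    by (intro mult_right_mono) (auto simp: add.commute intro: exp_ge_add_one_self)
  also have "\<dots> = exp (c * (A + a))" by (simp add: algebra_simps flip: exp_add)
  finally have "\<kappa> * ((1 + c * a) * exp (c * A)) \<le> \<kappa> * exp (c * (A + a))"
    using assms by (intro mult_left_mono) auto
  thus ?thesis by (simp add: algebra_simps)
qed

text \<open>One new variable turns \<open>S\<close> into \<open>S + w L\<close> with \<open>w\<close> centred and independent of
  \<open>S\<close> and \<open>L\<close>. With the weight \<open>a\<close> equal to the share of the new variable in the total
  variance, a moment bound of order \<open>\<kappa>\<close> is propagated. Linear and quadratic forms are both instances.\<close>

lemma martingale_step:
  fixes F S L :: "('i \<Rightarrow> real) \<Rightarrow> real"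
  assumes c: "centred_with_moment P w p K" and p: "1 \<le> p"
    and R: "finite R" "r \<notin> R"
    and [measurable]: "F \<in> borel_measurable (iid (insert r R) P)"
      "S \<in> borel_measurable (iid R P)" "L \<in> borel_measurable (iid R P)"
    and F: "\<And>x y. F (x(r := y)) = S x + w y * L x"
    and a: "0 \<le> a" "a \<le> 1" and \<kappa>: "0 \<le> \<kappa>" and A: "0 \<le> A"
    and S: "(\<integral>\<^sup>+x. ennreal (S x ^ (2 * p)) \<partial>iid R P) \<le> ennreal (\<kappa> * (exp (4 ^ p * (1 + K) * A) - 1))"
    and L: "(\<integral>\<^sup>+x. ennreal (L x ^ (2 * p)) \<partial>iid R P) \<le> ennreal (\<kappa> / 2 * a ^ p)"
    and L0: "a = 0 \<Longrightarrow> L = (\<lambda>_. 0)"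
  shows "(\<integral>\<^sup>+x. ennreal (F x ^ (2 * p)) \<partial>iid (insert r R) P)
           \<le> ennreal (\<kappa> * (exp (4 ^ p * (1 + K) * (A + a)) - 1))"
proof -
  have prob: "prob_space P" using c by (simp add: centred_with_moment_def)
  interpret P: prob_space P by fact
  interpret Q: product_prob_space "\<lambda>_. P" by (rule product_prob[OF prob])
  let ?c = "4 ^ p * (1 + K)"
  have "0 \<le> (\<integral>y. w y ^ (2 * p) \<partial>P)" by (intro integral_nonneg_AE) (simp add: zero_le_even_power)
  hence K0: "K \<ge> 0" using c unfolding centred_with_moment_def by linarith
  have eq: "(\<integral>\<^sup>+x. ennreal (F x ^ (2 * p)) \<partial>iid (insert r R) P)
     = (\<integral>\<^sup>+x. \<integral>\<^sup>+y. ennreal ((S x + w y * L x) ^ (2 * p)) \<partial>P \<partial>iid R P)"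
    by (subst Q.product_nn_integral_insert[OF R]) (simp_all add: F)
  show ?thesis
  proof (cases "a = 0")
    case True
    thus ?thesis using S by (simp add: eq L0 P.emeasure_space_1)
  next
    case False
    hence a0: "0 < a" using a by simp
    have "(\<integral>\<^sup>+x. \<integral>\<^sup>+y. ennreal ((S x + w y * L x) ^ (2 * p)) \<partial>P \<partial>iid R P)
       \<le> (\<integral>\<^sup>+x. ennreal (1 + ?c * a) * ennreal (S x ^ (2 * p))
           + ennreal (2 * ?c / a ^ (p - 1)) * ennreal (L x ^ (2 * p)) \<partial>iid R P)"
      by (intro nn_integral_mono centred_affine_moment[OF c p a0 a(2)])
    also have "\<dots> = ennreal (1 + ?c * a) * (\<integral>\<^sup>+x. ennreal (S x ^ (2 * p)) \<partial>iid R P)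
           + ennreal (2 * ?c / a ^ (p - 1)) * (\<integral>\<^sup>+x. ennreal (L x ^ (2 * p)) \<partial>iid R P)"
      by (simp add: nn_integral_add nn_integral_cmult)
    also have "\<dots> \<le> ennreal (1 + ?c * a) * ennreal (\<kappa> * (exp (?c * A) - 1))
           + ennreal (2 * ?c / a ^ (p - 1)) * ennreal (\<kappa> / 2 * a ^ p)"
      by (intro add_mono mult_left_mono S L) auto
    also have "\<dots> = ennreal ((1 + ?c * a) * (\<kappa> * (exp (?c * A) - 1)) + 2 * ?c / a ^ (p - 1) * (\<kappa> / 2 * a ^ p))"
      using a0 K0 \<kappa> A by (simp add: ennreal_mult'' flip: ennreal_plus ennreal_mult'')
    also have "2 * ?c / a ^ (p - 1) * (\<kappa> / 2 * a ^ p) = \<kappa> * (?c * a)"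
      using a0 p by (cases p) (auto simp: field_simps)
    also have "ennreal ((1 + ?c * a) * (\<kappa> * (exp (?c * A) - 1)) + \<kappa> * (?c * a))
        \<le> ennreal (\<kappa> * (exp (?c * (A + a)) - 1))"
      using a0 K0 \<kappa> A by (intro ennreal_leI gronwall_step) auto
    finally show ?thesis unfolding eq .
  qed
qed


text \<open>The constant that the Gronwall argument yields for linear forms.\<close>

definition moment_factor :: "nat \<Rightarrow> real \<Rightarrow> real" where
  "moment_factor p K = 2 * (exp (4 ^ p * (1 + K)) - 1)"

lemma moment_factor_nonneg: "0 \<le> K \<Longrightarrow> 0 \<le> moment_factor p K"
  by (simp add: moment_factor_def)

lemma centred_moment_nonneg:
  assumes "centred_with_moment P w p K" shows "0 \<le> K"
proof -
  have "0 \<le> (\<integral>y. w y ^ (2 * p) \<partial>P)" by (intro integral_nonneg_AE) (simp add: zero_le_even_power)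
  thus ?thesis using assms unfolding centred_with_moment_def by linarith
qed

lemma centred_measurable:
  assumes "centred_with_moment P w p K" shows "w \<in> borel_measurable P" "prob_space P"
  using assms measurable_cong_sets[of P borel borel borel] by (auto simp: centred_with_moment_def)

lemma exp_scaled_le:
  assumes "0 \<le> \<kappa>" "0 \<le> c" "A \<le> 1"
  shows "\<kappa> * (exp (c * A) - 1) \<le> \<kappa> * (exp c - (1::real))"
proof -
  have "c * A \<le> c * 1" using assms by (intro mult_left_mono) auto
  thus ?thesis using assms by (intro mult_left_mono) auto
qed

text \<open>Here \<open>L\<close> is the constant \<open>v r\<close> and the share of \<open>r\<close> is \<open>(v r)\<^sup>2 /
  s\<close>.\<close>

lemma linear_form_moment:
  fixes v :: "'i \<Rightarrow> real"
  assumes c: "centred_with_moment P w p K" and p: "1 \<le> p" and R: "finite R"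
  shows "(\<integral>\<^sup>+x. ennreal ((\<Sum>k\<in>R. v k * w (x k)) ^ (2 * p)) \<partial>iid R P)
           \<le> ennreal (moment_factor p K * (\<Sum>k\<in>R. (v k)\<^sup>2) ^ p)"
proof (cases "(\<Sum>k\<in>R. (v k)\<^sup>2) = 0")
  case True
  hence "\<forall>k\<in>R. v k = 0" using R by (simp add: sum_nonneg_eq_0_iff)
  thus ?thesis using p by (simp add: power_0_left)
next
  case False
  define s where "s = (\<Sum>k\<in>R. (v k)\<^sup>2)"
  have s: "s > 0" using False unfolding s_def by (simp add: less_le sum_nonneg)
  note [measurable] = centred_measurable(1)[OF c]
  note K0 = centred_moment_nonneg[OF c]
  let ?c = "4 ^ p * (1 + K)"
  let ?A = "\<lambda>Q. (\<Sum>k\<in>Q. (v k)\<^sup>2) / s"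
  have "(\<integral>\<^sup>+x. ennreal ((\<Sum>k\<in>Q. v k * w (x k)) ^ (2 * p)) \<partial>iid Q P)
      \<le> ennreal (2 * s ^ p * (exp (?c * ?A Q) - 1))" if "Q \<subseteq> R" for Q
    using finite_subset[OF that R] that
  proof (induction Q rule: finite_induct)
    case empty
    show ?case using p by simp
  next
    case (insert r Q)
    have vr: "(v r)\<^sup>2 / s \<le> 1"
      using s R insert.prems member_le_sum[of r R "\<lambda>k. (v k)\<^sup>2"] by (simp add: s_def)
    interpret Q: prob_space "iid Q P"
      using centred_measurable(2)[OF c] by (intro prob_space_PiM) auto
    have "(\<integral>\<^sup>+x. ennreal ((\<Sum>k\<in>insert r Q. v k * w (x k)) ^ (2 * p)) \<partial>iid (insert r Q) P)
      \<le> ennreal (2 * s ^ p * (exp (?c * (?A Q + (v r)\<^sup>2 / s)) - 1))"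
    proof (rule martingale_step[OF c p insert.hyps(1,2), where S = "\<lambda>x. \<Sum>k\<in>Q. v k * w (x k)" and L = "\<lambda>_. v r"])
      show "(\<Sum>k\<in>insert r Q. v k * w ((x(r := y)) k)) = (\<Sum>k\<in>Q. v k * w (x k)) + w y * v r" for x y
        using insert.hyps by (simp add: mult.commute) (intro sum.cong, auto)
      have "v r ^ (2 * p) = s ^ p * ((v r)\<^sup>2 / s) ^ p"
        using s by (simp add: power_divide power_mult)
      thus "(\<integral>\<^sup>+x. ennreal (v r ^ (2 * p)) \<partial>iid Q P) \<le> ennreal (2 * s ^ p / 2 * ((v r)\<^sup>2 / s) ^ p)"
        by (simp add: Q.emeasure_space_1)
      show "(\<integral>\<^sup>+x. ennreal ((\<Sum>k\<in>Q. v k * w (x k)) ^ (2 * p)) \<partial>iid Q P)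
        \<le> ennreal (2 * s ^ p * (exp (?c * ?A Q) - 1))"
        using insert by auto
      show "(v r)\<^sup>2 / s = 0 \<Longrightarrow> (\<lambda>_. v r) = (\<lambda>_. 0)" using s by simp
    qed (use vr s in \<open>auto intro!: divide_nonneg_nonneg sum_nonneg borel_measurable_sum borel_measurable_times\<close>)
    thus ?case using insert.hyps by (simp add: add_divide_distrib add.commute)
  qed
  from this[of R] have "(\<integral>\<^sup>+x. ennreal ((\<Sum>k\<in>R. v k * w (x k)) ^ (2 * p)) \<partial>iid R P)
      \<le> ennreal (2 * s ^ p * (exp (?c * ?A R) - 1))" by simp
  also have "\<dots> \<le> ennreal (2 * s ^ p * (exp ?c - 1))"
    using s K0 by (intro ennreal_leI exp_scaled_le) (auto simp: s_def[symmetric])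
  finally show ?thesis by (simp add: s_def moment_factor_def algebra_simps)
qed

text \<open>Adding the index \<open>r\<close> adds \<open>2 w(x\<^sub>r) \<Sum>\<^sub>k B\<^sub>r\<^sub>k w(x\<^sub>k)\<close>, whose
  second factor is a linear form in the old variables and is bounded by \<open>linear_form_moment\<close>.\<close>

lemma quadratic_form_moment:
  fixes B :: "'i \<Rightarrow> 'i \<Rightarrow> real"
  assumes c: "centred_with_moment P w p K" and p: "1 \<le> p" and R: "finite R"
    and sym: "\<And>k l. k \<in> R \<Longrightarrow> l \<in> R \<Longrightarrow> B k l = B l k"
  shows "(\<integral>\<^sup>+x. ennreal ((\<Sum>k\<in>R. \<Sum>l\<in>R-{k}. B k l * w (x k) * w (x l)) ^ (2 * p)) \<partial>iid R P)
           \<le> ennreal (4 ^ p * (moment_factor p K)\<^sup>2 * (\<Sum>k\<in>R. \<Sum>l\<in>R. (B k l)\<^sup>2) ^ p)"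
proof (cases "(\<Sum>k\<in>R. \<Sum>l\<in>R. (B k l)\<^sup>2) = 0")
  case True
  hence "\<forall>k\<in>R. \<forall>l\<in>R. B k l = 0" using R by (simp add: sum_nonneg_eq_0_iff sum_nonneg)
  hence "(\<Sum>k\<in>R. \<Sum>l\<in>R-{k}. B k l * w (x k) * w (x l)) = 0" for x
    by (intro sum.neutral ballI) auto
  thus ?thesis using p by (simp add: power_0_left)
next
  case False
  define s where "s = (\<Sum>k\<in>R. \<Sum>l\<in>R. (B k l)\<^sup>2)"
  have s: "s > 0" using False unfolding s_def by (simp add: less_le sum_nonneg)
  note [measurable] = centred_measurable(1)[OF c]
  note K0 = centred_moment_nonneg[OF c]
  let ?c = "4 ^ p * (1 + K)"
  define \<mu> where "\<mu> = moment_factor p K"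
  have \<mu>: "\<mu> \<ge> 0" using moment_factor_nonneg[OF K0] by (simp add: \<mu>_def)
  let ?A = "\<lambda>Q. (\<Sum>k\<in>Q. \<Sum>l\<in>Q. (B k l)\<^sup>2) / s"
  let ?S = "\<lambda>Q x. \<Sum>k\<in>Q. \<Sum>l\<in>Q-{k}. B k l * w (x k) * w (x l)"
  let ?\<kappa> = "2 * (4 ^ p * \<mu> * s ^ p)"
  have "(\<integral>\<^sup>+x. ennreal (?S Q x ^ (2 * p)) \<partial>iid Q P) \<le> ennreal (?\<kappa> * (exp (?c * ?A Q) - 1))"
    if "Q \<subseteq> R" for Q
    using finite_subset[OF that R] that
  proof (induction Q rule: finite_induct)
    case empty
    show ?case using p by simp
  next
    case (insert r Q)
    define b where "b = (\<Sum>k\<in>Q. (B r k)\<^sup>2)"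
    have b0: "b \<ge> 0" unfolding b_def by (intro sum_nonneg) auto
    have fin: "finite Q" and rR: "r \<in> R" and QR: "Q \<subseteq> R" using insert by auto
    have "b \<le> (\<Sum>k\<in>R. (B r k)\<^sup>2)"
      unfolding b_def using R QR by (intro sum_mono2) auto
    also have "\<dots> \<le> s" unfolding s_def
      using R rR by (intro member_le_sum[where f = "\<lambda>r. \<Sum>k\<in>R. (B r k)\<^sup>2"]) (auto intro: sum_nonneg)
    finally have bs: "b \<le> s" .
    have "(\<integral>\<^sup>+x. ennreal (?S (insert r Q) x ^ (2 * p)) \<partial>iid (insert r Q) P)
      \<le> ennreal (?\<kappa> * (exp (?c * (?A Q + b / s)) - 1))"
    proof (rule martingale_step[OF c p insert.hyps(1,2), where S = "?S Q"
          and L = "\<lambda>x. 2 * (\<Sum>k\<in>Q. B r k * w (x k))"])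
      show "?S (insert r Q) (x(r := y)) = ?S Q x + w y * (2 * (\<Sum>k\<in>Q. B r k * w (x k)))" for x y
      proof -
        let ?x = "x(r := y)"
        have x: "?x k = x k" if "k \<in> Q" for k using that insert.hyps by auto
        have 1: "(\<Sum>l\<in>insert r Q - {k}. B k l * w (?x k) * w (?x l))
            = B k r * w (x k) * w y + (\<Sum>l\<in>Q - {k}. B k l * w (x k) * w (x l))" if "k \<in> Q" for k
        proof -
          have "insert r Q - {k} = insert r (Q - {k})" using that insert.hyps by auto
          thus ?thesis using that insert.hyps x by (auto intro!: sum.cong)
        qed
        have 2: "(\<Sum>l\<in>insert r Q - {r}. B r l * w (?x r) * w (?x l)) = (\<Sum>l\<in>Q. B r l * w y * w (x l))"
          using insert.hyps x by (auto intro!: sum.cong)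
        have 3: "(\<Sum>k\<in>Q. B k r * w (x k) * w y) = (\<Sum>k\<in>Q. B r k * w y * w (x k))"
          using sym[OF rR] QR by (intro sum.cong) auto
        have "?S (insert r Q) ?x = (\<Sum>l\<in>Q. B r l * w y * w (x l))
            + (\<Sum>k\<in>Q. B k r * w (x k) * w y + (\<Sum>l\<in>Q - {k}. B k l * w (x k) * w (x l)))"
          unfolding sum.insert[OF insert.hyps] 2 by (intro arg_cong2[where f = "(+)"] refl sum.cong 1)
        also have "\<dots> = ?S Q x + w y * (2 * (\<Sum>k\<in>Q. B r k * w (x k)))"
          unfolding sum.distrib 3 by (simp add: sum_distrib_left mult_ac)
        finally show ?thesis .
      qed
      have "(\<integral>\<^sup>+x. ennreal ((2 * (\<Sum>k\<in>Q. B r k * w (x k))) ^ (2 * p)) \<partial>iid Q P)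
          = (\<integral>\<^sup>+x. ennreal (4 ^ p) * ennreal ((\<Sum>k\<in>Q. B r k * w (x k)) ^ (2 * p)) \<partial>iid Q P)"
        by (intro nn_integral_cong)
           (simp add: power_mult_distrib zero_le_even_power power_mult flip: ennreal_mult)
      also have "\<dots> = ennreal (4 ^ p) * (\<integral>\<^sup>+x. ennreal ((\<Sum>k\<in>Q. B r k * w (x k)) ^ (2 * p)) \<partial>iid Q P)"
        by (intro nn_integral_cmult) measurable
      also have "\<dots> \<le> ennreal (4 ^ p) * ennreal (\<mu> * b ^ p)"
        unfolding \<mu>_def b_def by (intro mult_left_mono linear_form_moment[OF c p fin]) auto
      also have "\<dots> = ennreal (?\<kappa> / 2 * (b / s) ^ p)"
        using s b0 \<mu> by (simp add: power_divide flip: ennreal_mult)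
      finally show "(\<integral>\<^sup>+x. ennreal ((2 * (\<Sum>k\<in>Q. B r k * w (x k))) ^ (2 * p)) \<partial>iid Q P)
          \<le> ennreal (?\<kappa> / 2 * (b / s) ^ p)" .
      show "(\<integral>\<^sup>+x. ennreal (?S Q x ^ (2 * p)) \<partial>iid Q P) \<le> ennreal (?\<kappa> * (exp (?c * ?A Q) - 1))"
        using insert.IH QR by auto
      show "(\<lambda>x. 2 * (\<Sum>k\<in>Q. B r k * w (x k))) = (\<lambda>_. 0)" if "b / s = 0"
      proof -
        have "b = 0" using that s by simp
        hence "\<forall>k\<in>Q. B r k = 0" using fin unfolding b_def by (simp add: sum_nonneg_eq_0_iff)
        thus ?thesis by simp
      qed
    qed (use bs b0 s \<mu> in \<open>auto intro!: divide_nonneg_nonneg sum_nonneg\<close>)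
    also have "\<dots> \<le> ennreal (?\<kappa> * (exp (?c * ?A (insert r Q)) - 1))"
    proof -
      have "(\<Sum>k\<in>Q. \<Sum>l\<in>Q. (B k l)\<^sup>2) \<le> (\<Sum>k\<in>Q. \<Sum>l\<in>insert r Q. (B k l)\<^sup>2)"
        using fin by (intro sum_mono sum_mono2) auto
      moreover have "b \<le> (\<Sum>l\<in>insert r Q. (B r l)\<^sup>2)"
        unfolding b_def using fin by (intro sum_mono2) auto
      ultimately have "?A Q + b / s \<le> ?A (insert r Q)"
        unfolding add_divide_distrib[symmetric] sum.insert[OF insert.hyps, of "\<lambda>k. \<Sum>l\<in>insert r Q. (B k l)\<^sup>2"]
        using s by (intro divide_right_mono) auto
      hence "?c * (?A Q + b / s) \<le> ?c * ?A (insert r Q)"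
        using K0 by (intro mult_left_mono) auto
      thus ?thesis using s \<mu>
        by (intro ennreal_leI mult_left_mono diff_right_mono) (simp_all only: exp_le_cancel_iff, simp_all)
    qed
    finally show ?case .
  qed
  from this[of R] have "(\<integral>\<^sup>+x. ennreal (?S R x ^ (2 * p)) \<partial>iid R P)
      \<le> ennreal (?\<kappa> * (exp (?c * ?A R) - 1))" by simp
  also have "\<dots> \<le> ennreal (?\<kappa> * (exp ?c - 1))"
    using s K0 \<mu> by (intro ennreal_leI exp_scaled_le) (auto simp: s_def[symmetric])
  also have "?\<kappa> * (exp ?c - 1) = 4 ^ p * \<mu>\<^sup>2 * s ^ p"
    by (simp add: \<mu>_def moment_factor_def power2_eq_square)
  finally show ?thesis by (simp add: s_def \<mu>_def)
qed


lemma add_power_le: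
  fixes a b :: real
  assumes "0 \<le> a" "0 \<le> b"
  shows "(a + b) ^ p \<le> 2 ^ p * (a ^ p + b ^ p)"
proof -
  have "(a + b) ^ p \<le> (2 * max a b) ^ p" using assms by (intro power_mono) auto
  also have "\<dots> = 2 ^ p * max (a ^ p) (b ^ p)"
  proof (cases "a \<le> b")
    case True
    thus ?thesis using assms power_mono[of a b p] by (simp add: power_mult_distrib max_absorb2)
  next
    case False
    thus ?thesis using assms power_mono[of b a p] by (simp add: power_mult_distrib max_absorb1)
  qed
  also have "\<dots> \<le> 2 ^ p * (a ^ p + b ^ p)" using assms by (intro mult_left_mono) auto
  finally show ?thesis .
qed

lemma add_even_power_le:
  fixes a b :: real
  shows "(a + b) ^ (2 * p) \<le> 4 ^ p * (a ^ (2 * p) + b ^ (2 * p))"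
proof -
  have "(a + b) ^ (2 * p) = \<bar>a + b\<bar> ^ (2 * p)" by (simp add: power_even_abs)
  also have "\<dots> \<le> (\<bar>a\<bar> + \<bar>b\<bar>) ^ (2 * p)" by (intro power_mono) auto
  also have "\<dots> \<le> 2 ^ (2 * p) * (\<bar>a\<bar> ^ (2 * p) + \<bar>b\<bar> ^ (2 * p))" by (intro add_power_le) auto
  finally show ?thesis by (simp add: power_even_abs power_mult)
qed

lemma add5_even_power_le:
  fixes a b c d e :: real
  shows "(a + b + (c + d + e)) ^ (2 * p)
    \<le> 64 ^ p * (a ^ (2 * p) + b ^ (2 * p) + (c ^ (2 * p) + d ^ (2 * p) + e ^ (2 * p)))"
proof -
  have nn: "0 \<le> x ^ (2 * p)" for x :: real by (simp add: zero_le_even_power)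
  have up: "X \<le> 4 ^ p * X" if "0 \<le> X" for X :: real
    using that mult_right_mono[of 1 "4 ^ p" X] by simp
  have "(a + b + (c + d + e)) ^ (2 * p) \<le> 4 ^ p * ((a + b) ^ (2 * p) + (c + d + e) ^ (2 * p))"
    by (rule add_even_power_le)
  also have "\<dots> \<le> 4 ^ p * (4 ^ p * (a ^ (2 * p) + b ^ (2 * p)) + 4 ^ p * ((c + d) ^ (2 * p) + e ^ (2 * p)))"
    by (intro mult_left_mono add_mono add_even_power_le) auto
  also have "\<dots> \<le> 4 ^ p * (4 ^ p * (4 ^ p * (a ^ (2 * p) + b ^ (2 * p)))
      + 4 ^ p * (4 ^ p * (c ^ (2 * p) + d ^ (2 * p)) + 4 ^ p * e ^ (2 * p)))"
    using nn by (intro mult_left_mono add_mono add_even_power_le up add_nonneg_nonneg) auto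
  also have "\<dots> = (4 * 4 * 4) ^ p * (a ^ (2 * p) + b ^ (2 * p) + (c ^ (2 * p) + d ^ (2 * p) + e ^ (2 * p)))"
    unfolding power_mult_distrib by (simp add: algebra_simps)
  finally show ?thesis by simp
qed

text \<open>Measures the distance of the conditional mean \<open>\<mu>\<close> from 0 and of the conditional second moment
  \<open>v\<close> from 1 on the scale \<open>1 / sqrt n\<close>. Its average over the mixing space is bounded independently
  of \<open>n\<close>.\<close>

definition mixing_weight :: "nat \<Rightarrow> real \<Rightarrow> real \<Rightarrow> real \<Rightarrow> real" where
  "mixing_weight p n \<mu> v = 1 + n ^ p * \<mu> ^ (2 * p) + n ^ (2 * p) * \<mu> ^ (4 * p) + n ^ p * (v - 1) ^ (2 * p)"

lemma mixing_weight_terms: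
  fixes n :: real
  assumes "0 \<le> n"
  shows "0 \<le> n ^ p * \<mu> ^ (2 * p)" "0 \<le> n ^ (2 * p) * \<mu> ^ (4 * p)" "0 \<le> n ^ p * (v - 1) ^ (2 * p)"
  using assms by (simp_all add: zero_le_even_power)

lemma mixing_weight_ge_1: "0 \<le> n \<Longrightarrow> 1 \<le> mixing_weight p n \<mu> v"
  using mixing_weight_terms(1,2)[of n p \<mu>] mixing_weight_terms(3)[of n p v] by (simp add: mixing_weight_def)

lemma sum_off_diagonal:
  fixes f :: "'i \<Rightarrow> real"
  assumes "finite R" "k \<in> R"
  shows "(\<Sum>l\<in>R-{k}. f l) = (\<Sum>l\<in>R. if l = k then 0 else f l)"
  using assms by (subst sum.remove[of R k]) (auto intro!: sum.cong)

text \<open>What the Cauchy--Schwarz inequality gives for the coefficients that arise when a quadratic form is expanded around a nonzero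
  mean.\<close>

lemma row_sum_bounds:
  fixes B :: "'i \<Rightarrow> 'i \<Rightarrow> real"
  assumes R: "finite R" "real (card R) \<le> n"
  defines "F \<equiv> \<Sum>k\<in>R. \<Sum>l\<in>R. (B k l)\<^sup>2"
  shows "(\<Sum>k\<in>R. (\<Sum>l\<in>R-{k}. B k l)\<^sup>2) \<le> n * F"
    and "(\<Sum>k\<in>R. \<Sum>l\<in>R-{k}. B k l)\<^sup>2 \<le> n\<^sup>2 * F"
    and "(\<Sum>k\<in>R. (B k k)\<^sup>2) \<le> F"
    and "(\<Sum>k\<in>R. B k k)\<^sup>2 \<le> n * F"
proof -
  have n: "0 \<le> n" using R(2) by linarith
  have cs: "(\<Sum>k\<in>R. f k)\<^sup>2 \<le> n * (\<Sum>k\<in>R. (f k)\<^sup>2)" for f :: "'i \<Rightarrow> real"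
  proof -
    have "(\<Sum>k\<in>R. f k)\<^sup>2 \<le> (\<Sum>k\<in>R. (f k)\<^sup>2) * real (card R)"
      by (rule sum_squared_le_sum_of_squares)
    also have "\<dots> \<le> (\<Sum>k\<in>R. (f k)\<^sup>2) * n" using R by (intro mult_left_mono sum_nonneg) auto
    finally show ?thesis by (simp add: mult.commute)
  qed
  have "(\<Sum>l\<in>R-{k}. B k l)\<^sup>2 \<le> n * (\<Sum>l\<in>R. (B k l)\<^sup>2)" if "k \<in> R" for k
  proof -
    have "(\<Sum>l\<in>R-{k}. B k l) = (\<Sum>l\<in>R. if l = k then 0 else B k l)"
      by (rule sum_off_diagonal[OF R(1) that])
    also have "\<dots>\<^sup>2 \<le> n * (\<Sum>l\<in>R. (if l = k then 0 else B k l)\<^sup>2)" by (rule cs)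
    also have "\<dots> \<le> n * (\<Sum>l\<in>R. (B k l)\<^sup>2)"
      using n by (intro mult_left_mono sum_mono) auto
    finally show ?thesis .
  qed
  hence "(\<Sum>k\<in>R. (\<Sum>l\<in>R-{k}. B k l)\<^sup>2) \<le> (\<Sum>k\<in>R. n * (\<Sum>l\<in>R. (B k l)\<^sup>2))"
    by (intro sum_mono)
  also have "\<dots> = n * F" by (simp add: F_def sum_distrib_left)
  finally show 1: "(\<Sum>k\<in>R. (\<Sum>l\<in>R-{k}. B k l)\<^sup>2) \<le> n * F" .
  show "(\<Sum>k\<in>R. \<Sum>l\<in>R-{k}. B k l)\<^sup>2 \<le> n\<^sup>2 * F"
    using order_trans[OF cs mult_left_mono[OF 1 n]] by (simp add: power2_eq_square mult.assoc)
  show 2: "(\<Sum>k\<in>R. (B k k)\<^sup>2) \<le> F" unfolding F_def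
  proof (intro sum_mono)
    fix k assume "k \<in> R"
    thus "(B k k)\<^sup>2 \<le> (\<Sum>l\<in>R. (B k l)\<^sup>2)"
      using R(1) by (intro member_le_sum[where f = "\<lambda>l. (B k l)\<^sup>2"]) auto
  qed
  show "(\<Sum>k\<in>R. B k k)\<^sup>2 \<le> n * F"
    using order_trans[OF cs mult_left_mono[OF 2 n]] .
qed

text \<open>Each of the five terms of the expansion around the mean \<open>\<mu>\<close> is bounded by the Frobenius norm: the off-diagonal
  form in the centred variables, the linear form with coefficients \<open>2 \<mu> \<Sum>\<^sub>l B\<^sub>k\<^sub>l\<close>, the diagonal fluctuation, the square of the
  mean, and the defect \<open>v - 1\<close> of the second moment. The mean and the defect contribute powers of \<open>\<mu> sqrt n\<close> and
  \<open>(v - 1) sqrt n\<close>.\<close>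

lemma real_quadratic_fluctuation:
  fixes B :: "'i \<Rightarrow> 'i \<Rightarrow> real"
  assumes w: "centred_with_moment P (\<lambda>y. y - \<mu>) p K" and u: "centred_with_moment P (\<lambda>y. y\<^sup>2 - v) p K"
    and p: "1 \<le> p" and R: "finite R" "real (card R) \<le> n"
    and sym: "\<And>k l. k \<in> R \<Longrightarrow> l \<in> R \<Longrightarrow> B k l = B l k"
  defines "F \<equiv> \<Sum>k\<in>R. \<Sum>l\<in>R. (B k l)\<^sup>2"
  shows "(\<integral>\<^sup>+x. ennreal (((\<Sum>k\<in>R. \<Sum>l\<in>R. B k l * x k * x l) - (\<Sum>k\<in>R. B k k)) ^ (2 * p)) \<partial>iid R P)
    \<le> ennreal (256 ^ p * (1 + moment_factor p K)\<^sup>2 * mixing_weight p n \<mu> v * F ^ p)"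
proof -
  define M where "M = moment_factor p K"
  have M: "M \<ge> 0" using moment_factor_nonneg[OF centred_moment_nonneg[OF w]] by (simp add: M_def)
  have n: "0 \<le> n" using R(2) by linarith
  have F: "0 \<le> F" by (auto simp: F_def intro!: sum_nonneg)
  have sets: "sets P = sets borel" using w by (simp add: centred_with_moment_def)
  have [measurable_cong]: "sets P = sets borel" by (fact sets)
  interpret Q: prob_space "iid R P"
    using centred_measurable(2)[OF w] by (intro prob_space_PiM) auto
  define b where "b k = (\<Sum>l\<in>R-{k}. B k l)" for k
  let ?q = "\<lambda>x. \<Sum>k\<in>R. \<Sum>l\<in>R-{k}. B k l * (x k - \<mu>) * (x l - \<mu>)"
  let ?l = "\<lambda>x. \<Sum>k\<in>R. (2 * \<mu> * b k) * (x k - \<mu>)"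
  let ?u = "\<lambda>x. \<Sum>k\<in>R. B k k * ((x k)\<^sup>2 - v)"
  let ?c = "\<mu>\<^sup>2 * (\<Sum>k\<in>R. b k)" and ?d = "(v - 1) * (\<Sum>k\<in>R. B k k)"
  have nn: "0 \<le> x ^ (2 * p)" for x :: real by (simp add: zero_le_even_power)
  \<comment> \<open>Off-diagonal part, linear part, diagonal part, and two terms that depend on the conditional moments only.\<close>
  have decomp: "(\<Sum>k\<in>R. \<Sum>l\<in>R. B k l * x k * x l) - (\<Sum>k\<in>R. B k k) = ?q x + ?l x + (?u x + ?c + ?d)" for x
  proof -
    have "(\<Sum>k\<in>R. \<Sum>l\<in>R. B k l * x k * x l)
        = (\<Sum>k\<in>R. B k k * (x k)\<^sup>2 + (\<Sum>l\<in>R-{k}. B k l * x k * x l))"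
      using R(1) by (intro sum.cong refl) (simp add: sum.remove power2_eq_square mult.assoc)
    also have "\<dots> = (\<Sum>k\<in>R. B k k * (x k)\<^sup>2) + (\<Sum>k\<in>R. \<Sum>l\<in>R-{k}. B k l * x k * x l)"
      by (rule sum.distrib)
    also have "(\<Sum>k\<in>R. B k k * (x k)\<^sup>2) = ?u x + v * (\<Sum>k\<in>R. B k k)"
      by (simp add: algebra_simps sum_subtractf sum_distrib_left)
    also have "(\<Sum>k\<in>R. \<Sum>l\<in>R-{k}. B k l * x k * x l)
        = (\<Sum>k\<in>R. \<Sum>l\<in>R-{k}. B k l * (x k - \<mu>) * (x l - \<mu>) + \<mu> * B k l * (x k - \<mu>)
             + \<mu> * B k l * (x l - \<mu>) + \<mu>\<^sup>2 * B k l)"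
      by (intro sum.cong refl) (simp add: algebra_simps power2_eq_square)
    also have "\<dots> = ?q x + (\<Sum>k\<in>R. \<Sum>l\<in>R-{k}. \<mu> * B k l * (x k - \<mu>))
        + (\<Sum>k\<in>R. \<Sum>l\<in>R-{k}. \<mu> * B k l * (x l - \<mu>)) + (\<Sum>k\<in>R. \<Sum>l\<in>R-{k}. \<mu>\<^sup>2 * B k l)"
      by (simp only: sum.distrib)
    also have "(\<Sum>k\<in>R. \<Sum>l\<in>R-{k}. \<mu> * B k l * (x l - \<mu>)) = (\<Sum>k\<in>R. \<Sum>l\<in>R-{k}. \<mu> * B k l * (x k - \<mu>))"
    proof -
      have off: "(\<Sum>k\<in>R. \<Sum>l\<in>R-{k}. f k l) = (\<Sum>k\<in>R. \<Sum>l\<in>R. if l = k then 0 else f k l)" for f :: "'i \<Rightarrow> 'i \<Rightarrow> real"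
        by (intro sum.cong refl sum_off_diagonal[OF R(1)])
      show ?thesis
        unfolding off by (subst sum.swap, intro sum.cong refl) (auto simp: sym)
    qed
    also have "(\<Sum>k\<in>R. \<Sum>l\<in>R-{k}. \<mu> * B k l * (x k - \<mu>)) = (\<Sum>k\<in>R. \<mu> * b k * (x k - \<mu>))"
      by (simp add: b_def sum_distrib_left sum_distrib_right)
    also have "(\<Sum>k\<in>R. \<Sum>l\<in>R-{k}. \<mu>\<^sup>2 * B k l) = ?c"
      by (simp add: b_def sum_distrib_left)
    moreover have "?l x = (\<Sum>k\<in>R. \<mu> * b k * (x k - \<mu>)) + (\<Sum>k\<in>R. \<mu> * b k * (x k - \<mu>))"
      by (simp add: mult.assoc flip: sum.distrib)
    ultimately show ?thesis by (simp add: left_diff_distrib)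
  qed
  have pow: "(x\<^sup>2) ^ p = x ^ (2 * p)" for x :: real by (simp add: power_mult)
  note rs = row_sum_bounds[OF R, of B, folded F_def b_def]
  have eq: "(\<integral>\<^sup>+x. ennreal (?q x ^ (2 * p)) \<partial>iid R P) \<le> ennreal (4 ^ p * M\<^sup>2 * F ^ p)"
    using quadratic_form_moment[OF w p R(1) sym] by (simp add: M_def F_def)
  have el: "(\<integral>\<^sup>+x. ennreal (?l x ^ (2 * p)) \<partial>iid R P) \<le> ennreal (M * (4 ^ p * (n ^ p * \<mu> ^ (2 * p)) * F ^ p))"
  proof -
    have "(\<Sum>k\<in>R. (2 * \<mu> * b k)\<^sup>2) = 4 * \<mu>\<^sup>2 * (\<Sum>k\<in>R. (b k)\<^sup>2)"
      by (simp add: power_mult_distrib sum_distrib_left)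
    also have "\<dots> \<le> 4 * \<mu>\<^sup>2 * (n * F)" using rs(1) by (intro mult_left_mono) auto
    finally have "(\<Sum>k\<in>R. (2 * \<mu> * b k)\<^sup>2) ^ p \<le> (4 * \<mu>\<^sup>2 * (n * F)) ^ p"
      by (intro power_mono sum_nonneg) auto
    also have "\<dots> = 4 ^ p * (n ^ p * \<mu> ^ (2 * p)) * F ^ p" by (simp add: power_mult_distrib pow)
    finally have "M * (\<Sum>k\<in>R. (2 * \<mu> * b k)\<^sup>2) ^ p \<le> M * (4 ^ p * (n ^ p * \<mu> ^ (2 * p)) * F ^ p)"
      using M by (intro mult_left_mono)
    thus ?thesis
      using linear_form_moment[OF w p R(1), of "\<lambda>k. 2 * \<mu> * b k"] unfolding M_def
      by (meson ennreal_leI order_trans)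
  qed
  have eu: "(\<integral>\<^sup>+x. ennreal (?u x ^ (2 * p)) \<partial>iid R P) \<le> ennreal (M * F ^ p)"
  proof -
    have "M * (\<Sum>k\<in>R. (B k k)\<^sup>2) ^ p \<le> M * F ^ p"
      using M rs(3) by (intro mult_left_mono power_mono sum_nonneg) auto
    thus ?thesis
      using linear_form_moment[OF u p R(1), of "\<lambda>k. B k k"] unfolding M_def
      by (meson ennreal_leI order_trans)
  qed
  have ec: "?c ^ (2 * p) \<le> n ^ (2 * p) * \<mu> ^ (4 * p) * F ^ p"
  proof -
    have "?c ^ (2 * p) = \<mu> ^ (4 * p) * ((\<Sum>k\<in>R. b k)\<^sup>2) ^ p"
      by (simp add: power_mult_distrib flip: power_mult)
    also have "\<dots> \<le> \<mu> ^ (4 * p) * (n\<^sup>2 * F) ^ p"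
      using rs(2) by (intro mult_left_mono power_mono) (auto simp: zero_le_even_power)
    finally show ?thesis by (simp add: power_mult_distrib pow mult_ac)
  qed
  have ed: "?d ^ (2 * p) \<le> n ^ p * (v - 1) ^ (2 * p) * F ^ p"
  proof -
    have "?d ^ (2 * p) = (v - 1) ^ (2 * p) * ((\<Sum>k\<in>R. B k k)\<^sup>2) ^ p"
      by (simp add: power_mult_distrib flip: power_mult)
    also have "\<dots> \<le> (v - 1) ^ (2 * p) * (n * F) ^ p"
      using rs(4) by (intro mult_left_mono power_mono) (auto simp: zero_le_even_power)
    finally show ?thesis by (simp add: power_mult_distrib mult_ac)
  qed
  have "(\<integral>\<^sup>+x. ennreal (((\<Sum>k\<in>R. \<Sum>l\<in>R. B k l * x k * x l) - (\<Sum>k\<in>R. B k k)) ^ (2 * p)) \<partial>iid R P)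
     \<le> (\<integral>\<^sup>+x. ennreal (64 ^ p) * (ennreal (?q x ^ (2 * p)) + ennreal (?l x ^ (2 * p)) +
           (ennreal (?u x ^ (2 * p)) + ennreal (?c ^ (2 * p)) + ennreal (?d ^ (2 * p)))) \<partial>iid R P)"
  proof (intro nn_integral_mono)
    fix x
    show "ennreal (((\<Sum>k\<in>R. \<Sum>l\<in>R. B k l * x k * x l) - (\<Sum>k\<in>R. B k k)) ^ (2 * p))
        \<le> ennreal (64 ^ p) * (ennreal (?q x ^ (2 * p)) + ennreal (?l x ^ (2 * p)) +
           (ennreal (?u x ^ (2 * p)) + ennreal (?c ^ (2 * p)) + ennreal (?d ^ (2 * p))))"
      unfolding decomp using nn
      by (subst ennreal_plus[symmetric] ennreal_mult[symmetric],
          (simp_all add: add_nonneg_nonneg)[2])+ (intro ennreal_leI add5_even_power_le)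
  qed
  also have "\<dots> = ennreal (64 ^ p) * ((\<integral>\<^sup>+x. ennreal (?q x ^ (2 * p)) \<partial>iid R P)
      + (\<integral>\<^sup>+x. ennreal (?l x ^ (2 * p)) \<partial>iid R P) + ((\<integral>\<^sup>+x. ennreal (?u x ^ (2 * p)) \<partial>iid R P)
      + ennreal (?c ^ (2 * p)) + ennreal (?d ^ (2 * p))))"
    by (simp add: nn_integral_cmult nn_integral_add Q.emeasure_space_1)
  also have "\<dots> \<le> ennreal (64 ^ p) * (ennreal (4 ^ p * M\<^sup>2 * F ^ p) + ennreal (M * (4 ^ p * (n ^ p * \<mu> ^ (2 * p)) * F ^ p))
      + (ennreal (M * F ^ p) + ennreal (n ^ (2 * p) * \<mu> ^ (4 * p) * F ^ p) + ennreal (n ^ p * (v - 1) ^ (2 * p) * F ^ p)))"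
    by (intro mult_left_mono add_mono eq el eu ennreal_leI ec ed) auto
  also have "\<dots> = ennreal (64 ^ p * (4 ^ p * M\<^sup>2 * F ^ p + M * (4 ^ p * (n ^ p * \<mu> ^ (2 * p)) * F ^ p)
      + (M * F ^ p + n ^ (2 * p) * \<mu> ^ (4 * p) * F ^ p + n ^ p * (v - 1) ^ (2 * p) * F ^ p)))"
    using F M n by (simp add: zero_le_even_power flip: ennreal_plus ennreal_mult)
  also have "\<dots> \<le> ennreal (256 ^ p * (1 + M)\<^sup>2 * mixing_weight p n \<mu> v * F ^ p)"
  proof (intro ennreal_leI)
    define A where "A = n ^ p * \<mu> ^ (2 * p)"
    define B' where "B' = n ^ (2 * p) * \<mu> ^ (4 * p)"
    define C where "C = n ^ p * (v - 1) ^ (2 * p)"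
    have ABC: "0 \<le> A" "0 \<le> B'" "0 \<le> C" using mixing_weight_terms[OF n] by (auto simp: A_def B'_def C_def)
    have one: "(1::real) \<le> 4 ^ p" by simp
    have m1: "M\<^sup>2 + M \<le> (1 + M)\<^sup>2" "M \<le> (1 + M)\<^sup>2" "1 \<le> (1 + M)\<^sup>2"
      using M by (auto simp: power2_eq_square algebra_simps)
    have m2: "M \<le> 4 ^ p * M" using M by (simp add: mult_le_cancel_right1)
    have "4 ^ p * M\<^sup>2 + M \<le> 4 ^ p * (M\<^sup>2 + M)" using m2 by (simp add: distrib_left)
    also have "\<dots> \<le> 4 ^ p * (1 + M)\<^sup>2" using m1 by (intro mult_left_mono) auto
    finally have 1: "4 ^ p * M\<^sup>2 + M \<le> 4 ^ p * (1 + M)\<^sup>2" .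
    have 2: "1 \<le> 4 ^ p * (1 + M)\<^sup>2" using one m1(3) by (metis mult_mono' mult_1 zero_le_one)
    have 3: "4 ^ p * M \<le> 4 ^ p * (1 + M)\<^sup>2" using m1 by (intro mult_left_mono) auto
    have "4 ^ p * M\<^sup>2 + M + 4 ^ p * M * A + B' + C
        \<le> 4 ^ p * (1 + M)\<^sup>2 + 4 ^ p * (1 + M)\<^sup>2 * A + 4 ^ p * (1 + M)\<^sup>2 * B' + 4 ^ p * (1 + M)\<^sup>2 * C"
      using 1 mult_right_mono[OF 3 ABC(1)] mult_right_mono[OF 2 ABC(2)] mult_right_mono[OF 2 ABC(3)] by linarith
    also have "\<dots> = 4 ^ p * (1 + M)\<^sup>2 * mixing_weight p n \<mu> v"
      by (simp add: mixing_weight_def A_def B'_def C_def algebra_simps)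
    finally have "64 ^ p * F ^ p * (4 ^ p * M\<^sup>2 + M + 4 ^ p * M * A + B' + C)
        \<le> 64 ^ p * F ^ p * (4 ^ p * (1 + M)\<^sup>2 * mixing_weight p n \<mu> v)"
      using F by (intro mult_left_mono) auto
    also have "64 ^ p * F ^ p * (4 ^ p * (1 + M)\<^sup>2 * mixing_weight p n \<mu> v)
        = (64 * 4) ^ p * (1 + M)\<^sup>2 * mixing_weight p n \<mu> v * F ^ p"
      unfolding power_mult_distrib by (simp add: mult_ac)
    finally show "64 ^ p * (4 ^ p * M\<^sup>2 * F ^ p + M * (4 ^ p * (n ^ p * \<mu> ^ (2 * p)) * F ^ p)
      + (M * F ^ p + n ^ (2 * p) * \<mu> ^ (4 * p) * F ^ p + n ^ p * (v - 1) ^ (2 * p) * F ^ p))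
      \<le> 256 ^ p * (1 + M)\<^sup>2 * mixing_weight p n \<mu> v * F ^ p"
      by (simp add: A_def B'_def C_def algebra_simps)
  qed
  finally show ?thesis by (simp add: M_def)
qed


lemma complex_even_power_le:
  fixes z :: complex
  shows "cmod z ^ (2 * p) \<le> 2 ^ p * (Re z ^ (2 * p) + Im z ^ (2 * p))"
  using add_power_le[of "(Re z)\<^sup>2" "(Im z)\<^sup>2" p] by (simp add: cmod_power2 power_mult)

lemma markov_even_moment:
  assumes [measurable]: "Z \<in> borel_measurable M"
    and "(\<integral>\<^sup>+x. ennreal (Z x ^ (2 * p)) \<partial>M) \<le> ennreal (C * F ^ p)"
    and F: "0 < F" and \<phi>: "0 < \<phi>" and "0 \<le> C"
  shows "emeasure M {x \<in> space M. \<phi> * sqrt F < Z x} \<le> ennreal (C / \<phi> ^ (2 * p))"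
proof -
  let ?K = "\<phi> ^ (2 * p) * F ^ p"
  have K: "?K > 0" using F \<phi> by simp
  have "emeasure M {x \<in> space M. \<phi> * sqrt F < Z x} = (\<integral>\<^sup>+x. indicator {x \<in> space M. \<phi> * sqrt F < Z x} x \<partial>M)"
    by (intro nn_integral_indicator[symmetric]) measurable
  also have "\<dots> \<le> (\<integral>\<^sup>+x. ennreal (1 / ?K) * ennreal (Z x ^ (2 * p)) \<partial>M)"
  proof (intro nn_integral_mono)
    fix x
    show "indicator {x \<in> space M. \<phi> * sqrt F < Z x} x \<le> ennreal (1 / ?K) * ennreal (Z x ^ (2 * p))"
    proof (cases "\<phi> * sqrt F < Z x")
      case True
      have "(\<phi> * sqrt F) ^ (2 * p) \<le> Z x ^ (2 * p)"
        using True F \<phi> by (intro power_mono) auto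
      hence "?K \<le> Z x ^ (2 * p)"
        using F by (simp add: power_mult_distrib power_mult)
      hence "1 \<le> 1 / ?K * Z x ^ (2 * p)" using K by (simp add: field_simps)
      hence "1 \<le> ennreal (1 / ?K * Z x ^ (2 * p))" by simp
      also have "\<dots> = ennreal (1 / ?K) * ennreal (Z x ^ (2 * p))"
        using K by (intro ennreal_mult) (auto simp: zero_le_even_power)
      finally show ?thesis by (simp add: indicator_def)
    qed (simp add: indicator_def)
  qed
  also have "\<dots> = ennreal (1 / ?K) * (\<integral>\<^sup>+x. ennreal (Z x ^ (2 * p)) \<partial>M)"
    by (intro nn_integral_cmult) measurable
  also have "\<dots> \<le> ennreal (1 / ?K) * ennreal (C * F ^ p)" by (intro mult_left_mono assms) auto
  also have "\<dots> = ennreal (1 / ?K * (C * F ^ p))" using K F assms(5) by (intro ennreal_mult[symmetric]) auto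
  also have "1 / ?K * (C * F ^ p) = C / \<phi> ^ (2 * p)" using F by (simp add: field_simps)
  finally show ?thesis .
qed

lemma complex_form_deviation:
  fixes Z :: "'a \<Rightarrow> complex"
  assumes [measurable]: "Z \<in> borel_measurable M"
    and "(\<integral>\<^sup>+x. ennreal (Re (Z x) ^ (2 * p)) \<partial>M) \<le> ennreal (C * F ^ p)"
    and "(\<integral>\<^sup>+x. ennreal (Im (Z x) ^ (2 * p)) \<partial>M) \<le> ennreal (C * F ^ p)"
    and F: "0 < F" and C: "0 \<le> C" and \<phi>: "0 < \<phi>"
  shows "emeasure M {x \<in> space M. \<phi> * sqrt F < cmod (Z x)} \<le> ennreal (2 * 2 ^ p * C / \<phi> ^ (2 * p))"
proof -
  have "(\<integral>\<^sup>+x. ennreal (cmod (Z x) ^ (2 * p)) \<partial>M)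
      \<le> (\<integral>\<^sup>+x. ennreal (2 ^ p) * (ennreal (Re (Z x) ^ (2 * p)) + ennreal (Im (Z x) ^ (2 * p))) \<partial>M)"
    by (intro nn_integral_mono)
       (simp add: ennreal_leI complex_even_power_le zero_le_even_power flip: ennreal_plus ennreal_mult)
  also have "\<dots> = ennreal (2 ^ p) * ((\<integral>\<^sup>+x. ennreal (Re (Z x) ^ (2 * p)) \<partial>M) + (\<integral>\<^sup>+x. ennreal (Im (Z x) ^ (2 * p)) \<partial>M))"
    by (simp add: nn_integral_cmult nn_integral_add)
  also have "\<dots> \<le> ennreal (2 ^ p) * (ennreal (C * F ^ p) + ennreal (C * F ^ p))"
    by (intro mult_left_mono add_mono assms) auto
  also have "\<dots> = ennreal (2 * 2 ^ p * C * F ^ p)"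
    using C F by (simp add: mult_ac flip: ennreal_plus ennreal_mult)
  finally show ?thesis using F \<phi> C by (intro markov_even_moment) auto
qed

text \<open>A common constant in the tail bounds for linear and quadratic forms.\<close>

definition tail_factor :: "nat \<Rightarrow> real \<Rightarrow> real" where
  "tail_factor p K = 2 * 512 ^ p * (1 + moment_factor p K)\<^sup>2"

lemma tail_factor_nonneg: "0 \<le> tail_factor p K"
  by (simp add: tail_factor_def)

text \<open>Markov's inequality for \<open>real_quadratic_fluctuation\<close>, applied to the real and imaginary parts of the
  coefficients.\<close>

lemma quadratic_deviation:
  fixes B :: "'i \<Rightarrow> 'i \<Rightarrow> complex"
  assumes w: "centred_with_moment P (\<lambda>y. y - \<mu>) p K" and u: "centred_with_moment P (\<lambda>y. y\<^sup>2 - v) p K"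
    and p: "1 \<le> p" and R: "finite R" "real (card R) \<le> n"
    and sym: "\<And>k l. k \<in> R \<Longrightarrow> l \<in> R \<Longrightarrow> B k l = B l k" and \<phi>: "0 < \<phi>"
  shows "emeasure (iid R P) {x \<in> space (iid R P).
      \<phi> * sqrt (\<Sum>k\<in>R. \<Sum>l\<in>R. (cmod (B k l))\<^sup>2)
        < cmod ((\<Sum>k\<in>R. \<Sum>l\<in>R. B k l * of_real (x k) * of_real (x l)) - (\<Sum>k\<in>R. B k k))}
    \<le> ennreal (tail_factor p K * mixing_weight p n \<mu> v / \<phi> ^ (2 * p))"
proof -
  define M where "M = moment_factor p K"
  have n: "0 \<le> n" using R(2) by linarith
  have h: "1 \<le> mixing_weight p n \<mu> v" by (rule mixing_weight_ge_1[OF n])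
  have [measurable_cong]: "sets P = sets borel" using w by (simp add: centred_with_moment_def)
  define F where "F = (\<Sum>k\<in>R. \<Sum>l\<in>R. (cmod (B k l))\<^sup>2)"
  define Z where "Z x = (\<Sum>k\<in>R. \<Sum>l\<in>R. B k l * of_real (x k) * of_real (x l)) - (\<Sum>k\<in>R. B k k)" for x
  have F0: "0 \<le> F" by (auto simp: F_def intro!: sum_nonneg)
  let ?C = "256 ^ p * (1 + M)\<^sup>2 * mixing_weight p n \<mu> v"
  have part: "(\<integral>\<^sup>+x. ennreal (((\<Sum>k\<in>R. \<Sum>l\<in>R. f (B k l) * x k * x l) - (\<Sum>k\<in>R. f (B k k))) ^ (2 * p)) \<partial>iid R P)
      \<le> ennreal (?C * F ^ p)" if f: "\<And>z. \<bar>f z\<bar> \<le> cmod z" for f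
  proof -
    let ?Ff = "\<Sum>k\<in>R. \<Sum>l\<in>R. (f (B k l))\<^sup>2"
    have "?Ff \<le> F" unfolding F_def
      by (intro sum_mono) (use f in \<open>simp add: abs_le_square_iff[symmetric]\<close>)
    hence "?C * ?Ff ^ p \<le> ?C * F ^ p"
      using h by (intro mult_left_mono power_mono sum_nonneg) auto
    moreover have "(\<integral>\<^sup>+x. ennreal (((\<Sum>k\<in>R. \<Sum>l\<in>R. f (B k l) * x k * x l) - (\<Sum>k\<in>R. f (B k k))) ^ (2 * p)) \<partial>iid R P)
      \<le> ennreal (?C * ?Ff ^ p)"
      unfolding M_def by (rule real_quadratic_fluctuation[OF w u p R]) (simp add: sym)
    ultimately show ?thesis by (meson ennreal_leI order_trans)
  qed
  have Re: "Re (Z x) = (\<Sum>k\<in>R. \<Sum>l\<in>R. Re (B k l) * x k * x l) - (\<Sum>k\<in>R. Re (B k k))" for x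
    by (simp add: Z_def)
  have Im: "Im (Z x) = (\<Sum>k\<in>R. \<Sum>l\<in>R. Im (B k l) * x k * x l) - (\<Sum>k\<in>R. Im (B k k))" for x
    by (simp add: Z_def)
  have "emeasure (iid R P) {x \<in> space (iid R P). \<phi> * sqrt F < cmod (Z x)}
      \<le> ennreal (tail_factor p K * mixing_weight p n \<mu> v / \<phi> ^ (2 * p))"
  proof (cases "F = 0")
    case True
    hence "\<forall>k\<in>R. \<forall>l\<in>R. B k l = 0"
      using R(1) by (simp add: F_def sum_nonneg_eq_0_iff sum_nonneg)
    hence "Z x = 0" for x by (simp add: Z_def)
    thus ?thesis by (simp add: True)
  next
    case False
    have "(512::real) ^ p = 2 ^ p * 256 ^ p" by (simp flip: power_mult_distrib)
    hence df: "tail_factor p K * mixing_weight p n \<mu> v = 2 * 2 ^ p * ?C"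
      by (simp add: tail_factor_def M_def)
    have "Z \<in> borel_measurable (iid R P)" unfolding Z_def by measurable
    hence "emeasure (iid R P) {x \<in> space (iid R P). \<phi> * sqrt F < cmod (Z x)}
        \<le> ennreal (2 * 2 ^ p * ?C / \<phi> ^ (2 * p))"
      using False F0 h \<phi>
      by (intro complex_form_deviation) (auto simp: Re Im intro!: part abs_Re_le_cmod abs_Im_le_cmod)
    thus ?thesis unfolding df .
  qed
  thus ?thesis by (simp add: F_def Z_def)
qed

lemma linear_deviation:
  fixes v :: "'i \<Rightarrow> complex"
  assumes w: "centred_with_moment P (\<lambda>y. y - \<mu>) p K"
    and p: "1 \<le> p" and R: "finite R" "real (card R) \<le> n" and \<phi>: "0 < \<phi>"
  shows "emeasure (iid R P) {x \<in> space (iid R P).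
      \<phi> * sqrt (\<Sum>k\<in>R. (cmod (v k))\<^sup>2) < cmod (\<Sum>k\<in>R. v k * of_real (x k))}
    \<le> ennreal (tail_factor p K * mixing_weight p n \<mu> m / \<phi> ^ (2 * p))"
proof -
  define M where "M = moment_factor p K"
  have M: "M \<ge> 0" using moment_factor_nonneg[OF centred_moment_nonneg[OF w]] by (simp add: M_def)
  have n: "0 \<le> n" using R(2) by linarith
  have h: "1 \<le> mixing_weight p n \<mu> m" by (rule mixing_weight_ge_1[OF n])
  have [measurable_cong]: "sets P = sets borel" using w by (simp add: centred_with_moment_def)
  interpret Q: prob_space "iid R P"
    using centred_measurable(2)[OF w] by (intro prob_space_PiM) auto
  define F where "F = (\<Sum>k\<in>R. (cmod (v k))\<^sup>2)"
  define Z where "Z x = (\<Sum>k\<in>R. v k * of_real (x k))" for x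
  have F0: "0 \<le> F" by (auto simp: F_def intro!: sum_nonneg)
  let ?C = "4 ^ p * (1 + M) * mixing_weight p n \<mu> m"
  have part: "(\<integral>\<^sup>+x. ennreal ((\<Sum>k\<in>R. f (v k) * x k) ^ (2 * p)) \<partial>iid R P) \<le> ennreal (?C * F ^ p)"
    if f: "\<And>z. \<bar>f z\<bar> \<le> cmod z" for f
  proof -
    let ?Ff = "\<Sum>k\<in>R. (f (v k))\<^sup>2"
    have Ff: "?Ff \<le> F" unfolding F_def
      by (intro sum_mono) (use f in \<open>simp add: abs_le_square_iff[symmetric]\<close>)
    have "(\<Sum>k\<in>R. f (v k))\<^sup>2 \<le> ?Ff * real (card R)" by (rule sum_squared_le_sum_of_squares)
    also have "\<dots> \<le> F * n" using Ff R F0 by (intro mult_mono) auto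
    finally have cs: "(\<Sum>k\<in>R. f (v k))\<^sup>2 \<le> F * n" .
    have mean: "(\<mu> * (\<Sum>k\<in>R. f (v k))) ^ (2 * p) \<le> n ^ p * \<mu> ^ (2 * p) * F ^ p"
    proof -
      have "(\<mu> * (\<Sum>k\<in>R. f (v k))) ^ (2 * p) = \<mu> ^ (2 * p) * ((\<Sum>k\<in>R. f (v k))\<^sup>2) ^ p"
        by (simp add: power_mult_distrib flip: power_mult)
      also have "\<dots> \<le> \<mu> ^ (2 * p) * (F * n) ^ p"
        using cs by (intro mult_left_mono power_mono) (auto simp: zero_le_even_power)
      finally show ?thesis by (simp add: power_mult_distrib mult_ac)
    qed
    have lin: "(\<integral>\<^sup>+x. ennreal ((\<Sum>k\<in>R. f (v k) * (x k - \<mu>)) ^ (2 * p)) \<partial>iid R P) \<le> ennreal (M * F ^ p)"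
    proof -
      have "M * ?Ff ^ p \<le> M * F ^ p"
        using M Ff by (intro mult_left_mono power_mono sum_nonneg) auto
      thus ?thesis using linear_form_moment[OF w p R(1), of "\<lambda>k. f (v k)"] unfolding M_def
        by (meson ennreal_leI order_trans)
    qed
    have "(\<integral>\<^sup>+x. ennreal ((\<Sum>k\<in>R. f (v k) * x k) ^ (2 * p)) \<partial>iid R P)
       \<le> (\<integral>\<^sup>+x. ennreal (4 ^ p) * (ennreal ((\<Sum>k\<in>R. f (v k) * (x k - \<mu>)) ^ (2 * p))
            + ennreal ((\<mu> * (\<Sum>k\<in>R. f (v k))) ^ (2 * p))) \<partial>iid R P)"
    proof (intro nn_integral_mono)
      fix x
      have "(\<Sum>k\<in>R. f (v k) * x k) = (\<Sum>k\<in>R. f (v k) * (x k - \<mu>)) + \<mu> * (\<Sum>k\<in>R. f (v k))"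
        by (simp add: algebra_simps sum_subtractf sum_distrib_left)
      thus "ennreal ((\<Sum>k\<in>R. f (v k) * x k) ^ (2 * p))
          \<le> ennreal (4 ^ p) * (ennreal ((\<Sum>k\<in>R. f (v k) * (x k - \<mu>)) ^ (2 * p))
            + ennreal ((\<mu> * (\<Sum>k\<in>R. f (v k))) ^ (2 * p)))"
        by (simp add: ennreal_leI add_even_power_le zero_le_even_power flip: ennreal_plus ennreal_mult)
    qed
    also have "\<dots> = ennreal (4 ^ p) * ((\<integral>\<^sup>+x. ennreal ((\<Sum>k\<in>R. f (v k) * (x k - \<mu>)) ^ (2 * p)) \<partial>iid R P)
            + ennreal ((\<mu> * (\<Sum>k\<in>R. f (v k))) ^ (2 * p)))"
      by (simp add: nn_integral_cmult nn_integral_add Q.emeasure_space_1)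
    also have "\<dots> \<le> ennreal (4 ^ p) * (ennreal (M * F ^ p) + ennreal (n ^ p * \<mu> ^ (2 * p) * F ^ p))"
      by (intro mult_left_mono add_mono lin ennreal_leI mean) auto
    also have "\<dots> = ennreal (4 ^ p * (M + n ^ p * \<mu> ^ (2 * p)) * F ^ p)"
      using M F0 n by (simp add: zero_le_even_power distrib_left distrib_right mult.assoc flip: ennreal_plus ennreal_mult)
    also have "\<dots> \<le> ennreal (?C * F ^ p)"
    proof (intro ennreal_leI mult_right_mono)
      have "M + n ^ p * \<mu> ^ (2 * p) \<le> (1 + M) * (1 + n ^ p * \<mu> ^ (2 * p))"
        using M mixing_weight_terms(1)[OF n, of p \<mu>] by (simp add: algebra_simps)
      also have "\<dots> \<le> (1 + M) * mixing_weight p n \<mu> m"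
        using M mixing_weight_terms(2)[OF n, of p \<mu>] mixing_weight_terms(3)[OF n, of p m] by (intro mult_left_mono) (auto simp: mixing_weight_def)
      finally show "4 ^ p * (M + n ^ p * \<mu> ^ (2 * p)) \<le> ?C" by (simp add: mult.assoc)
    qed (use F0 in auto)
    finally show ?thesis .
  qed
  have Re: "Re (Z x) = (\<Sum>k\<in>R. Re (v k) * x k)" and Im: "Im (Z x) = (\<Sum>k\<in>R. Im (v k) * x k)" for x
    by (simp_all add: Z_def)
  have "emeasure (iid R P) {x \<in> space (iid R P). \<phi> * sqrt F < cmod (Z x)}
      \<le> ennreal (tail_factor p K * mixing_weight p n \<mu> m / \<phi> ^ (2 * p))"
  proof (cases "F = 0")
    case True
    hence "\<forall>k\<in>R. v k = 0"
      using R(1) by (simp add: F_def sum_nonneg_eq_0_iff)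
    hence "Z x = 0" for x by (simp add: Z_def)
    thus ?thesis by (simp add: True)
  next
    case False
    have "Z \<in> borel_measurable (iid R P)" unfolding Z_def by measurable
    hence "emeasure (iid R P) {x \<in> space (iid R P). \<phi> * sqrt F < cmod (Z x)}
        \<le> ennreal (2 * 2 ^ p * ?C / \<phi> ^ (2 * p))"
      using False F0 h M \<phi>
      by (intro complex_form_deviation) (auto simp: Re Im intro!: part abs_Re_le_cmod abs_Im_le_cmod)
    also have "\<dots> \<le> ennreal (tail_factor p K * mixing_weight p n \<mu> m / \<phi> ^ (2 * p))"
    proof (intro ennreal_leI divide_right_mono)
      have "2 ^ p * 4 ^ p * (1 + M) \<le> 512 ^ p * (1 + M)\<^sup>2"
        using M by (intro mult_mono) (auto simp: power2_eq_square power_mono simp flip: power_mult_distrib)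
      hence "2 * (2 ^ p * 4 ^ p * (1 + M)) * mixing_weight p n \<mu> m
          \<le> 2 * (512 ^ p * (1 + M)\<^sup>2) * mixing_weight p n \<mu> m"
        using h by (intro mult_right_mono) auto
      thus "2 * 2 ^ p * ?C \<le> tail_factor p K * mixing_weight p n \<mu> m"
        by (simp add: tail_factor_def M_def mult_ac)
    qed (use \<phi> in auto)
    finally show ?thesis .
  qed
  thus ?thesis by (simp add: F_def Z_def)
qed

section \<open>Symmetric matrices with independent entries\<close>

lemma borel_measurable_det:
  fixes F :: "'a \<Rightarrow> complex mat"
  assumes "\<And>x. x \<in> space M \<Longrightarrow> F x \<in> carrier_mat n n"
    and "\<And>i j. i < n \<Longrightarrow> j < n \<Longrightarrow> (\<lambda>x. F x $$ (i, j)) \<in> borel_measurable M"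
  shows "(\<lambda>x. Determinant.det (F x)) \<in> borel_measurable M"
proof -
  have "(\<lambda>x. \<Sum>p\<in>{p. p permutes {0..<n}}. signof p * (\<Prod>i = 0..<n. F x $$ (i, p i))) \<in> borel_measurable M"
    using assms(2) by (intro borel_measurable_sum borel_measurable_times borel_measurable_prod borel_measurable_const)
      (auto dest: permutes_in_image)
  thus ?thesis
    by (subst measurable_cong[OF Determinant.det_def'[OF assms(1)]]) auto
qed

lemma borel_measurable_resolvent:
  fixes F :: "'a \<Rightarrow> real mat"
  assumes sym: "\<And>x. x \<in> space M \<Longrightarrow> real_symmetric n (F x)"
    and ent: "\<And>i j. i < n \<Longrightarrow> j < n \<Longrightarrow> (\<lambda>x. F x $$ (i, j)) \<in> borel_measurable M"
    and z: "Im z > 0" and ij: "i < n" "j < n"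
  shows "(\<lambda>x. resolvent (F x) z $$ (i, j)) \<in> borel_measurable M"
proof -
  define S where "S x = map_mat complex_of_real (F x) - z \<cdot>\<^sub>m 1\<^sub>m n" for x
  have S: "S x \<in> carrier_mat n n" for x
    unfolding S_def by (intro minus_carrier_mat smult_carrier_mat one_carrier_mat)
  have Sent: "(\<lambda>x. S x $$ (a, b)) \<in> borel_measurable M" if "a < n" "b < n" for a b
  proof -
    have "(\<lambda>x. complex_of_real (F x $$ (a, b)) - (if a = b then z else 0)) \<in> borel_measurable M"
      using ent[OF that] by (intro borel_measurable_diff borel_measurable_of_real) auto
    moreover have "S x $$ (a, b) = complex_of_real (F x $$ (a, b)) - (if a = b then z else 0)"
      if "x \<in> space M" for x
    proof -
      have "F x \<in> carrier_mat n n" using sym[OF that] by (simp add: real_symmetric_def)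
      hence "dim_row (F x) = n" "dim_col (F x) = n" by auto
      thus ?thesis using \<open>a < n\<close> \<open>b < n\<close> by (simp add: S_def)
    qed
    ultimately show ?thesis by (subst measurable_cong) auto
  qed
  have cof: "(\<lambda>x. cofactor (S x) j i) \<in> borel_measurable M"
  proof -
    have "(\<lambda>x. Determinant.det (mat_delete (S x) j i)) \<in> borel_measurable M"
    proof (rule borel_measurable_det[of _ _ "n - 1"])
      fix a b assume ab: "a < n - 1" "b < n - 1"
      have "mat_delete (S x) j i $$ (a, b)
          = S x $$ (if a < j then a else Suc a, if b < i then b else Suc b)" for x
        using S[of x] ab by (auto simp: mat_delete_def)
      thus "(\<lambda>x. mat_delete (S x) j i $$ (a, b)) \<in> borel_measurable M"
        using Sent ab by simp
    qed (intro mat_delete_carrier S)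
    thus ?thesis unfolding cofactor_def by (intro borel_measurable_times) auto
  qed
  have "(\<lambda>x. 1 / Determinant.det (S x) * cofactor (S x) j i) \<in> borel_measurable M"
    using borel_measurable_det[of M S n] S Sent cof
    by (intro borel_measurable_times borel_measurable_divide) auto
  thus ?thesis
  proof (subst measurable_cong[of M])
    fix x assume "x \<in> space M"
    thus "resolvent (F x) z $$ (i, j) = 1 / Determinant.det (S x) * cofactor (S x) j i"
      using resolvent_eq_adj(1)[OF sym z] ij S[of x] by (auto simp: adj_mat_def S_def)
  qed
qed

definition upper :: "nat \<Rightarrow> (nat \<times> nat) set" where
  "upper n = {(i, j). i \<le> j \<and> j < n}"

lemma finite_upper [simp]: "finite (upper n)"
  by (rule finite_subset[of _ "{..<n} \<times> {..<n}"]) (auto simp: upper_def)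

definition wigner :: "nat \<Rightarrow> (nat \<times> nat \<Rightarrow> real) \<Rightarrow> real mat" where
  "wigner n x = mat n n (\<lambda>(i, j). x (min i j, max i j) / sqrt n)"

lemma wigner_entry: "i < n \<Longrightarrow> j < n \<Longrightarrow> wigner n x $$ (i, j) = x (min i j, max i j) / sqrt n"
  by (simp add: wigner_def)

lemma real_symmetric_wigner: "real_symmetric n (wigner n x)"
  by (auto simp: real_symmetric_def wigner_def min.commute max.commute intro!: eq_matI)

lemma min_max_upper: "i < n \<Longrightarrow> j < n \<Longrightarrow> (min i j, max i j) \<in> upper n"
  by (auto simp: upper_def)

text \<open>The positions in the upper triangle that hold the off-diagonal entries of row \<open>i\<close>; \<open>row_other i\<close>
  recovers the column.\<close>

definition row_idx :: "nat \<Rightarrow> nat \<Rightarrow> (nat \<times> nat) set" where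
  "row_idx n i = (\<lambda>k. (min i k, max i k)) ` ({..<n} - {i})"

definition row_other :: "nat \<Rightarrow> nat \<times> nat \<Rightarrow> nat" where
  "row_other i e = (if fst e = i then snd e else fst e)"

lemma row_idx_bij: "bij_betw (row_other i) (row_idx n i) ({..<n} - {i})"
proof -
  have [simp]: "row_other i (min i k, max i k) = k" if "k \<noteq> i" for k
    using that by (simp add: row_other_def min_def max_def)
  show ?thesis
    by (rule bij_betw_byWitness[where f' = "\<lambda>k. (min i k, max i k)"]) (auto simp: row_idx_def)
qed

lemma row_idx_facts:
  "finite (row_idx n i)" "i < n \<Longrightarrow> row_idx n i \<subseteq> upper n" "card (row_idx n i) \<le> n"
proof -
  show "finite (row_idx n i)" by (simp add: row_idx_def)
  show "i < n \<Longrightarrow> row_idx n i \<subseteq> upper n" using min_max_upper by (auto simp: row_idx_def)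
  have "card (row_idx n i) \<le> card ({..<n} - {i})" unfolding row_idx_def by (rule card_image_le) simp
  also have "\<dots> \<le> card {..<n}" by (rule card_mono) auto
  finally show "card (row_idx n i) \<le> n" by simp
qed

lemma sum_row: "(\<Sum>k\<in>{..<n}-{i}. f k) = (\<Sum>e\<in>row_idx n i. f (row_other i e))"
  by (rule sum.reindex_bij_betw[OF row_idx_bij, symmetric])

lemma wigner_row:
  assumes "i < n" "e \<in> row_idx n i"
  shows "wigner n x $$ (i, row_other i e) = x e / sqrt n"
proof -
  obtain k where k: "k < n" "k \<noteq> i" "e = (min i k, max i k)" using assms(2) by (auto simp: row_idx_def)
  have "row_other i e = k" using k by (auto simp: row_other_def min_def max_def)
  thus ?thesis using assms(1) k by (simp add: wigner_entry)
qed

text \<open>The minor is a function of the entries outside row \<open>i\<close>.\<close>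

lemma clear_row_cong:
  assumes "\<And>e. e \<in> upper n - row_idx n i \<Longrightarrow> x e = y e"
  shows "clear_row i (wigner n x) = clear_row i (wigner n y)"
proof (rule eq_matI)
  fix j k assume "j < dim_row (clear_row i (wigner n y))" "k < dim_col (clear_row i (wigner n y))"
  hence jk: "j < n" "k < n" by (auto simp: clear_row_def wigner_def)
  show "clear_row i (wigner n x) $$ (j, k) = clear_row i (wigner n y) $$ (j, k)"
  proof (cases "j = i \<or> k = i")
    case False
    hence "(min j k, max j k) \<notin> row_idx n i" by (auto simp: row_idx_def min_def max_def split: if_splits)
    thus ?thesis using jk min_max_upper[OF jk] assms by (auto simp: clear_row_def wigner_def)
  qed (use jk in \<open>auto simp: clear_row_def wigner_def\<close>)
qed (auto simp: clear_row_def wigner_def)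

text \<open>Fubini: a bound that holds for the block \<open>J\<close> uniformly in the values of the block \<open>K\<close> holds for
  both together.\<close>

lemma emeasure_PiM_split_le:
  fixes P :: "real measure"
  assumes prob: "prob_space P" and JK: "finite J" "finite K" "J \<inter> K = {}"
    and bad: "bad \<in> sets (iid (J \<union> K) P)"
    and le: "\<And>y. y \<in> space (iid K P) \<Longrightarrow>
      emeasure (iid J P) {x \<in> space (iid J P). merge J K (x, y) \<in> bad} \<le> c"
  shows "emeasure (iid (J \<union> K) P) bad \<le> c"
proof -
  interpret product_prob_space "\<lambda>_. P" by (rule product_prob[OF prob])
  interpret K: prob_space "iid K P" by (rule prob_space_PiM) (rule prob)
  have KJ: "K \<inter> J = {}" "K \<union> J = J \<union> K" using JK by auto
  have "emeasure (iid (J \<union> K) P) bad = (\<integral>\<^sup>+x. indicator bad x \<partial>iid (K \<union> J) P)"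
    using bad by (simp add: KJ)
  also have "\<dots> = (\<integral>\<^sup>+y. \<integral>\<^sup>+x. indicator bad (merge K J (y, x)) \<partial>iid J P \<partial>iid K P)"
    using bad by (intro product_nn_integral_fold KJ JK) (simp add: KJ)
  also have "\<dots> \<le> (\<integral>\<^sup>+y. c \<partial>iid K P)"
  proof (intro nn_integral_mono)
    fix y assume y: "y \<in> space (iid K P)"
    have ev: "{x \<in> space (iid J P). merge J K (x, y) \<in> bad} \<in> sets (iid J P)"
    proof -
      have "(\<lambda>x. merge J K (x, y)) \<in> measurable (iid J P) (iid (J \<union> K) P)"
        using y by (intro measurable_compose[OF _ measurable_merge] measurable_Pair) auto
      from measurable_sets[OF this bad] show ?thesis
        by (simp add: vimage_def Int_def conj_commute)
    qed
    have "(\<integral>\<^sup>+x. indicator bad (merge K J (y, x)) \<partial>iid J P)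
        = (\<integral>\<^sup>+x. indicator {x \<in> space (iid J P). merge J K (x, y) \<in> bad} x \<partial>iid J P)"
      by (intro nn_integral_cong) (simp add: indicator_def merge_commute[OF KJ(1)])
    also have "\<dots> \<le> c" using le[OF y] by (simp add: nn_integral_indicator[OF ev])
    finally show "(\<integral>\<^sup>+x. indicator bad (merge K J (y, x)) \<partial>iid J P) \<le> c" .
  qed
  also have "\<dots> = c" by (simp add: K.emeasure_space_1)
  finally show ?thesis .
qed

text \<open>Failure of the conditions in \<open>controlled\<close>, as sets of upper triangles and without the reserve \<open>\<phi> /
  n\<close>. The bound on single entries is imposed on the whole triangle, since the Lipschitz estimates in \<open>z\<close>
  use it.\<close>

definition bad_quad :: "nat \<Rightarrow> real \<Rightarrow> nat \<Rightarrow> complex \<Rightarrow> (nat \<times> nat \<Rightarrow> real) set" where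
  "bad_quad n \<phi> i z = {x \<in> space (iid (upper n) borel).
     \<phi> * minor_frob n (wigner n x) i z / n < cmod (quad_fluct n (wigner n x) i z)}"

definition bad_lin :: "nat \<Rightarrow> real \<Rightarrow> nat \<Rightarrow> nat \<Rightarrow> complex \<Rightarrow> (nat \<times> nat \<Rightarrow> real) set" where
  "bad_lin n \<phi> i j z = {x \<in> space (iid (upper n) borel).
     \<phi> / sqrt n * minor_col n (wigner n x) i j z < cmod (lin_fluct n (wigner n x) i j z)}"

definition bad_entry :: "nat \<Rightarrow> real \<Rightarrow> nat \<times> nat \<Rightarrow> (nat \<times> nat \<Rightarrow> real) set" where
  "bad_entry n \<phi> e = {x \<in> space (iid (upper n) borel). \<phi> < \<bar>x e\<bar>}"

lemma measurable_wigner_entry: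
  assumes "i < n" "j < n"
  shows "(\<lambda>x. wigner n x $$ (i, j)) \<in> borel_measurable (iid (upper n) borel)"
  using min_max_upper[OF assms] by (simp add: wigner_entry assms)

lemma measurable_minor_res:
  assumes "Im z > 0" "k < n" "l < n"
  shows "(\<lambda>x. minor_res (wigner n x) i z k l) \<in> borel_measurable (iid (upper n) borel)"
  unfolding minor_res_def
proof (rule borel_measurable_resolvent[OF _ _ assms])
  show "real_symmetric n (clear_row i (wigner n x))" for x
    by (intro real_symmetric_clear_row real_symmetric_wigner)
  fix a b assume ab: "a < n" "b < n"
  have "clear_row i (wigner n x) $$ (a, b) = (if a = i \<or> b = i then 0 else wigner n x $$ (a, b))" for x
    using ab by (simp add: clear_row_def wigner_def)
  thus "(\<lambda>x. clear_row i (wigner n x) $$ (a, b)) \<in> borel_measurable (iid (upper n) borel)"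
    using measurable_wigner_entry[OF ab] by simp
qed

lemma bad_sets:
  assumes z: "Im z > 0"
  shows "i < n \<Longrightarrow> bad_quad n \<phi> i z \<in> sets (iid (upper n) borel)"
    and "i < n \<Longrightarrow> j < n \<Longrightarrow> bad_lin n \<phi> i j z \<in> sets (iid (upper n) borel)"
    and "e \<in> upper n \<Longrightarrow> bad_entry n \<phi> e \<in> sets (iid (upper n) borel)"
proof -
  let ?B = "PiM (upper n) (\<lambda>_. borel :: real measure)"
  note [measurable] = measurable_minor_res[OF z] measurable_wigner_entry
  show "bad_quad n \<phi> i z \<in> sets ?B" if "i < n"
  proof -
    have "(\<lambda>x. minor_frob n (wigner n x) i z) \<in> borel_measurable ?B"
      unfolding minor_frob_def using that
      by (intro measurable_compose[OF _ borel_measurable_sqrt] borel_measurable_sum borel_measurable_power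
          measurable_compose[OF measurable_minor_res[OF z] borel_measurable_norm]) auto
    moreover have "(\<lambda>x. quad_fluct n (wigner n x) i z) \<in> borel_measurable ?B"
      unfolding quad_fluct_def using that
      by (intro borel_measurable_diff borel_measurable_divide borel_measurable_sum borel_measurable_times
          borel_measurable_of_real measurable_wigner_entry measurable_minor_res[OF z] borel_measurable_const) auto
    ultimately show ?thesis unfolding bad_quad_def by measurable
  qed
  show "bad_lin n \<phi> i j z \<in> sets ?B" if "i < n" "j < n"
  proof -
    have "(\<lambda>x. minor_col n (wigner n x) i j z) \<in> borel_measurable ?B"
      unfolding minor_col_def using that
      by (intro measurable_compose[OF _ borel_measurable_sqrt] borel_measurable_sum borel_measurable_power
          measurable_compose[OF measurable_minor_res[OF z] borel_measurable_norm]) auto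
    moreover have "(\<lambda>x. lin_fluct n (wigner n x) i j z) \<in> borel_measurable ?B"
      unfolding lin_fluct_def using that
      by (intro borel_measurable_sum borel_measurable_times
          borel_measurable_of_real measurable_wigner_entry measurable_minor_res[OF z]) auto
    ultimately show ?thesis unfolding bad_lin_def by measurable
  qed
  show "bad_entry n \<phi> e \<in> sets ?B" if "e \<in> upper n"
    unfolding bad_entry_def using that by measurable
qed

text \<open>The situation after conditioning on the mixing variable: independent entries with law \<open>P\<close>, mean
  \<open>\<mu>\<close> and second moment \<open>v\<close>.\<close>

locale iid_entries =
  fixes P :: "real measure" and \<mu> v K :: real and p :: nat
  assumes w: "centred_with_moment P (\<lambda>y. y - \<mu>) p K" and u: "centred_with_moment P (\<lambda>y. y\<^sup>2 - v) p K"
    and p: "1 \<le> p"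
begin

lemma P: "prob_space P" "sets P = sets borel"
  using w by (auto simp: centred_with_moment_def)

lemma setsPi: "sets (iid I P) = sets (iid I borel)"
  by (intro sets_PiM_cong refl P)

lemma spacePi: "space (iid I P) = space (iid I borel)"
  by (rule sets_eq_imp_space_eq[OF setsPi])

definition bound :: "nat \<Rightarrow> real \<Rightarrow> ennreal" where
  "bound n \<phi> = ennreal (tail_factor p K * mixing_weight p n \<mu> v / \<phi> ^ (2 * p))"

lemma emeasure_split_le:
  assumes J: "J \<subseteq> upper n" and bad: "bad \<in> sets (iid (upper n) borel)"
    and le: "\<And>y. y \<in> space (iid (upper n - J) P) \<Longrightarrow>
      emeasure (iid J P) {x \<in> space (iid J P). merge J (upper n - J) (x, y) \<in> bad} \<le> c"
  shows "emeasure (iid (upper n) P) bad \<le> c"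
proof -
  have U: "J \<union> (upper n - J) = upper n" "J \<union> upper n = upper n" using J by auto
  have "emeasure (PiM (J \<union> (upper n - J)) (\<lambda>_. P)) bad \<le> c"
    using le bad by (intro emeasure_PiM_split_le[OF P(1)] finite_subset[OF J]) (auto simp: U setsPi)
  thus ?thesis by (simp add: U)
qed

lemma merge_space:
  assumes "x \<in> space (iid J P)" "y \<in> space (iid (upper n - J) P)" "J \<subseteq> upper n"
  shows "merge J (upper n - J) (x, y) \<in> space (iid (upper n) borel)"
proof -
  have U: "J \<union> (upper n - J) = upper n" "J \<union> upper n = upper n" using assms(3) by auto
  have "merge J (upper n - J) (x, y) \<in> space (PiM (J \<union> (upper n - J)) (\<lambda>_. P))"
    using assms measurable_space[OF measurable_merge, of "(x, y)" J "\<lambda>_. P" "upper n - J"]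
    by (simp add: space_pair_measure)
  thus ?thesis by (simp add: U spacePi)
qed

lemma emeasure_bad_entry:
  assumes n: "1 \<le> n" and e: "e \<in> upper n" and \<phi>: "0 < \<phi>"
  shows "emeasure (iid (upper n) P) (bad_entry n \<phi> e) \<le> bound n \<phi>"
proof (rule emeasure_split_le[of "{e}"])
  show "bad_entry n \<phi> e \<in> sets (iid (upper n) borel)"
    using bad_sets(3)[of \<i> e n \<phi>] e by simp
  fix y assume y: "y \<in> space (iid (upper n - {e}) P)"
  have "{x \<in> space (PiM {e} (\<lambda>_. P)). merge {e} (upper n - {e}) (x, y) \<in> bad_entry n \<phi> e}
     = {x \<in> space (PiM {e} (\<lambda>_. P)). \<phi> * sqrt (\<Sum>k\<in>{e}. (cmod ((\<lambda>_. 1) k))\<^sup>2) < cmod (\<Sum>k\<in>{e}. (\<lambda>_. 1) k * of_real (x k))}"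
    using merge_space[OF _ y] e by (auto simp: bad_entry_def)
  also have "emeasure (PiM {e} (\<lambda>_. P)) \<dots> \<le> bound n \<phi>"
    unfolding bound_def using n \<phi> by (intro linear_deviation[OF w p]) auto
  finally show "emeasure (PiM {e} (\<lambda>_. P))
      {x \<in> space (PiM {e} (\<lambda>_. P)). merge {e} (upper n - {e}) (x, y) \<in> bad_entry n \<phi> e} \<le> bound n \<phi>" .
qed (use e in auto)

lemma minor_res_merge:
  assumes "i < n"
  shows "minor_res (wigner n (merge (row_idx n i) (upper n - row_idx n i) (x, y))) i z
       = minor_res (wigner n y) i z"
proof -
  have "clear_row i (wigner n (merge (row_idx n i) (upper n - row_idx n i) (x, y))) = clear_row i (wigner n y)"
    by (rule clear_row_cong) simp
  thus ?thesis by (simp add: minor_res_def[abs_def])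
qed

lemma wigner_row_merge:
  assumes "i < n" "e \<in> row_idx n i"
  shows "wigner n (merge (row_idx n i) (upper n - row_idx n i) (x, y)) $$ (i, row_other i e) = x e / sqrt n"
  using assms by (simp add: wigner_row)

lemma emeasure_bad_lin:
  assumes i: "i < n" "j < n" and z: "Im z > 0" and \<phi>: "0 < \<phi>"
  shows "emeasure (iid (upper n) P) (bad_lin n \<phi> i j z) \<le> bound n \<phi>"
proof (rule emeasure_split_le[OF row_idx_facts(2)[OF i(1)] bad_sets(2)[OF z i]])
  let ?J = "row_idx n i" and ?K = "upper n - row_idx n i"
  fix y assume y: "y \<in> space (iid ?K P)"
  define b where "b e = minor_res (wigner n y) i z (row_other i e) j" for e
  have n: "0 < n" using i by simp
  have lin: "lin_fluct n (wigner n (merge ?J ?K (x, y))) i j z = (\<Sum>e\<in>?J. b e * of_real (x e)) / of_real (sqrt n)" for x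
    unfolding lin_fluct_def minor_res_merge[OF i(1)] sum_row b_def sum_divide_distrib
    by (intro sum.cong refl) (simp add: wigner_row_merge[OF i(1)])
  have col: "minor_col n (wigner n (merge ?J ?K (x, y))) i j z = sqrt (\<Sum>e\<in>?J. (cmod (b e))\<^sup>2)" for x
    unfolding minor_col_def minor_res_merge[OF i(1)] sum_row b_def ..
  have "{x \<in> space (iid ?J P). merge ?J ?K (x, y) \<in> bad_lin n \<phi> i j z}
     = {x \<in> space (iid ?J P). \<phi> * sqrt (\<Sum>e\<in>?J. (cmod (b e))\<^sup>2) < cmod (\<Sum>e\<in>?J. b e * of_real (x e))}"
    using merge_space[OF _ y row_idx_facts(2)[OF i(1)]] n
    by (auto simp: bad_lin_def lin col norm_divide divide_less_cancel)
  also have "emeasure (iid ?J P) \<dots> \<le> bound n \<phi>"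
    unfolding bound_def using row_idx_facts[of n i] \<phi> by (intro linear_deviation[OF w p]) auto
  finally show "emeasure (iid ?J P)
      {x \<in> space (iid ?J P). merge ?J ?K (x, y) \<in> bad_lin n \<phi> i j z} \<le> bound n \<phi>" .
qed

lemma emeasure_bad_quad:
  assumes i: "i < n" and z: "Im z > 0" and \<phi>: "0 < \<phi>"
  shows "emeasure (iid (upper n) P) (bad_quad n \<phi> i z) \<le> bound n \<phi>"
proof (rule emeasure_split_le[OF row_idx_facts(2)[OF i] bad_sets(1)[OF z i]])
  let ?J = "row_idx n i" and ?K = "upper n - row_idx n i"
  fix y assume y: "y \<in> space (iid ?K P)"
  define b where "b e f = minor_res (wigner n y) i z (row_other i e) (row_other i f)" for e f
  have n: "0 < n" using i by simp
  have sq: "complex_of_real (sqrt n) * complex_of_real (sqrt n) = of_nat n"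
    by (simp flip: of_real_mult)
  have quad: "quad_fluct n (wigner n (merge ?J ?K (x, y))) i z
      = ((\<Sum>e\<in>?J. \<Sum>f\<in>?J. b e f * of_real (x e) * of_real (x f)) - (\<Sum>e\<in>?J. b e e)) / of_nat n" for x
  proof -
    have "(\<Sum>k\<in>{..<n}-{i}. \<Sum>l\<in>{..<n}-{i}. of_real (wigner n (merge ?J ?K (x, y)) $$ (i, k))
        * minor_res (wigner n y) i z k l * of_real (wigner n (merge ?J ?K (x, y)) $$ (i, l)))
      = (\<Sum>e\<in>?J. \<Sum>f\<in>?J. b e f * of_real (x e) * of_real (x f) / of_nat n)"
      unfolding sum_row
      by (intro sum.cong refl) (simp add: wigner_row_merge[OF i] b_def mult_ac flip: sq)
    thus ?thesis
      unfolding quad_fluct_def minor_res_merge[OF i] sum_row[of "\<lambda>k. minor_res (wigner n y) i z k k"]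
      by (simp add: b_def diff_divide_distrib sum_divide_distrib)
  qed
  have frob: "minor_frob n (wigner n (merge ?J ?K (x, y))) i z = sqrt (\<Sum>e\<in>?J. \<Sum>f\<in>?J. (cmod (b e f))\<^sup>2)" for x
    unfolding minor_frob_def minor_res_merge[OF i] sum_row b_def ..
  have sym: "b e f = b f e" if "e \<in> ?J" "f \<in> ?J" for e f
  proof -
    have "symm_on ({..<n} - {i}) (\<lambda>j k. wigner n y $$ (j, k))"
      by (rule symm_on_subset[OF real_symmetric_symm_on[OF real_symmetric_wigner]]) auto
    moreover have "row_other i e \<in> {..<n} - {i}" "row_other i f \<in> {..<n} - {i}"
      using that row_idx_bij[of i n] by (auto simp: bij_betw_def)
    ultimately show ?thesis
      unfolding b_def by (intro green_sym[OF _ _ green_minor_res[OF real_symmetric_wigner z i]]) auto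
  qed
  have "{x \<in> space (iid ?J P). merge ?J ?K (x, y) \<in> bad_quad n \<phi> i z}
     = {x \<in> space (iid ?J P). \<phi> * sqrt (\<Sum>e\<in>?J. \<Sum>f\<in>?J. (cmod (b e f))\<^sup>2)
          < cmod ((\<Sum>e\<in>?J. \<Sum>f\<in>?J. b e f * of_real (x e) * of_real (x f)) - (\<Sum>e\<in>?J. b e e))}"
    using merge_space[OF _ y row_idx_facts(2)[OF i]] n
    by (auto simp: bad_quad_def quad frob norm_divide divide_less_cancel)
  also have "emeasure (iid ?J P) \<dots> \<le> bound n \<phi>"
    unfolding bound_def using row_idx_facts[of n i] \<phi> sym by (intro quadratic_deviation[OF w u p]) auto
  finally show "emeasure (iid ?J P)
      {x \<in> space (iid ?J P). merge ?J ?K (x, y) \<in> bad_quad n \<phi> i z} \<le> bound n \<phi>" .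
qed

end

section \<open>Averaging over the mixing space\<close>

text \<open>The preimage of an open set under \<open>\<mu> \<mapsto> \<integral>f d\<mu>\<close> is one of the sets that generate the
  weak topology.\<close>

lemma integral_weak_measurable:
  fixes f :: "real \<Rightarrow> real"
  assumes P: "P \<in> measurable T weak_borel" and f: "continuous_on UNIV f" "bounded (range f)"
  shows "(\<lambda>t. \<integral>x. f x \<partial>P t) \<in> borel_measurable T"
proof (rule borel_measurableI)
  fix U :: "real set" assume "open U"
  let ?B = "{\<mu> \<in> prob_measures_R. (\<integral>x. f x \<partial>\<mu>) \<in> U}"
  have "openin weak_topology ?B"
    unfolding weak_topology_def using f \<open>open U\<close> by (intro topology_generated_by_Basis) blast
  moreover have "{U. openin weak_topology U} \<subseteq> Pow prob_measures_R"
  proof safe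
    fix V x assume "openin weak_topology V" "x \<in> V"
    hence "x \<in> topspace weak_topology" using openin_subset by blast
    thus "x \<in> prob_measures_R" by (auto simp: weak_topology_def)
  qed
  ultimately have "?B \<in> sets weak_borel" unfolding weak_borel_def by auto
  from measurable_sets[OF P this] have "P -` ?B \<inter> space T \<in> sets T" .
  moreover have "P -` ?B \<inter> space T = (\<lambda>t. \<integral>x. f x \<partial>P t) -` U \<inter> space T"
    using measurable_space[OF P] unfolding weak_borel_def space_measure_of_conv by auto
  ultimately show "(\<lambda>t. \<integral>x. f x \<partial>P t) -` U \<inter> space T \<in> sets T" by simp
qed

lemma weak_borel_kernel:
  assumes "P \<in> measurable T weak_borel" "t \<in> space T"
  shows "prob_space (P t)" "sets (P t) = sets borel"
proof -
  have "sets (P t) = sets borel \<and> prob_space (P t)"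
    using measurable_space[OF assms]
    unfolding weak_borel_def space_measure_of_conv prob_measures_R_def mem_Collect_eq .
  thus "prob_space (P t)" "sets (P t) = sets borel" by blast+
qed

text \<open>The monomial is unbounded; clipping it at \<open>\<plusminus> n\<close> gives bounded continuous functions whose integrals
  converge.\<close>

lemma moment_measurable:
  assumes P: "P \<in> measurable T weak_borel"
    and int: "\<And>t. t \<in> space T \<Longrightarrow> integrable (P t) (\<lambda>x. x ^ l)"
  shows "moment P l \<in> borel_measurable T"
proof -
  define c where "c n x = max (- real n) (min (real n) (x ^ l))" for n and x :: real
  show ?thesis
  proof (rule borel_measurable_LIMSEQ_real)
    show "(\<lambda>t. \<integral>x. c n x \<partial>P t) \<in> borel_measurable T" for n
    proof (rule integral_weak_measurable[OF P])
      show "continuous_on UNIV (c n)" unfolding c_def by (intro continuous_intros)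
      have "norm (c n x) \<le> real n" for x by (auto simp: c_def)
      thus "bounded (range (c n))" by (intro boundedI) auto
    qed
    fix t assume t: "t \<in> space T"
    note [measurable_cong] = weak_borel_kernel(2)[OF P t]
    show "(\<lambda>n. \<integral>x. c n x \<partial>P t) \<longlonglongrightarrow> moment P l t"
      unfolding moment_def
    proof (rule integral_dominated_convergence[where w = "\<lambda>x. \<bar>x ^ l\<bar>"])
      show "integrable (P t) (\<lambda>x. \<bar>x ^ l\<bar>)" using int[OF t] by (rule integrable_abs)
      show "AE x in P t. (\<lambda>n. c n x) \<longlonglongrightarrow> x ^ l"
      proof (rule AE_I2, rule tendsto_eventually)
        fix x :: real
        obtain n0 :: nat where n0: "\<bar>x ^ l\<bar> \<le> n0" using real_arch_simple[of "\<bar>x ^ l\<bar>"] by (elim exE)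
        have "c n x = x ^ l" if "n0 \<le> n" for n
        proof -
          have "\<bar>x ^ l\<bar> \<le> n" using n0 that by linarith
          thus ?thesis by (auto simp: c_def)
        qed
        thus "\<forall>\<^sub>F n in sequentially. c n x = x ^ l" by (auto simp: eventually_sequentially)
      qed
      show "AE x in P t. norm (c n x) \<le> \<bar>x ^ l\<bar>" for n
        by (rule AE_I2) (auto simp: c_def)
    qed (simp_all add: c_def)
  qed
qed

lemma finite_even_moment:
  fixes f :: "real \<Rightarrow> real"
  assumes Q: "prob_space Q" "sets Q = sets borel" and f: "f \<in> borel_measurable borel" and p: "1 \<le> p"
    and le: "(\<integral>\<^sup>+y. ennreal (\<bar>f y\<bar> ^ (2 * p)) \<partial>Q) \<le> ennreal K" "0 \<le> K"
  shows "integrable Q f" "integrable Q (\<lambda>y. f y ^ (2 * p))" "(\<integral>y. f y ^ (2 * p) \<partial>Q) \<le> K"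
proof -
  interpret prob_space Q by fact
  have [measurable_cong]: "sets Q = sets borel" by fact
  note [measurable] = f
  have abs: "\<bar>f y\<bar> ^ (2 * p) = f y ^ (2 * p)" for y by (simp add: power_even_abs)
  have nn: "0 \<le> f y ^ (2 * p)" for y by (simp add: zero_le_even_power)
  show int: "integrable Q (\<lambda>y. f y ^ (2 * p))"
    using le nn by (intro integrableI_nonneg) (auto simp: abs intro: le_less_trans)
  show "integrable Q f"
  proof (rule Bochner_Integration.integrable_bound)
    show "integrable Q (\<lambda>y. 1 + f y ^ (2 * p))" using int by simp
    show "AE y in Q. norm (f y) \<le> norm (1 + f y ^ (2 * p))"
    proof (rule AE_I2)
      fix y
      have "\<bar>f y\<bar> \<le> 1 + \<bar>f y\<bar> ^ (2 * p)"
      proof (cases "\<bar>f y\<bar> \<le> 1")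
        case True thus ?thesis by (simp add: add_increasing2)
      next
        case False
        hence "\<bar>f y\<bar> ^ 1 \<le> \<bar>f y\<bar> ^ (2 * p)" using p by (intro power_increasing) auto
        thus ?thesis by simp
      qed
      thus "norm (f y) \<le> norm (1 + f y ^ (2 * p))" using nn[of y] by (simp add: abs)
    qed
  qed measurable
  have "ennreal (\<integral>y. f y ^ (2 * p) \<partial>Q) = (\<integral>\<^sup>+y. ennreal (f y ^ (2 * p)) \<partial>Q)"
    using int nn by (intro nn_integral_eq_integral[symmetric]) auto
  also have "\<dots> \<le> ennreal K" using le by (simp add: abs)
  finally show "(\<integral>y. f y ^ (2 * p) \<partial>Q) \<le> K" using le(2) by simp
qed

lemma iid_entries_of_moments:
  assumes P: "P \<in> measurable T weak_borel" and p: "1 \<le> p" and K: "0 \<le> K"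
    and b1: "(SUP t\<in>space T. \<integral>\<^sup>+y. ennreal (\<bar>y - moment P 1 t\<bar> ^ (2 * p)) \<partial>(P t)) \<le> ennreal K"
    and b2: "(SUP t\<in>space T. \<integral>\<^sup>+y. ennreal (\<bar>y\<^sup>2 - moment P 2 t\<bar> ^ (2 * p)) \<partial>(P t)) \<le> ennreal K"
    and t: "t \<in> space T"
  shows "iid_entries (P t) (moment P 1 t) (moment P 2 t) K p"
    "integrable (P t) (\<lambda>y. y ^ 1)" "integrable (P t) (\<lambda>y. y ^ 2)"
proof -
  note k = weak_borel_kernel[OF P t]
  interpret prob_space "P t" by (rule k)
  have [measurable_cong]: "sets (P t) = sets borel" by (rule k)
  have n1: "(\<integral>\<^sup>+y. ennreal (\<bar>y - moment P 1 t\<bar> ^ (2 * p)) \<partial>(P t)) \<le> ennreal K"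
    by (rule order_trans[OF SUP_upper[OF t] b1])
  have n2: "(\<integral>\<^sup>+y. ennreal (\<bar>y\<^sup>2 - moment P 2 t\<bar> ^ (2 * p)) \<partial>(P t)) \<le> ennreal K"
    by (rule order_trans[OF SUP_upper[OF t] b2])
  note f1 = finite_even_moment[OF k _ p n1 K] and f2 = finite_even_moment[OF k _ p n2 K]
  have i1: "integrable (P t) (\<lambda>y. y)"
    using Bochner_Integration.integrable_add[OF f1(1) integrable_const[of "moment P 1 t"]] by simp
  have i2: "integrable (P t) (\<lambda>y. y\<^sup>2)"
    using Bochner_Integration.integrable_add[OF f2(1) integrable_const[of "moment P 2 t"]] by simp
  show "integrable (P t) (\<lambda>y. y ^ 1)" "integrable (P t) (\<lambda>y. y ^ 2)" using i1 i2 by simp_all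
  have "(\<integral>y. y - moment P 1 t \<partial>P t) = 0" "(\<integral>y. y\<^sup>2 - moment P 2 t \<partial>P t) = 0"
    using i1 i2 prob_space by (simp_all add: moment_def)
  thus "iid_entries (P t) (moment P 1 t) (moment P 2 t) K p"
    using f1 f2 k p by (intro iid_entries.intro) (auto simp: centred_with_moment_def)
qed

text \<open>If the integrand of the mixture is not integrable, its Bochner integral is 0 and the bound is trivial; otherwise it agrees
  with the nonnegative integral.\<close>

lemma de_finetti_prob_le:
  assumes df: "de_finetti_type M I X T P" and bad: "bad \<in> sets (iid I borel)"
    and le: "\<And>t. t \<in> space T \<Longrightarrow> emeasure (iid I (P t)) bad \<le> g t"
    and g: "(\<integral>\<^sup>+t. g t \<partial>T) \<le> ennreal C" and C: "0 \<le> C"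
  shows "measure M {\<omega> \<in> space M. (\<lambda>i\<in>I. X i \<omega>) \<in> bad} \<le> C"
proof -
  let ?f = "\<lambda>t. measure (iid I (P t)) bad"
  have P: "P \<in> measurable T weak_borel" using df by (simp add: de_finetti_type_def)
  have eq: "measure M {\<omega> \<in> space M. (\<lambda>i\<in>I. X i \<omega>) \<in> bad} = (\<integral>t. ?f t \<partial>T)"
    using df bad by (simp add: de_finetti_type_def)
  show ?thesis
  proof (cases "integrable T ?f")
    case False
    thus ?thesis using C by (simp add: eq not_integrable_integral_eq)
  next
    case True
    have "ennreal (\<integral>t. ?f t \<partial>T) = (\<integral>\<^sup>+t. ennreal (?f t) \<partial>T)"
      using True by (intro nn_integral_eq_integral[symmetric]) auto
    also have "\<dots> \<le> (\<integral>\<^sup>+t. g t \<partial>T)"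
    proof (intro nn_integral_mono)
      fix t assume t: "t \<in> space T"
      interpret prob_space "iid I (P t)"
        by (rule prob_space_PiM) (rule weak_borel_kernel(1)[OF P t])
      show "ennreal (?f t) \<le> g t" using le[OF t] by (simp add: emeasure_eq_measure)
    qed
    also note g
    finally show ?thesis using C by (simp add: eq)
  qed
qed

text \<open>The factors \<open>n\<^sup>p\<close> in the weight cancel exactly against the decay of the moments over the mixing space.\<close>

lemma mixing_weight_integral:
  fixes \<mu> v :: "'t \<Rightarrow> real"
  assumes T: "prob_space T" and [measurable]: "\<mu> \<in> borel_measurable T" "v \<in> borel_measurable T"
    and N: "1 \<le> N" and K: "0 \<le> K1" "0 \<le> K2"
    and m1: "(\<integral>\<^sup>+t. ennreal (\<bar>\<mu> t\<bar> ^ (2 * p)) \<partial>T) \<le> ennreal (K1 * real N powr (- real (2 * p) / 2))"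
    and m2: "(\<integral>\<^sup>+t. ennreal (\<bar>1 - v t\<bar> ^ (2 * p)) \<partial>T) \<le> ennreal (K1 * real N powr (- real (2 * p) / 2))"
    and m4: "(\<integral>\<^sup>+t. ennreal (\<bar>\<mu> t\<bar> ^ (4 * p)) \<partial>T) \<le> ennreal (K2 * real N powr (- real (4 * p) / 2))"
  shows "(\<integral>\<^sup>+t. ennreal (mixing_weight p N (\<mu> t) (v t)) \<partial>T) \<le> ennreal (1 + 2 * K1 + K2)"
proof -
  interpret prob_space T by fact
  have pw: "real N powr (- real (2 * q) / 2) = 1 / real N ^ q" for q
    using N by (simp add: powr_minus_divide powr_realpow)
  have scale: "ennreal (real N ^ q) * X \<le> ennreal K"
    if "X \<le> ennreal (K * real N powr (- real (2 * q) / 2))" "0 \<le> K" for X q K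
  proof -
    have "ennreal (real N ^ q) * X \<le> ennreal (real N ^ q) * ennreal (K * (1 / real N ^ q))"
      using that unfolding pw by (intro mult_left_mono) auto
    also have "\<dots> = ennreal K" using N that by (simp flip: ennreal_mult)
    finally show ?thesis .
  qed
  have ev: "\<bar>x\<bar> ^ (2 * q) = x ^ (2 * q)" for x :: real and q by (simp add: power_even_abs)
  have m4': "(\<integral>\<^sup>+t. ennreal (\<bar>\<mu> t\<bar> ^ (4 * p)) \<partial>T) \<le> ennreal (K2 * real N powr (- real (2 * (2 * p)) / 2))"
    using m4 by simp
  have ev4: "\<bar>x\<bar> ^ (4 * p) = x ^ (4 * p)" for x :: real by (simp add: power_even_abs)
  have sw: "(v t - 1) ^ (2 * p) = (1 - v t) ^ (2 * p)" for t
    by (simp add: power_mult power2_commute)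
  have "(\<integral>\<^sup>+t. ennreal (mixing_weight p N (\<mu> t) (v t)) \<partial>T)
     = (\<integral>\<^sup>+t. 1 + ennreal (real N ^ p) * ennreal (\<bar>\<mu> t\<bar> ^ (2 * p))
          + ennreal (real N ^ (2 * p)) * ennreal (\<bar>\<mu> t\<bar> ^ (4 * p))
          + ennreal (real N ^ p) * ennreal (\<bar>1 - v t\<bar> ^ (2 * p)) \<partial>T)"
    unfolding mixing_weight_def sw ev ev4
    by (intro nn_integral_cong) (simp add: zero_le_even_power flip: ennreal_mult ennreal_plus ennreal_1)
  also have "\<dots> = 1 + ennreal (real N ^ p) * (\<integral>\<^sup>+t. ennreal (\<bar>\<mu> t\<bar> ^ (2 * p)) \<partial>T)
          + ennreal (real N ^ (2 * p)) * (\<integral>\<^sup>+t. ennreal (\<bar>\<mu> t\<bar> ^ (4 * p)) \<partial>T)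
          + ennreal (real N ^ p) * (\<integral>\<^sup>+t. ennreal (\<bar>1 - v t\<bar> ^ (2 * p)) \<partial>T)"
    by (simp add: nn_integral_add nn_integral_cmult emeasure_space_1)
  also have "\<dots> \<le> 1 + ennreal K1 + ennreal K2 + ennreal K1"
    by (intro add_mono scale m1 m2 m4' K order_refl)
  also have "\<dots> = ennreal (1 + 2 * K1 + K2)"
    using K by (simp add: add_ac flip: ennreal_plus ennreal_1)
  finally show ?thesis .
qed

definition bad_family :: "nat \<Rightarrow> real \<Rightarrow> (nat \<times> nat \<Rightarrow> real) set set" where
  "bad_family N \<phi> = bad_entry N \<phi> ` upper N
     \<union> {bad_quad N \<phi> i z | i z. i < N \<and> 0 < Im z}
     \<union> {bad_lin N \<phi> i j z | i j z. i < N \<and> j < N \<and> 0 < Im z}"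

lemma bad_family_sets: "bad \<in> bad_family N \<phi> \<Longrightarrow> bad \<in> sets (iid (upper N) borel)"
  by (auto simp: bad_family_def intro: bad_sets(1,2) bad_sets(3)[of \<i>])

lemma (in iid_entries) emeasure_bad_family:
  assumes "bad \<in> bad_family n \<phi>" "1 \<le> n" "0 < \<phi>"
  shows "emeasure (iid (upper n) P) bad \<le> bound n \<phi>"
  using assms(1)[unfolded bad_family_def] assms(2,3)
  by (auto intro: emeasure_bad_entry emeasure_bad_quad emeasure_bad_lin)

text \<open>Given the mixing variable, every bad event has probability at most a constant times \<open>mixing_weight /
  \<phi>\<^sup>2\<^sup>p\<close>; the weight has bounded average.\<close>

lemma curie_weiss_bad_events:
  assumes cw: "curie_weiss_type M H T P" and p: "1 \<le> p"
  shows "\<exists>C\<ge>0. \<forall>N\<ge>1. \<exists>X. (\<forall>e\<in>upper N. X e \<in> borel_measurable M) \<and>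
           (\<forall>\<omega>\<in>space M. H N \<omega> = wigner N (\<lambda>e\<in>upper N. X e \<omega>)) \<and>
           (\<forall>\<phi>>0. \<forall>bad\<in>bad_family N \<phi>.
              measure M {\<omega> \<in> space M. (\<lambda>e\<in>upper N. X e \<omega>) \<in> bad} \<le> C / \<phi> ^ (2 * p))"
    (is "\<exists>C\<ge>0. \<forall>N\<ge>1. \<exists>X. ?Q C N X")
proof -
  have mom: "\<exists>K\<ge>0. \<forall>N\<ge>1.
        (\<integral>\<^sup>+t. ennreal (\<bar>moment (P N) 1 t\<bar> ^ q) \<partial>(T N)) \<le> ennreal (K * real N powr (- real q / 2)) \<and>
        (\<integral>\<^sup>+t. ennreal (\<bar>1 - moment (P N) 2 t\<bar> ^ q) \<partial>(T N)) \<le> ennreal (K * real N powr (- real q / 2)) \<and>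
        (SUP t\<in>space (T N). \<integral>\<^sup>+y. ennreal (\<bar>y - moment (P N) 1 t\<bar> ^ q) \<partial>(P N t)) \<le> ennreal K \<and>
        (SUP t\<in>space (T N). \<integral>\<^sup>+y. ennreal (\<bar>y\<^sup>2 - moment (P N) 2 t\<bar> ^ q) \<partial>(P N t)) \<le> ennreal K"
    if "even q" "0 < q" for q
    by (rule mp[OF spec[OF conjunct2[OF conjunct2[OF cw[unfolded curie_weiss_type_def]]], of q] conjI[OF that]])
  from mom[of "2 * p"] p obtain K1 where K1: "0 \<le> K1" and
    k1: "\<And>N. 1 \<le> N \<Longrightarrow> (\<integral>\<^sup>+t. ennreal (\<bar>moment (P N) 1 t\<bar> ^ (2 * p)) \<partial>(T N)) \<le> ennreal (K1 * real N powr (- real (2 * p) / 2))"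
      "\<And>N. 1 \<le> N \<Longrightarrow> (\<integral>\<^sup>+t. ennreal (\<bar>1 - moment (P N) 2 t\<bar> ^ (2 * p)) \<partial>(T N)) \<le> ennreal (K1 * real N powr (- real (2 * p) / 2))"
      "\<And>N. 1 \<le> N \<Longrightarrow> (SUP t\<in>space (T N). \<integral>\<^sup>+y. ennreal (\<bar>y - moment (P N) 1 t\<bar> ^ (2 * p)) \<partial>(P N t)) \<le> ennreal K1"
      "\<And>N. 1 \<le> N \<Longrightarrow> (SUP t\<in>space (T N). \<integral>\<^sup>+y. ennreal (\<bar>y\<^sup>2 - moment (P N) 2 t\<bar> ^ (2 * p)) \<partial>(P N t)) \<le> ennreal K1"
    by auto
  from mom[of "4 * p"] p obtain K2 where K2: "0 \<le> K2" and
    k2: "\<And>N. 1 \<le> N \<Longrightarrow> (\<integral>\<^sup>+t. ennreal (\<bar>moment (P N) 1 t\<bar> ^ (4 * p)) \<partial>(T N)) \<le> ennreal (K2 * real N powr (- real (4 * p) / 2))"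
    by auto
  define C where "C = tail_factor p K1 * (1 + 2 * K1 + K2)"
  have C: "0 \<le> C" using K1 K2 tail_factor_nonneg by (simp add: C_def)
  show ?thesis
  proof (intro exI[of _ C] conjI allI impI C)
    fix N :: nat assume N: "1 \<le> N"
    have "\<exists>X :: nat \<times> nat \<Rightarrow> 'a \<Rightarrow> real. de_finetti_type M (upper N) X (T N) (P N) \<and>
        (\<forall>\<omega>\<in>space M. \<forall>i j. i \<le> j \<and> j < N \<longrightarrow> H N \<omega> $$ (i, j) = 1 / sqrt (real N) * X (i, j) \<omega>)"
      unfolding upper_def
      by (rule mp[OF spec[OF conjunct1[OF conjunct2[OF cw[unfolded curie_weiss_type_def]]], of N] N])
    then obtain X :: "nat \<times> nat \<Rightarrow> 'a \<Rightarrow> real" where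
      df: "de_finetti_type M (upper N) X (T N) (P N)" and
      HX: "\<forall>\<omega>\<in>space M. \<forall>i j. i \<le> j \<and> j < N \<longrightarrow> H N \<omega> $$ (i, j) = 1 / sqrt (real N) * X (i, j) \<omega>"
      by (elim exE conjE)
    have P: "P N \<in> measurable (T N) weak_borel" and T: "prob_space (T N)"
      and X: "\<forall>e\<in>upper N. X e \<in> borel_measurable M"
      using df by (auto simp: de_finetti_type_def)
    have HN: "H N \<omega> = wigner N (\<lambda>e\<in>upper N. X e \<omega>)" if \<omega>: "\<omega> \<in> space M" for \<omega>
    proof -
      have rs: "real_symmetric N (H N \<omega>)"
        using conjunct1[OF cw[unfolded curie_weiss_type_def]] N \<omega> unfolding real_symmetric_def by blast
      hence dims: "dim_row (H N \<omega>) = N" "dim_col (H N \<omega>) = N" by (auto simp: real_symmetric_def)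
      show ?thesis
      proof (rule eq_matI)
        fix i j assume "i < dim_row (wigner N (\<lambda>e\<in>upper N. X e \<omega>))" "j < dim_col (wigner N (\<lambda>e\<in>upper N. X e \<omega>))"
        hence ij: "i < N" "j < N" by (auto simp: wigner_def)
        have "H N \<omega> $$ (i, j) = H N \<omega> $$ (min i j, max i j)"
          using symm_onD[OF real_symmetric_symm_on[OF rs], of i j] ij by (auto simp: min_def max_def)
        also have "\<dots> = 1 / sqrt (real N) * X (min i j, max i j) \<omega>" using HX \<omega> ij by auto
        finally show "H N \<omega> $$ (i, j) = wigner N (\<lambda>e\<in>upper N. X e \<omega>) $$ (i, j)"
          using ij min_max_upper[OF ij] by (simp add: wigner_entry)
      qed (auto simp: wigner_def dims)
    qed
    note iid = iid_entries_of_moments[OF P p K1 k1(3)[OF N] k1(4)[OF N]]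
    have mm: "moment (P N) 1 \<in> borel_measurable (T N)" "moment (P N) 2 \<in> borel_measurable (T N)"
      using moment_measurable[OF P] iid by auto
    note [measurable] = mm
    have prob_le: "measure M {\<omega> \<in> space M. (\<lambda>e\<in>upper N. X e \<omega>) \<in> bad} \<le> C / \<phi> ^ (2 * p)"
      if \<phi>: "0 < \<phi>" and bad: "bad \<in> bad_family N \<phi>" for \<phi> bad
    proof (rule de_finetti_prob_le[OF df bad_family_sets[OF bad]])
      let ?d = "tail_factor p K1 / \<phi> ^ (2 * p)"
      have d: "0 \<le> ?d" using tail_factor_nonneg \<phi> by simp
      show "emeasure (iid (upper N) (P N t)) bad
          \<le> ennreal ?d * ennreal (mixing_weight p N (moment (P N) 1 t) (moment (P N) 2 t))"
        if "t \<in> space (T N)" for t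
        using iid_entries.emeasure_bad_family[OF iid(1)[OF that] bad N \<phi>] d mixing_weight_ge_1[of "real N" p]
        unfolding iid_entries.bound_def[OF iid(1)[OF that]]
        by (subst ennreal_mult[symmetric]) (auto intro: order_trans[OF zero_le_one])
      have "(\<integral>\<^sup>+t. ennreal ?d * ennreal (mixing_weight p N (moment (P N) 1 t) (moment (P N) 2 t)) \<partial>T N)
          = ennreal ?d * (\<integral>\<^sup>+t. ennreal (mixing_weight p N (moment (P N) 1 t) (moment (P N) 2 t)) \<partial>T N)"
        unfolding mixing_weight_def by (intro nn_integral_cmult) measurable
      also have "\<dots> \<le> ennreal ?d * ennreal (1 + 2 * K1 + K2)"
        by (intro mult_left_mono mixing_weight_integral T mm N K1 K2 k1(1,2) k2) auto
      also have "\<dots> = ennreal (C / \<phi> ^ (2 * p))"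
        using ennreal_mult[OF d, of "1 + 2 * K1 + K2"] K1 K2 by (simp add: C_def)
      finally show "(\<integral>\<^sup>+t. ennreal ?d * ennreal (mixing_weight p N (moment (P N) 1 t) (moment (P N) 2 t)) \<partial>T N)
          \<le> ennreal (C / \<phi> ^ (2 * p))" .
      show "0 \<le> C / \<phi> ^ (2 * p)" using C \<phi> by simp
    qed
    show "\<exists>X. ?Q C N X"
    proof (rule exI[of _ X], intro conjI)
      show "\<forall>\<omega>\<in>space M. H N \<omega> = wigner N (\<lambda>e\<in>upper N. X e \<omega>)" using HN by (rule ballI)
      show "\<forall>\<phi>>0. \<forall>bad\<in>bad_family N \<phi>.
              measure M {\<omega> \<in> space M. (\<lambda>e\<in>upper N. X e \<omega>) \<in> bad} \<le> C / \<phi> ^ (2 * p)"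
        by (intro allI impI ballI) (rule prob_le)
    qed (rule X)
  qed
qed

section \<open>From grid points to the whole domain\<close>

lemma L2_norm_perturb:
  fixes f g :: "'i \<Rightarrow> complex"
  assumes "finite S" "\<And>x. x \<in> S \<Longrightarrow> cmod (f x - g x) \<le> c" "0 \<le> c"
  shows "sqrt (\<Sum>x\<in>S. (cmod (f x))\<^sup>2) \<le> sqrt (\<Sum>x\<in>S. (cmod (g x))\<^sup>2) + sqrt (card S) * c"
proof -
  have "L2_set (\<lambda>x. cmod (f x)) S \<le> L2_set (\<lambda>x. cmod (g x) + cmod (f x - g x)) S"
    by (intro L2_set_mono) (use norm_triangle_sub in \<open>auto simp: add.commute\<close>)
  also have "\<dots> \<le> L2_set (\<lambda>x. cmod (g x)) S + L2_set (\<lambda>x. cmod (f x - g x)) S"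
    by (rule L2_set_triangle_ineq)
  also have "L2_set (\<lambda>x. cmod (f x - g x)) S \<le> L2_set (\<lambda>_. c) S"
    using assms by (intro L2_set_mono) auto
  also have "\<dots> = sqrt (card S) * c" using assms by (simp add: L2_set_def real_sqrt_mult)
  finally show ?thesis by (simp add: L2_set_def)
qed

lemma minor_res_lipschitz:
  assumes A: "real_symmetric n A" and i: "i < n" and z: "1 / n \<le> Im z" "1 / n \<le> Im w"
    and kl: "k \<in> {..<n} - {i}" "l \<in> {..<n} - {i}"
  shows "cmod (minor_res A i z k l - minor_res A i w k l) \<le> cmod (z - w) * (real n)\<^sup>2"
proof -
  have n: "0 < real n" using i by simp
  have pos: "0 < Im z" "0 < Im w" using z n by (smt (verit) divide_pos_pos)+
  have symJ: "symm_on ({..<n} - {i}) (\<lambda>j k. A $$ (j, k))"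
    by (rule symm_on_subset[OF real_symmetric_symm_on[OF A]]) auto
  have "cmod (minor_res A i z k l - minor_res A i w k l) \<le> cmod (z - w) / (Im w * Im z)"
    using green_lipschitz[OF _ symJ green_minor_res[OF A pos(2) i] green_minor_res[OF A pos(1) i] pos(2,1) kl]
    by simp
  also have "\<dots> \<le> cmod (z - w) / ((1 / n) * (1 / n))"
    using z n pos by (intro divide_left_mono mult_mono mult_pos_pos) auto
  finally show ?thesis by (simp add: power2_eq_square)
qed

text \<open>All quantities in \<open>controlled\<close> are Lipschitz in \<open>z\<close> with a constant of order
  \<open>n\<^sup>4\<close>, as the resolvent of the minor has constant \<open>n\<^sup>2\<close> for \<open>Im z \<ge> 1 /
  n\<close>. At distance \<open>1 / (3 n\<^sup>5)\<close> the change fits into the reserve \<open>\<phi> / n\<close>.\<close>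

lemma controlled_perturb:
  assumes A: "real_symmetric n A" and n: "1 \<le> n"
    and entries: "\<And>j k. j < n \<Longrightarrow> k < n \<Longrightarrow> \<bar>A $$ (j, k)\<bar> \<le> \<phi> / sqrt n"
    and \<phi>: "1 \<le> \<phi>" "\<phi> \<le> sqrt n"
    and z: "1 / n \<le> Im z" "1 / n \<le> Im w" "cmod (z - w) \<le> 1 / (3 * real n ^ 5)"
    and quad: "\<And>i. i < n \<Longrightarrow> cmod (quad_fluct n A i w) \<le> \<phi> * minor_frob n A i w / n"
    and lin: "\<And>i j. i < n \<Longrightarrow> j < n \<Longrightarrow> i \<noteq> j \<Longrightarrow>
      cmod (lin_fluct n A i j w) \<le> \<phi> / sqrt n * minor_col n A i j w"
  shows "controlled n A \<phi> z"
proof -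
  have n1: "1 \<le> real n" using n by simp
  define c where "c = cmod (z - w) * (real n)\<^sup>2"
  have c0: "0 \<le> c" by (simp add: c_def)
  have "c \<le> 1 / (3 * real n ^ 5) * (real n)\<^sup>2" unfolding c_def by (intro mult_right_mono z) auto
  also have "\<dots> = 1 / (3 * real n ^ 3)" using n1 by (simp add: field_simps flip: power_add)
  finally have c: "c \<le> 1 / (3 * real n ^ 3)" .
  have cn: "c * real n ^ 2 \<le> 1 / (3 * n)"
    using mult_right_mono[OF c, of "real n ^ 2"] n1 by (simp add: field_simps power2_eq_square power3_eq_cube)
  have sq: "c * 1 \<le> c * real n ^ 1" "c * real n ^ 1 \<le> c * real n ^ 2"
    using n1 c0 by (intro mult_left_mono; simp add: power2_eq_square)+
  have lip: "cmod (minor_res A i z k l - minor_res A i w k l) \<le> c"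
    "cmod (minor_res A i w k l - minor_res A i z k l) \<le> c"
    if "i < n" "k \<in> {..<n} - {i}" "l \<in> {..<n} - {i}" for i k l
    using minor_res_lipschitz[OF A that(1) z(1,2) that(2,3)] minor_res_lipschitz[OF A that(1) z(2,1) that(2,3)]
    by (auto simp: c_def norm_minus_commute)
  have A1: "cmod (of_real (A $$ (j, k))) \<le> 1" if "j < n" "k < n" for j k
  proof -
    have "\<bar>A $$ (j, k)\<bar> \<le> \<phi> / sqrt n" by (rule entries[OF that])
    also have "\<dots> \<le> 1" using \<phi> n1 by simp
    finally show ?thesis by simp
  qed
  have card: "real (card ({..<n} - {i})) \<le> n" for i
    by (metis card_Diff1_le card_lessThan finite_lessThan of_nat_mono)
  have "cmod (quad_fluct n A i z) \<le> \<phi> * minor_frob n A i z / n + \<phi> / n" if i: "i < n" for i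
  proof -
    let ?J = "{..<n} - {i}"
    let ?S = "\<Sum>k\<in>?J. \<Sum>l\<in>?J. of_real (A $$ (i, k)) * (minor_res A i z k l - minor_res A i w k l) * of_real (A $$ (i, l))"
    let ?D = "\<Sum>k\<in>?J. minor_res A i z k k - minor_res A i w k k"
    have S: "?S = (\<Sum>k\<in>?J. \<Sum>l\<in>?J. of_real (A $$ (i, k)) * minor_res A i z k l * of_real (A $$ (i, l)))
        - (\<Sum>k\<in>?J. \<Sum>l\<in>?J. of_real (A $$ (i, k)) * minor_res A i w k l * of_real (A $$ (i, l)))"
      by (simp only: right_diff_distrib left_diff_distrib sum_subtractf)
    have "quad_fluct n A i z - quad_fluct n A i w = ?S - ?D / of_nat n"
    proof -
      have "(a - x) - (b - y) = (a - b) - (x - y)" for a b x y :: complex by simp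
      thus ?thesis unfolding quad_fluct_def S sum_subtractf diff_divide_distrib .
    qed
    hence tri: "cmod (quad_fluct n A i z - quad_fluct n A i w) \<le> cmod ?S + cmod ?D / n"
      using norm_triangle_ineq4[of ?S "?D / of_nat n"] by (simp add: norm_divide)
    have entry: "cmod (of_real (A $$ (i, k)) * (minor_res A i z k l - minor_res A i w k l) * of_real (A $$ (i, l))) \<le> 1 * c * 1"
      if "k \<in> ?J" "l \<in> ?J" for k l
      unfolding norm_mult using c0 that by (intro mult_mono A1 lip(1) i) auto
    have "cmod ?S \<le> (\<Sum>k\<in>?J. \<Sum>l\<in>?J. 1 * c * 1)"
      by (rule order_trans[OF norm_sum], rule sum_mono, rule order_trans[OF norm_sum], rule sum_mono, rule entry)
    hence "cmod ?S \<le> real (card ?J) * (real (card ?J) * c)" by simp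
    moreover have "real (card ?J) * (real (card ?J) * c) \<le> n * (n * c)"
      using card[of i] c0 by (intro mult_mono) auto
    ultimately have S_le: "cmod ?S \<le> n * (n * c)" by linarith
    have "cmod ?D \<le> (\<Sum>k\<in>?J. c)"
      by (rule order_trans[OF norm_sum], rule sum_mono, rule lip(1)[OF i])
    hence "cmod ?D \<le> real (card ?J) * c" by simp
    moreover have "real (card ?J) * c \<le> n * c" using card[of i] c0 by (intro mult_right_mono) auto
    ultimately have "cmod ?D \<le> n * c" by linarith
    hence "cmod ?D / n \<le> n * c / n" by (intro divide_right_mono) auto
    with tri S_le have "cmod (quad_fluct n A i z - quad_fluct n A i w) \<le> n * (n * c) + n * c / n" by linarith
    also have "\<dots> = c * real n ^ 2 + c" using n1 by (simp add: power2_eq_square)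
    also have "\<dots> \<le> 2 * (1 / (3 * n))" using cn sq by linarith
    finally have 1: "cmod (quad_fluct n A i z - quad_fluct n A i w) \<le> 2 * (1 / (3 * n))" .
    have "sqrt (\<Sum>x\<in>?J \<times> ?J. (cmod ((\<lambda>(k, l). minor_res A i w k l) x))\<^sup>2)
      \<le> sqrt (\<Sum>x\<in>?J \<times> ?J. (cmod ((\<lambda>(k, l). minor_res A i z k l) x))\<^sup>2) + sqrt (card (?J \<times> ?J)) * c"
      using lip(2)[OF i] c0 by (intro L2_norm_perturb) auto
    hence "minor_frob n A i w \<le> minor_frob n A i z + sqrt (card (?J \<times> ?J)) * c"
      by (simp add: minor_frob_def sum.cartesian_product case_prod_unfold)
    also have "sqrt (card (?J \<times> ?J)) = real (card ?J)" by (simp add: card_cartesian_product)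
    also have "\<dots> * c \<le> n * c" using card c0 by (intro mult_right_mono) auto
    finally have "\<phi> * minor_frob n A i w / n \<le> \<phi> * (minor_frob n A i z + n * c) / n"
      using \<phi> by (intro divide_right_mono mult_left_mono) auto
    also have "\<dots> = \<phi> * minor_frob n A i z / n + \<phi> * c" using n1 by (simp add: field_simps)
    also have "\<phi> * c \<le> \<phi> * (1 / (3 * n))" using cn sq \<phi> by (intro mult_left_mono) auto
    finally have 2: "\<phi> * minor_frob n A i w / n \<le> \<phi> * minor_frob n A i z / n + \<phi> * (1 / (3 * n))" by simp
    have "cmod (quad_fluct n A i z) \<le> cmod (quad_fluct n A i w) + cmod (quad_fluct n A i z - quad_fluct n A i w)"
      by (rule norm_triangle_sub)
    also have "\<dots> \<le> \<phi> * minor_frob n A i z / n + (\<phi> * (1 / (3 * n)) + 2 * (1 / (3 * n)))"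
      using 1 2 quad[OF i] by linarith
    also have "\<phi> * (1 / (3 * n)) + 2 * (1 / (3 * n)) \<le> \<phi> / n"
      using \<phi> n1 by (simp add: field_simps)
    finally show ?thesis by simp
  qed
  moreover have "cmod (lin_fluct n A i j z) \<le> \<phi> / sqrt n * minor_col n A i j z + \<phi> / n"
    if ij: "i < n" "j < n" "i \<noteq> j" for i j
  proof -
    let ?J = "{..<n} - {i}"
    have jJ: "j \<in> ?J" using ij by auto
    have "lin_fluct n A i j z - lin_fluct n A i j w
        = (\<Sum>k\<in>?J. of_real (A $$ (i, k)) * (minor_res A i z k j - minor_res A i w k j))"
      by (simp add: lin_fluct_def sum_subtractf algebra_simps)
    hence L: "cmod (lin_fluct n A i j z - lin_fluct n A i j w)
        \<le> (\<Sum>k\<in>?J. cmod (of_real (A $$ (i, k)) * (minor_res A i z k j - minor_res A i w k j)))"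
      by (simp only: norm_sum)
    have entry: "cmod (of_real (A $$ (i, k)) * (minor_res A i z k j - minor_res A i w k j)) \<le> 1 * c"
      if "k \<in> ?J" for k
      unfolding norm_mult using c0 that ij jJ by (intro mult_mono A1 lip(1)) auto
    have "cmod (lin_fluct n A i j z - lin_fluct n A i j w) \<le> (\<Sum>k\<in>?J. 1 * c)"
      by (rule order_trans[OF L], rule sum_mono, rule entry)
    hence "cmod (lin_fluct n A i j z - lin_fluct n A i j w) \<le> real (card ?J) * c" by simp
    also have "\<dots> \<le> n * c" using card c0 by (intro mult_right_mono) auto
    also have "\<dots> \<le> 1 / (3 * n)" using cn sq by (simp add: mult.commute)
    finally have 1: "cmod (lin_fluct n A i j z - lin_fluct n A i j w) \<le> 1 / (3 * n)" .
    have "minor_col n A i j w \<le> minor_col n A i j z + sqrt (card ?J) * c"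
      unfolding minor_col_def using lip(2)[OF ij(1) _ jJ] c0 by (intro L2_norm_perturb) auto
    also have "sqrt (card ?J) * c \<le> sqrt n * c" using card c0 by (intro mult_right_mono) auto
    finally have "\<phi> / sqrt n * minor_col n A i j w \<le> \<phi> / sqrt n * (minor_col n A i j z + sqrt n * c)"
      using \<phi> by (intro mult_left_mono) auto
    also have "\<dots> = \<phi> / sqrt n * minor_col n A i j z + \<phi> * c" using n1 by (simp add: field_simps)
    also have "\<phi> * c \<le> \<phi> * (1 / (3 * n))" using cn sq \<phi> by (intro mult_left_mono) auto
    finally have 2: "\<phi> / sqrt n * minor_col n A i j w \<le> \<phi> / sqrt n * minor_col n A i j z + \<phi> * (1 / (3 * n))" by simp
    have "cmod (lin_fluct n A i j z) \<le> cmod (lin_fluct n A i j w) + cmod (lin_fluct n A i j z - lin_fluct n A i j w)"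
      by (rule norm_triangle_sub)
    also have "\<dots> \<le> \<phi> / sqrt n * minor_col n A i j z + (\<phi> * (1 / (3 * n)) + 1 / (3 * n))"
      using 1 2 lin[OF ij] by linarith
    also have "\<phi> * (1 / (3 * n)) + 1 / (3 * n) \<le> \<phi> / n"
      using \<phi> n1 by (simp add: field_simps)
    finally show ?thesis by simp
  qed
  ultimately show ?thesis using entries by (simp add: controlled_def)
qed

text \<open>Mesh size \<open>1 / h\<close> in both directions; rounding moves a point by at most \<open>2 / h = 1 / (3
  n\<^sup>5)\<close>.\<close>

definition grid :: "real \<Rightarrow> nat \<Rightarrow> complex set" where
  "grid \<tau> n = (let h = 6 * real n ^ 5; m = \<lceil>h / \<tau>\<rceil> in
     (\<lambda>(a, b). Complex (real_of_int a / h) (real_of_int b / h)) ` ({-m..m} \<times> {1..m}))"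

lemma finite_grid: "finite (grid \<tau> n)"
  by (simp add: grid_def Let_def)

lemma grid_Im_pos: "1 \<le> n \<Longrightarrow> z \<in> grid \<tau> n \<Longrightarrow> 0 < Im z"
  by (auto simp: grid_def Let_def)

lemma card_grid:
  assumes "1 \<le> n" "0 < \<tau>" "\<tau> < 1"
  shows "real (card (grid \<tau> n)) \<le> 432 * real n ^ 10 / \<tau>\<^sup>2"
proof -
  define h where "h = 6 * real n ^ 5"
  define m where "m = \<lceil>h / \<tau>\<rceil>"
  have "1 \<le> real n ^ 5" using assms by simp
  hence h: "6 \<le> h" by (simp add: h_def)
  have "\<tau> * 1 \<le> 1 * h" using assms h by (intro mult_mono) auto
  hence ht: "1 \<le> h / \<tau>" using assms by (simp add: field_simps)
  have m1: "1 \<le> m" using ht by (simp add: m_def)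
  have m: "real_of_int m \<le> 2 * (h / \<tau>)" using ht by (simp add: m_def) linarith
  have "card (grid \<tau> n) \<le> card ({-m..m} \<times> {1..m})"
    unfolding grid_def Let_def h_def[symmetric] m_def[symmetric] by (intro card_image_le) auto
  also have "\<dots> = nat (2 * m + 1) * nat m" by (simp add: card_cartesian_product)
  finally have "real (card (grid \<tau> n)) \<le> real (nat (2 * m + 1) * nat m)" by (simp only: of_nat_le_iff)
  also have "\<dots> = (2 * real_of_int m + 1) * real_of_int m" using m1 by simp
  also have "\<dots> \<le> (3 * real_of_int m) * real_of_int m" using m1 by (intro mult_right_mono) auto
  also have "\<dots> \<le> (3 * (2 * (h / \<tau>))) * (2 * (h / \<tau>))" using m m1 ht by (intro mult_mono) auto
  also have "\<dots> = 432 * real n ^ 10 / \<tau>\<^sup>2"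
    by (simp add: h_def power2_eq_square flip: power_add)
  finally show ?thesis .
qed

text \<open>The imaginary part is rounded up, so that it keeps its lower bound.\<close>

lemma grid_dense:
  assumes n: "1 \<le> n" and \<tau>: "0 < \<tau>" "\<tau> < 1" and z: "z \<in> dom_D \<tau> n"
  obtains w where "w \<in> grid \<tau> n" "Im z \<le> Im w" "cmod (z - w) \<le> 1 / (3 * real n ^ 5)"
proof -
  define h where "h = 6 * real n ^ 5"
  define m where "m = \<lceil>h / \<tau>\<rceil>"
  define a where "a = \<lfloor>h * Re z\<rfloor>"
  define b where "b = \<lceil>h * Im z\<rceil>"
  have h: "0 < h" using n by (simp add: h_def)
  have zR: "- (1 / \<tau>) \<le> Re z" "Re z \<le> 1 / \<tau>" "1 / real n powr (1 - \<tau>) \<le> Im z" "Im z \<le> 1 / \<tau>"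
    using z by (auto simp: dom_D_def)
  have "0 < 1 / real n powr (1 - \<tau>)" using n by simp
  hence Im0: "0 < Im z" using zR by linarith
  note hb0 = mult_left_mono[OF zR(2) less_imp_le[OF h]] mult_left_mono[OF zR(1) less_imp_le[OF h]]
    mult_left_mono[OF zR(4) less_imp_le[OF h]]
  have hb: "h * Re z \<le> h / \<tau>" "- (h / \<tau>) \<le> h * Re z" "h * Im z \<le> h / \<tau>" using hb0 by simp_all
  have "a \<le> m" "- m \<le> a" "b \<le> m" unfolding a_def b_def m_def using hb by linarith+
  moreover have "1 \<le> b" using h Im0 by (simp add: b_def)
  ultimately have ab: "(a, b) \<in> {-m..m} \<times> {1..m}" by auto
  let ?w = "Complex (real_of_int a / h) (real_of_int b / h)"
  have "?w \<in> grid \<tau> n"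
    unfolding grid_def Let_def h_def[symmetric] m_def[symmetric] using ab by (intro image_eqI[of _ _ "(a, b)"]) auto
  moreover have "Im z \<le> Im ?w"
    using h le_of_int_ceiling[of "h * Im z"] by (simp add: b_def pos_le_divide_eq mult.commute)
  moreover have "cmod (z - ?w) \<le> 1 / (3 * real n ^ 5)"
  proof -
    have "\<bar>h * Re z - a\<bar> \<le> 1" unfolding a_def by linarith
    hence "\<bar>Re z - a / h\<bar> \<le> 1 / h"
      using h by (simp add: abs_le_iff field_simps)
    moreover have "\<bar>h * Im z - b\<bar> \<le> 1" unfolding b_def by linarith
    hence "\<bar>Im z - b / h\<bar> \<le> 1 / h"
      using h by (simp add: abs_le_iff field_simps)
    ultimately have "cmod (z - ?w) \<le> 1 / h + 1 / h"
      using cmod_le[of "z - ?w"] by simp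
    thus ?thesis by (simp add: h_def)
  qed
  ultimately show ?thesis by (rule that)
qed

definition grid_bad :: "real \<Rightarrow> nat \<Rightarrow> real \<Rightarrow> (nat \<times> nat \<Rightarrow> real) set set" where
  "grid_bad \<tau> N \<phi> = bad_entry N \<phi> ` upper N
     \<union> (\<lambda>(i, z). bad_quad N \<phi> i z) ` ({..<N} \<times> grid \<tau> N)
     \<union> (\<lambda>(i, j, z). bad_lin N \<phi> i j z) ` ({..<N} \<times> {..<N} \<times> grid \<tau> N)"

lemma grid_bad_subset:
  assumes "1 \<le> N" shows "grid_bad \<tau> N \<phi> \<subseteq> bad_family N \<phi>"
proof -
  have "(\<lambda>(i, z). bad_quad N \<phi> i z) ` ({..<N} \<times> grid \<tau> N) \<subseteq> {bad_quad N \<phi> i z | i z. i < N \<and> 0 < Im z}"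
  proof
    fix B assume "B \<in> (\<lambda>(i, z). bad_quad N \<phi> i z) ` ({..<N} \<times> grid \<tau> N)"
    then obtain i z where "i < N" "z \<in> grid \<tau> N" "B = bad_quad N \<phi> i z" by auto
    thus "B \<in> {bad_quad N \<phi> i z | i z. i < N \<and> 0 < Im z}" using grid_Im_pos[OF assms, of z \<tau>] by blast
  qed
  moreover have "(\<lambda>(i, j, z). bad_lin N \<phi> i j z) ` ({..<N} \<times> {..<N} \<times> grid \<tau> N)
      \<subseteq> {bad_lin N \<phi> i j z | i j z. i < N \<and> j < N \<and> 0 < Im z}"
  proof
    fix B assume "B \<in> (\<lambda>(i, j, z). bad_lin N \<phi> i j z) ` ({..<N} \<times> {..<N} \<times> grid \<tau> N)"
    then obtain i j z where "i < N" "j < N" "z \<in> grid \<tau> N" "B = bad_lin N \<phi> i j z" by auto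
    thus "B \<in> {bad_lin N \<phi> i j z | i j z. i < N \<and> j < N \<and> 0 < Im z}"
      using grid_Im_pos[OF assms, of z \<tau>] by blast
  qed
  ultimately show ?thesis unfolding grid_bad_def bad_family_def by (intro Un_mono order_refl)
qed

lemma finite_grid_bad: "finite (grid_bad \<tau> N \<phi>)"
  by (simp add: grid_bad_def finite_grid)

lemma card_grid_bad:
  assumes N: "1 \<le> N" and \<tau>: "0 < \<tau>" "\<tau> < 1"
  shows "real (card (grid_bad \<tau> N \<phi>)) \<le> 1296 * real N ^ 12 / \<tau>\<^sup>2"
proof -
  define g where "g = 432 * real N ^ 10 / \<tau>\<^sup>2"
  have g: "real (card (grid \<tau> N)) \<le> g" unfolding g_def by (rule card_grid[OF assms])
  have N1: "1 \<le> real N" using N by simp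
  have "\<tau>\<^sup>2 \<le> 1" using \<tau> by (simp add: power_le_one)
  moreover have "1 \<le> real N ^ 10" using N1 by simp
  ultimately have g1: "1 \<le> g" using \<tau> by (simp add: g_def field_simps)
  have "upper N \<subseteq> {..<N} \<times> {..<N}" by (auto simp: upper_def)
  hence up: "card (upper N) \<le> N * N"
    using card_mono[of "{..<N} \<times> {..<N}" "upper N"] by (simp add: card_cartesian_product)
  have "card (grid_bad \<tau> N \<phi>) \<le> card (bad_entry N \<phi> ` upper N)
     + card ((\<lambda>(i, z). bad_quad N \<phi> i z) ` ({..<N} \<times> grid \<tau> N))
     + card ((\<lambda>(i, j, z). bad_lin N \<phi> i j z) ` ({..<N} \<times> {..<N} \<times> grid \<tau> N))"
    unfolding grid_bad_def by (intro order_trans[OF card_Un_le] add_mono order_refl)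
  also have "\<dots> \<le> N * N + card ({..<N} \<times> grid \<tau> N) + card ({..<N} \<times> {..<N} \<times> grid \<tau> N)"
    using up by (intro add_mono card_image_le order_trans[OF card_image_le]) (auto simp: finite_grid)
  also have "\<dots> = N * N + N * card (grid \<tau> N) + N * (N * card (grid \<tau> N))"
    by (simp add: card_cartesian_product)
  finally have "real (card (grid_bad \<tau> N \<phi>)) \<le> real (N * N + N * card (grid \<tau> N) + N * (N * card (grid \<tau> N)))"
    by (simp only: of_nat_le_iff)
  also have "\<dots> = real N * real N * 1 + real N * 1 * real (card (grid \<tau> N)) + real N * real N * real (card (grid \<tau> N))"
    by simp
  also have "\<dots> \<le> real N * real N * g + real N * real N * g + real N * real N * g"
    using g g1 N1 by (intro add_mono mult_mono) auto
  also have "\<dots> = 1296 * real N ^ 12 / \<tau>\<^sup>2"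
  proof -
    have "real N ^ 12 = real N * real N * real N ^ 10"
      using power_add[of "real N" 2 10] by (simp add: power2_eq_square)
    thus ?thesis using \<tau> by (simp add: g_def field_simps)
  qed
  finally show ?thesis .
qed

lemma controlled_off_bad:
  assumes x: "x \<in> space (iid (upper N) borel)" "x \<notin> \<Union>(grid_bad \<tau> N \<phi>)"
    and N: "1 \<le> N" and \<tau>: "0 < \<tau>" "\<tau> < 1" and \<phi>: "1 \<le> \<phi>" "\<phi> \<le> sqrt N" and z: "z \<in> dom_D \<tau> N"
  shows "controlled N (wigner N x) \<phi> z"
proof -
  obtain w where w: "w \<in> grid \<tau> N" "Im z \<le> Im w" "cmod (z - w) \<le> 1 / (3 * real N ^ 5)"
    by (rule grid_dense[OF N \<tau> z])
  have "real N powr (1 - \<tau>) \<le> real N powr 1" using N \<tau> by (intro powr_mono) auto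
  hence "1 / real N \<le> 1 / real N powr (1 - \<tau>)" using N by (intro divide_left_mono) auto
  also have "\<dots> \<le> Im z" using z by (simp add: dom_D_def)
  finally have zN: "1 / real N \<le> Im z" .
  show ?thesis
  proof (rule controlled_perturb[OF real_symmetric_wigner N _ \<phi> zN order_trans[OF zN w(2)] w(3)])
    fix j k assume jk: "j < N" "k < N"
    have "x \<notin> bad_entry N \<phi> (min j k, max j k)"
      using x(2) min_max_upper[OF jk] unfolding grid_bad_def by blast
    hence "\<bar>x (min j k, max j k)\<bar> \<le> \<phi>" using x(1) by (simp add: bad_entry_def)
    thus "\<bar>wigner N x $$ (j, k)\<bar> \<le> \<phi> / sqrt N"
      using jk by (simp add: wigner_entry divide_right_mono)
  next
    fix i assume i: "i < N"
    have "bad_quad N \<phi> i w \<in> grid_bad \<tau> N \<phi>"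
      unfolding grid_bad_def using i w(1) by (intro UnI1 UnI2 image_eqI[of _ _ "(i, w)"]) auto
    thus "cmod (quad_fluct N (wigner N x) i w) \<le> \<phi> * minor_frob N (wigner N x) i w / N"
      using x by (force simp: bad_quad_def)
  next
    fix i j assume ij: "i < N" "j < N"
    have "bad_lin N \<phi> i j w \<in> grid_bad \<tau> N \<phi>"
      unfolding grid_bad_def using ij w(1) by (intro UnI2 image_eqI[of _ _ "(i, j, w)"]) auto
    thus "cmod (lin_fluct N (wigner N x) i j w) \<le> \<phi> / sqrt N * minor_col N (wigner N x) i j w"
      using x by (force simp: bad_lin_def)
  qed
qed

text \<open>There are at most a constant times \<open>N\<^sup>1\<^sup>2\<close> bad events, so a moment of order \<open>2 p\<close> with
  \<open>2 p \<delta> \<ge> D + 12\<close> beats their number at the level \<open>\<phi> = N\<^sup>\<delta>\<close>. The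
  factor \<open>\<tau>\<close> in the bound pays for the comparison of the two error scales in the smaller domain.\<close>

lemma overwhelming_local_law:
  assumes cw: "curie_weiss_type M H T P" and M: "prob_space M" and \<tau>: "0 < \<tau>" "\<tau> < 1"
    and \<epsilon>: "0 < \<epsilon>" and D: "0 < D"
  shows "\<exists>C\<ge>0. \<forall>N\<ge>1. \<exists>Bad\<in>sets M. measure M Bad \<le> C * real N powr (- D) \<and>
      (\<forall>\<omega>\<in>space M - Bad. \<forall>z\<in>dom_D \<tau> N. law_error N (H N \<omega>) z \<le> \<tau> * real N powr \<epsilon> * rate N z)"
    (is "\<exists>C\<ge>0. \<forall>N\<ge>1. ?law C N")
proof -
  interpret M: prob_space M by fact
  \<comment> \<open>\<open>\<delta> \<le> \<tau> / 4\<close> keeps \<open>\<phi> N powr (- \<tau> / 2)\<close> small, and \<open>\<delta> \<le> \<epsilon> / 2\<close> leaves a factor \<open>N powr (\<epsilon> / 2)\<close> for the constants.\<close>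
  define \<delta> where "\<delta> = min (\<epsilon> / 2) (\<tau> / 4)"
  have \<delta>: "0 < \<delta>" "\<delta> \<le> \<epsilon> / 2" "\<delta> \<le> \<tau> / 4" using \<epsilon> \<tau> by (auto simp: \<delta>_def)
  define p where "p = nat \<lceil>(D + 12) / (2 * \<delta>)\<rceil>"
  have "0 < (D + 12) / (2 * \<delta>)" using D \<delta> by simp
  hence "0 < \<lceil>(D + 12) / (2 * \<delta>)\<rceil>" by (simp only: zero_less_ceiling)
  hence p: "1 \<le> p" "(D + 12) / (2 * \<delta>) \<le> real p"
    unfolding p_def using real_nat_ceiling_ge[of "(D + 12) / (2 * \<delta>)"] by linarith+
  have pd: "D + 12 \<le> \<delta> * real (2 * p)" using p(2) \<delta>(1) by (simp add: field_simps)
  obtain C where C: "0 \<le> C" and CX: "\<forall>N\<ge>1. \<exists>X. (\<forall>e\<in>upper N. X e \<in> borel_measurable M) \<and>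
           (\<forall>\<omega>\<in>space M. H N \<omega> = wigner N (\<lambda>e\<in>upper N. X e \<omega>)) \<and>
           (\<forall>\<phi>>0. \<forall>bad\<in>bad_family N \<phi>.
              measure M {\<omega> \<in> space M. (\<lambda>e\<in>upper N. X e \<omega>) \<in> bad} \<le> C / \<phi> ^ (2 * p))"
    using curie_weiss_bad_events[OF cw p(1)] by (elim exE conjE)
  have "filterlim (\<lambda>N. real N powr (\<tau> / 4)) at_top sequentially"
    "filterlim (\<lambda>N. real N powr (\<epsilon> / 2)) at_top sequentially"
    using \<tau>(1) \<epsilon> by real_asymp+
  hence "\<forall>\<^sub>F N in sequentially. 100000 / \<tau>\<^sup>2 \<le> real N powr (\<tau> / 4)"
    "\<forall>\<^sub>F N in sequentially. 10000 / \<tau>\<^sup>2 / \<tau> \<le> real N powr (\<epsilon> / 2)"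
    by (auto simp: filterlim_at_top)
  hence "\<forall>\<^sub>F N in sequentially. 100000 / \<tau>\<^sup>2 \<le> real N powr (\<tau> / 4) \<and> 10000 / \<tau>\<^sup>2 / \<tau> \<le> real N powr (\<epsilon> / 2)"
    by (rule eventually_conj)
  then obtain N0 where N0: "\<And>N. N0 \<le> N \<Longrightarrow> 100000 / \<tau>\<^sup>2 \<le> real N powr (\<tau> / 4) \<and> 10000 / \<tau>\<^sup>2 / \<tau> \<le> real N powr (\<epsilon> / 2)"
    by (auto simp: eventually_sequentially)
  \<comment> \<open>The second entry makes the bound trivial for the finitely many \<open>N < N0\<close>.\<close>
  define C' where "C' = max (1296 * C / \<tau>\<^sup>2) (real N0 powr D)"
  show ?thesis
  proof (intro exI[of _ C'] conjI allI impI)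
    show "0 \<le> C'" by (simp add: C'_def le_max_iff_disj)
    fix N :: nat assume N: "1 \<le> N"
    show "?law C' N"
    proof (cases "N0 \<le> N")
      case False
      have "real N powr D \<le> real N0 powr D" using False D by (intro powr_mono2) auto
      also have "\<dots> \<le> C'" by (simp add: C'_def)
      finally have "real N powr D * real N powr (- D) \<le> C' * real N powr (- D)" by (intro mult_right_mono) auto
      hence "1 \<le> C' * real N powr (- D)" using N by (simp flip: powr_add)
      thus ?thesis by (intro bexI[of _ "space M"]) (auto simp: M.prob_space)
    next
      case True
      define \<phi> where "\<phi> = real N powr \<delta>"
      have N1: "1 \<le> real N" using N by simp
      have \<phi>1: "1 \<le> \<phi>" unfolding \<phi>_def using N1 \<delta> by (intro ge_one_powr_ge_zero) auto
      have "\<phi> \<le> real N powr (1 / 2)" unfolding \<phi>_def using N1 \<delta> \<tau> by (intro powr_mono) auto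
      hence \<phi>2: "\<phi> \<le> sqrt N" by (simp add: powr_half_sqrt)
      have small: "\<phi> * real N powr (- \<tau> / 2) \<le> \<tau>\<^sup>2 / 100000"
      proof -
        have "\<phi> * real N powr (- \<tau> / 2) = real N powr (\<delta> - \<tau> / 2)"
          unfolding \<phi>_def by (simp add: powr_add[symmetric])
        also have "\<dots> \<le> real N powr (- (\<tau> / 4))" using N1 \<delta> by (intro powr_mono) auto
        also have "\<dots> = 1 / real N powr (\<tau> / 4)" by (simp add: powr_minus_divide)
        also have "\<dots> \<le> 1 / (100000 / \<tau>\<^sup>2)" using N0[OF True] \<tau> N by (intro divide_left_mono mult_pos_pos) auto
        finally show ?thesis by simp
      qed
      have final: "10000 * \<phi> / \<tau>\<^sup>2 \<le> \<tau> * real N powr \<epsilon>"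
      proof -
        have "10000 / \<tau>\<^sup>2 \<le> \<tau> * real N powr (\<epsilon> / 2)"
          using N0[OF True] \<tau> by (simp add: pos_divide_le_eq mult_ac)
        moreover have "\<phi> \<le> real N powr (\<epsilon> / 2)" unfolding \<phi>_def using N1 \<delta> by (intro powr_mono) auto
        ultimately have "10000 / \<tau>\<^sup>2 * \<phi> \<le> \<tau> * real N powr (\<epsilon> / 2) * real N powr (\<epsilon> / 2)"
          using \<phi>1 \<tau> by (intro mult_mono) auto
        thus ?thesis by (simp add: mult.assoc flip: powr_add)
      qed
      obtain X where X: "\<forall>e\<in>upper N. X e \<in> borel_measurable M"
        and HX: "\<forall>\<omega>\<in>space M. H N \<omega> = wigner N (\<lambda>e\<in>upper N. X e \<omega>)"
        and bd: "\<forall>\<phi>>0. \<forall>bad\<in>bad_family N \<phi>.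
              measure M {\<omega> \<in> space M. (\<lambda>e\<in>upper N. X e \<omega>) \<in> bad} \<le> C / \<phi> ^ (2 * p)"
        using CX[rule_format, OF N] by (elim exE conjE)
      define x where "x \<omega> = (\<lambda>e\<in>upper N. X e \<omega>)" for \<omega>
      have xm: "x \<in> measurable M (iid (upper N) borel)"
        unfolding x_def using X by (intro measurable_restrict) auto
      define ev where "ev bad = {\<omega> \<in> space M. x \<omega> \<in> bad}" for bad
      have evs: "ev bad \<in> sets M" if "bad \<in> grid_bad \<tau> N \<phi>" for bad
      proof -
        have "bad \<in> sets (iid (upper N) borel)"
          using bad_family_sets grid_bad_subset[OF N] that by blast
        from measurable_sets[OF xm this] show ?thesis
          by (simp add: ev_def vimage_def Int_def conj_commute)
      qed
      define Bad where "Bad = (\<Union>bad\<in>grid_bad \<tau> N \<phi>. ev bad)"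
      have "Bad \<in> sets M" unfolding Bad_def using evs finite_grid_bad by (intro sets.finite_UN) auto
      moreover have "measure M Bad \<le> C' * real N powr (- D)"
      proof -
        have "measure M Bad \<le> (\<Sum>bad\<in>grid_bad \<tau> N \<phi>. measure M (ev bad))"
          unfolding Bad_def using evs finite_grid_bad by (intro M.finite_measure_subadditive_finite) auto
        also have "\<dots> \<le> (\<Sum>bad\<in>grid_bad \<tau> N \<phi>. C / \<phi> ^ (2 * p))"
        proof (rule sum_mono)
          fix bad assume "bad \<in> grid_bad \<tau> N \<phi>"
          hence "bad \<in> bad_family N \<phi>" using grid_bad_subset[OF N] by blast
          thus "measure M (ev bad) \<le> C / \<phi> ^ (2 * p)" using bd \<phi>1 by (simp add: ev_def x_def)
        qed
        also have "\<dots> = real (card (grid_bad \<tau> N \<phi>)) * (C / \<phi> ^ (2 * p))" by simp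
        also have "\<dots> \<le> (1296 * real N ^ 12 / \<tau>\<^sup>2) * (C * real N powr (- (D + 12)))"
        proof (intro mult_mono card_grid_bad N \<tau>)
          have "\<phi> ^ (2 * p) = real N powr (\<delta> * real (2 * p))"
            unfolding \<phi>_def using N by (simp add: powr_powr flip: powr_realpow)
          also have "\<dots> \<ge> real N powr (D + 12)" using N1 pd by (intro powr_mono) auto
          finally have "1 / \<phi> ^ (2 * p) \<le> 1 / real N powr (D + 12)"
            using N \<phi>1 by (intro divide_left_mono mult_pos_pos) auto
          hence "C * (1 / \<phi> ^ (2 * p)) \<le> C * (1 / real N powr (D + 12))" using C by (intro mult_left_mono) auto
          thus "C / \<phi> ^ (2 * p) \<le> C * real N powr (- (D + 12))"
            by (simp only: powr_minus_divide times_divide_eq_right mult_1_right)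
        qed (use C \<phi>1 in auto)
        also have "\<dots> = 1296 * C / \<tau>\<^sup>2 * (real N powr 12 * real N powr (- (D + 12)))"
          using N by (simp add: powr_realpow[of _ 12, simplified])
        also have "real N powr 12 * real N powr (- (D + 12)) = real N powr (- D)"
          unfolding powr_add[symmetric] by (simp only: minus_add_distrib) simp
        also have "1296 * C / \<tau>\<^sup>2 * real N powr (- D) \<le> C' * real N powr (- D)"
          by (intro mult_right_mono) (auto simp: C'_def)
        finally show ?thesis .
      qed
      moreover have "\<forall>\<omega>\<in>space M - Bad. \<forall>z\<in>dom_D \<tau> N. law_error N (H N \<omega>) z \<le> \<tau> * real N powr \<epsilon> * rate N z"
      proof (intro ballI)
        fix \<omega> z assume \<omega>: "\<omega> \<in> space M - Bad" and z: "z \<in> dom_D \<tau> N"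
        have xs: "x \<omega> \<in> space (iid (upper N) borel)" using measurable_space[OF xm] \<omega> by auto
        have xb: "x \<omega> \<notin> \<Union>(grid_bad \<tau> N \<phi>)" using \<omega> by (auto simp: Bad_def ev_def)
        have Hx: "H N \<omega> = wigner N (x \<omega>)" using HX \<omega> by (simp add: x_def)
        have law: "law_error N (wigner N (x \<omega>)) z \<le> 10000 * \<phi> / \<tau>\<^sup>2 * rate N z"
          by (rule deterministic_local_law[OF real_symmetric_wigner N \<tau> \<phi>1 small
            controlled_off_bad[OF xs xb N \<tau> \<phi>1 \<phi>2] z])
        have "0 \<le> rate N z"
        proof -
          have "0 < 1 / real N powr (1 - \<tau>)" using N by simp
          hence "0 < Im z" using z unfolding dom_D_def by (simp del: zero_less_divide_1_iff)
          thus ?thesis by (simp add: rate_def kappa_def)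
        qed
        hence fr: "10000 * \<phi> / \<tau>\<^sup>2 * rate N z \<le> \<tau> * real N powr \<epsilon> * rate N z"
          using final by (intro mult_right_mono)
        show "law_error N (H N \<omega>) z \<le> \<tau> * real N powr \<epsilon> * rate N z"
          unfolding Hx by (rule order_trans[OF law fr])
      qed
      ultimately show ?thesis by (intro bexI[of _ Bad] conjI)
    qed
  qed
qed

section \<open>Suprema over the domain\<close>

lemma continuous_on_Max:
  fixes f :: "'i \<Rightarrow> 'b::topological_space \<Rightarrow> real"
  assumes "finite I" "I \<noteq> {}" "\<And>i. i \<in> I \<Longrightarrow> continuous_on S (f i)"
  shows "continuous_on S (\<lambda>x. Max ((\<lambda>i. f i x) ` I))"
  using assms
proof (induction I rule: finite_ne_induct)
  case (insert i I)
  have "continuous_on S (\<lambda>x. max (f i x) (Max ((\<lambda>i. f i x) ` I)))"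
    using insert by (intro continuous_on_max) auto
  thus ?case using insert by simp
qed simp

text \<open>Makes suprema over a continuum measurable, by restricting them to a countable dense subset.\<close>

lemma SUP_dense_eq:
  fixes f :: "'b::topological_space \<Rightarrow> real"
  assumes c: "continuous_on S f" and b: "bdd_above (f ` S)" and T: "T \<subseteq> S" "S \<subseteq> closure T" "T \<noteq> {}"
  shows "(SUP x\<in>S. f x) = (SUP x\<in>T. f x)"
proof (rule antisym)
  have bT: "bdd_above (f ` T)" by (rule bdd_above_mono[OF b]) (use T in auto)
  have "f x \<le> (SUP x\<in>T. f x)" if x: "x \<in> S" for x
  proof (rule ccontr)
    assume "\<not> f x \<le> (SUP x\<in>T. f x)"
    hence "x \<in> {y \<in> S. f y \<in> {(SUP x\<in>T. f x)<..}}" using x by auto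
    moreover have "openin (top_of_set S) {y \<in> S. f y \<in> {(SUP x\<in>T. f x)<..}}"
      using continuous_openin_preimage_gen[OF c open_greaterThan] by (simp add: vimage_def Int_def)
    ultimately obtain U where U: "open U" "x \<in> U" "S \<inter> U \<subseteq> {y \<in> S. f y \<in> {(SUP x\<in>T. f x)<..}}"
      unfolding openin_open by blast
    have "x \<in> closure T" using x T by auto
    then obtain y where y: "y \<in> T" "y \<in> U" using U(1,2) by (meson disjoint_iff open_Int_closure_eq_empty)
    hence "(SUP x\<in>T. f x) < f y" using U(3) T by auto
    thus False using cSUP_upper[OF y(1) bT] by simp
  qed
  moreover have "S \<noteq> {}" using T by auto
  ultimately show "(SUP x\<in>S. f x) \<le> (SUP x\<in>T. f x)" by (intro cSUP_least)
  show "(SUP x\<in>T. f x) \<le> (SUP x\<in>S. f x)" using T b by (intro cSUP_subset_mono) auto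
qed

lemma borel_measurable_SUP_compact:
  fixes F :: "complex \<Rightarrow> 'a \<Rightarrow> real"
  assumes S: "compact S" "S \<noteq> {}" and F: "\<And>z. z \<in> S \<Longrightarrow> F z \<in> borel_measurable M"
    and c: "\<And>\<omega>. \<omega> \<in> space M \<Longrightarrow> continuous_on S (\<lambda>z. F z \<omega>)"
  shows "(\<lambda>\<omega>. SUP z\<in>S. F z \<omega>) \<in> borel_measurable M"
proof -
  obtain T where T: "countable T" "T \<subseteq> S" "S \<subseteq> closure T" by (rule separable)
  have T0: "T \<noteq> {}" using T S by auto
  have b: "bdd_above ((\<lambda>z. F z \<omega>) ` S)" if "\<omega> \<in> space M" for \<omega>
    using compact_continuous_image[OF c[OF that] S(1)] by (intro bounded_imp_bdd_above compact_imp_bounded)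
  have "(\<lambda>\<omega>. SUP z\<in>T. F z \<omega>) \<in> borel_measurable M"
  proof (rule borel_measurable_cSUP[OF T(1)])
    show "bdd_above ((\<lambda>z. F z \<omega>) ` T)" if "\<omega> \<in> space M" for \<omega>
      by (rule bdd_above_mono[OF b[OF that]]) (use T in auto)
  qed (use F T in auto)
  thus ?thesis
    using SUP_dense_eq[OF c b T(2,3) T0] by (subst measurable_cong) auto
qed

lemma dom_D_cbox:
  "dom_D \<tau> N = cbox (Complex (- 1 / \<tau>) (1 / real N powr (1 - \<tau>))) (Complex (1 / \<tau>) (1 / \<tau>))"
  "dom_D_star \<tau> N = cbox (Complex (- 2 + \<tau>) (1 / real N powr (1 - \<tau>))) (Complex (2 - \<tau>) (1 / \<tau>))"
  by (auto simp: dom_D_def dom_D_star_def in_cbox_complex_iff)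

lemma dom_facts:
  assumes N: "1 \<le> N" and \<tau>: "0 < \<tau>" "\<tau> < 1"
  shows "dom_D_star \<tau> N \<subseteq> dom_D \<tau> N" "dom_D_star \<tau> N \<noteq> {}" "dom_D \<tau> N \<noteq> {}"
    "\<And>z. z \<in> dom_D \<tau> N \<Longrightarrow> 0 < Im z"
proof -
  have "1 \<le> real N powr (1 - \<tau>)" using N \<tau> by (intro ge_one_powr_ge_zero) auto
  hence "1 / real N powr (1 - \<tau>) \<le> 1 / 1" by (intro frac_le) auto
  hence "1 / real N powr (1 - \<tau>) \<le> 1" by (simp only: div_by_1)
  also have "1 \<le> 1 / \<tau>" using \<tau> by simp
  finally have le: "1 / real N powr (1 - \<tau>) \<le> 1 / \<tau>" .
  have "0 \<le> (1 - \<tau>)\<^sup>2" by simp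
  hence "2 - \<tau> \<le> 1 / \<tau>" using \<tau> by (simp add: field_simps power2_eq_square)
  thus sub: "dom_D_star \<tau> N \<subseteq> dom_D \<tau> N" by (auto simp: dom_D_def dom_D_star_def)
  have "Complex 0 (1 / \<tau>) \<in> dom_D_star \<tau> N" using le \<tau> by (auto simp: dom_D_star_def)
  thus "dom_D_star \<tau> N \<noteq> {}" "dom_D \<tau> N \<noteq> {}" using sub by auto
  have "0 < 1 / real N powr (1 - \<tau>)" using N by simp
  thus "\<And>z. z \<in> dom_D \<tau> N \<Longrightarrow> 0 < Im z" unfolding dom_D_def by (auto simp del: zero_less_divide_1_iff)
qed

lemma continuous_on_law_error:
  assumes A: "real_symmetric N A" and N: "1 \<le> N"
  shows "continuous_on {z. 0 < Im z} (law_error N A)"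
proof -
  have ne: "{..<N} \<times> {..<N} \<noteq> {}" using N by (auto simp: lessThan_empty_iff)
  have "continuous_on {z. 0 < Im z} (\<lambda>z. Max ((\<lambda>(i, j). cmod (resolvent A z $$ (i, j) - (if i = j then m_sc z else 0))) ` ({..<N} \<times> {..<N})))"
    unfolding case_prod_unfold
  proof (intro continuous_on_Max ne)
    fix p assume p: "p \<in> {..<N} \<times> {..<N}"
    have "continuous_on {z. 0 < Im z} (\<lambda>z. if fst p = snd p then m_sc z else 0)"
      using continuous_on_m_sc by (cases "fst p = snd p") auto
    thus "continuous_on {z. 0 < Im z} (\<lambda>z. cmod (resolvent A z $$ (fst p, snd p) - (if fst p = snd p then m_sc z else 0)))"
      using p by (intro continuous_on_norm continuous_on_diff continuous_on_resolvent[OF A]) auto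
  qed simp
  thus ?thesis
    unfolding law_error_def[abs_def] Lambda_eq
    by (intro continuous_on_max continuous_on_norm continuous_on_diff continuous_on_s_emp[OF A] continuous_on_m_sc)
qed

lemma borel_measurable_law_error:
  assumes A: "\<And>\<omega>. \<omega> \<in> space M \<Longrightarrow> real_symmetric N (A \<omega>)"
    and ent: "\<And>i j. i < N \<Longrightarrow> j < N \<Longrightarrow> (\<lambda>\<omega>. A \<omega> $$ (i, j)) \<in> borel_measurable M" and z: "0 < Im z"
  shows "(\<lambda>\<omega>. law_error N (A \<omega>) z) \<in> borel_measurable M"
proof -
  have res: "(\<lambda>\<omega>. resolvent (A \<omega>) z $$ (i, j)) \<in> borel_measurable M" if "i < N" "j < N" for i j
    by (rule borel_measurable_resolvent[OF A ent z that])
  have "(\<lambda>\<omega>. Max ((\<lambda>p. cmod (resolvent (A \<omega>) z $$ (fst p, snd p) - (if fst p = snd p then m_sc z else 0))) ` ({..<N} \<times> {..<N})))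
      \<in> borel_measurable M"
    by (intro borel_measurable_Max borel_measurable_diff measurable_compose[OF _ borel_measurable_norm] res) auto
  moreover have "(\<lambda>\<omega>. s_emp N (A \<omega>) z) \<in> borel_measurable M"
    unfolding s_emp_def by (intro borel_measurable_times borel_measurable_const borel_measurable_sum res) auto
  hence "(\<lambda>\<omega>. cmod (s_emp N (A \<omega>) z - m_sc z)) \<in> borel_measurable M" by measurable
  ultimately show ?thesis
    unfolding law_error_def Lambda_eq case_prod_unfold by measurable
qed

text \<open>The law at rate \<open>\<tau> N\<^sup>\<epsilon>\<close> times \<open>rate\<close> bounds the quotient by
  \<open>N\<^sup>\<epsilon>\<close> for every error scale that is at least \<open>\<tau>\<close> times \<open>rate\<close>.
  Both claims of the local law have this form.\<close>

lemma stoch_dom_SUP: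
  fixes \<rho> :: "nat \<Rightarrow> complex \<Rightarrow> real"
  assumes M: "prob_space M" and cw: "curie_weiss_type M H T P" and \<tau>: "0 < \<tau>" "\<tau> < 1"
    and S: "\<And>N. 1 \<le> N \<Longrightarrow> compact (S N) \<and> S N \<noteq> {} \<and> S N \<subseteq> dom_D \<tau> N"
    and \<rho>: "\<And>N z. 1 \<le> N \<Longrightarrow> z \<in> S N \<Longrightarrow> 0 < \<rho> N z \<and> \<tau> * rate N z \<le> \<rho> N z"
    and c\<rho>: "\<And>N. 1 \<le> N \<Longrightarrow> continuous_on (S N) (\<rho> N)"
  shows "stoch_dom M (\<lambda>N \<omega>. complex_of_real (SUP z\<in>S N. law_error N (H N \<omega>) z / \<rho> N z)) (\<lambda>N \<omega>. 1)"
  unfolding stoch_dom_def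
proof (intro conjI allI impI ballI)
  interpret M: prob_space M by fact
  have meas: "(\<lambda>\<omega>. SUP z\<in>S N. law_error N (H N \<omega>) z / \<rho> N z) \<in> borel_measurable M" if N: "1 \<le> N" for N
  proof -
    obtain C X where X: "\<forall>e\<in>upper N. X e \<in> borel_measurable M"
        and HX: "\<forall>\<omega>\<in>space M. H N \<omega> = wigner N (\<lambda>e\<in>upper N. X e \<omega>)"
      using curie_weiss_bad_events[OF cw, of 1] N by blast
    have sym: "real_symmetric N (H N \<omega>)" if "\<omega> \<in> space M" for \<omega>
      using HX that real_symmetric_wigner by simp
    have ent: "(\<lambda>\<omega>. H N \<omega> $$ (i, j)) \<in> borel_measurable M" if ij: "i < N" "j < N" for i j
    proof -
      have "(\<lambda>\<omega>. X (min i j, max i j) \<omega> / sqrt N) \<in> borel_measurable M"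
        using X min_max_upper[OF ij] by (intro borel_measurable_divide) auto
      moreover have "H N \<omega> $$ (i, j) = X (min i j, max i j) \<omega> / sqrt N" if "\<omega> \<in> space M" for \<omega>
        using HX that ij min_max_upper[OF ij] by (simp add: wigner_entry)
      ultimately show ?thesis by (subst measurable_cong) auto
    qed
    show ?thesis
    proof (rule borel_measurable_SUP_compact)
      show "compact (S N)" "S N \<noteq> {}" using S[OF N] by auto
      show "(\<lambda>\<omega>. law_error N (H N \<omega>) z / \<rho> N z) \<in> borel_measurable M" if "z \<in> S N" for z
      proof -
        have "0 < Im z" using that S[OF N] dom_facts(4)[OF N \<tau>] by auto
        thus ?thesis by (intro borel_measurable_divide borel_measurable_law_error sym ent) auto
      qed
      show "continuous_on (S N) (\<lambda>z. law_error N (H N \<omega>) z / \<rho> N z)" if "\<omega> \<in> space M" for \<omega>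
      proof (intro continuous_on_divide c\<rho>[OF N])
        have "S N \<subseteq> {z. 0 < Im z}" using S[OF N] dom_facts(4)[OF N \<tau>] by auto
        thus "continuous_on (S N) (law_error N (H N \<omega>))"
          by (rule continuous_on_subset[OF continuous_on_law_error[OF sym[OF that] N]])
      qed (use \<rho>[OF N] in force)
    qed
  qed
  show "(\<lambda>\<omega>. complex_of_real (SUP z\<in>S N. law_error N (H N \<omega>) z / \<rho> N z)) \<in> borel_measurable M"
    if "1 \<le> N" for N using meas[OF that] by measurable
  fix \<epsilon> D :: real assume eD: "0 < \<epsilon>" "0 < D"
  obtain C where C: "0 \<le> C" and Bad: "\<forall>N\<ge>1. \<exists>Bad\<in>sets M. measure M Bad \<le> C * real N powr (- D) \<and>
      (\<forall>\<omega>\<in>space M - Bad. \<forall>z\<in>dom_D \<tau> N. law_error N (H N \<omega>) z \<le> \<tau> * real N powr \<epsilon> * rate N z)"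
    using overwhelming_local_law[OF cw M \<tau> eD] by (elim exE conjE)
  show "\<exists>C\<ge>0. \<forall>N\<ge>1. measure M {\<omega> \<in> space M. real N powr \<epsilon> * 1
      < cmod (complex_of_real (SUP z\<in>S N. law_error N (H N \<omega>) z / \<rho> N z))} \<le> C * real N powr (- D)"
  proof (intro exI[of _ C] conjI allI impI C)
    fix N :: nat assume N: "1 \<le> N"
    obtain B where B: "B \<in> sets M" "measure M B \<le> C * real N powr (- D)"
      and law: "\<forall>\<omega>\<in>space M - B. \<forall>z\<in>dom_D \<tau> N. law_error N (H N \<omega>) z \<le> \<tau> * real N powr \<epsilon> * rate N z"
      using Bad[rule_format, OF N] by (elim bexE conjE)
    have good: "\<bar>SUP z\<in>S N. law_error N (H N \<omega>) z / \<rho> N z\<bar> \<le> real N powr \<epsilon>" if \<omega>: "\<omega> \<in> space M - B" for \<omega>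
    proof -
      have le: "0 \<le> law_error N (H N \<omega>) z / \<rho> N z \<and> law_error N (H N \<omega>) z / \<rho> N z \<le> real N powr \<epsilon>" if z: "z \<in> S N" for z
      proof -
        have zD: "z \<in> dom_D \<tau> N" using z S[OF N] by auto
        have "law_error N (H N \<omega>) z \<le> \<tau> * real N powr \<epsilon> * rate N z"
          using law \<omega> zD by blast
        also have "\<dots> = real N powr \<epsilon> * (\<tau> * rate N z)" by simp
        also have "\<dots> \<le> real N powr \<epsilon> * \<rho> N z" using \<rho>[OF N z] by (intro mult_left_mono) auto
        finally have "law_error N (H N \<omega>) z \<le> real N powr \<epsilon> * \<rho> N z" .
        moreover have "0 \<le> law_error N (H N \<omega>) z" by (simp add: law_error_def le_max_iff_disj)
        ultimately show ?thesis using \<rho>[OF N z] by (simp add: pos_divide_le_eq)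
      qed
      obtain z0 where z0: "z0 \<in> S N" using S[OF N] by auto
      have "(SUP z\<in>S N. law_error N (H N \<omega>) z / \<rho> N z) \<le> real N powr \<epsilon>"
        using le z0 by (intro cSUP_least) auto
      moreover have "law_error N (H N \<omega>) z0 / \<rho> N z0 \<le> (SUP z\<in>S N. law_error N (H N \<omega>) z / \<rho> N z)"
        using le by (intro cSUP_upper z0 bdd_aboveI2[where M = "real N powr \<epsilon>"]) auto
      ultimately show ?thesis using le[OF z0] by (auto simp: abs_le_iff)
    qed
    have "measure M {\<omega> \<in> space M. real N powr \<epsilon> * 1
      < cmod (complex_of_real (SUP z\<in>S N. law_error N (H N \<omega>) z / \<rho> N z))} \<le> measure M B"
    proof (rule M.finite_measure_mono[OF _ B(1)], rule subsetI)
      fix \<omega> assume "\<omega> \<in> {\<omega> \<in> space M. real N powr \<epsilon> * 1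
          < cmod (complex_of_real (SUP z\<in>S N. law_error N (H N \<omega>) z / \<rho> N z))}"
      hence "\<omega> \<in> space M" "real N powr \<epsilon> < \<bar>SUP z\<in>S N. law_error N (H N \<omega>) z / \<rho> N z\<bar>" by auto
      thus "\<omega> \<in> B" using good[of \<omega>] by (cases "\<omega> \<in> B") auto
    qed
    with B(2) show "measure M {\<omega> \<in> space M. real N powr \<epsilon> * 1
      < cmod (complex_of_real (SUP z\<in>S N. law_error N (H N \<omega>) z / \<rho> N z))} \<le> C * real N powr (- D)"
      by linarith
  qed
qed auto

lemma rate_facts:
  assumes N: "1 \<le> N" and z: "0 < Im z"
  shows "0 < kappa z + Im z + 1 / sqrt (N * Im z)" "0 < rate N z"
proof -
  have "0 < 1 / sqrt (N * Im z)" using N z by simp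
  moreover have "0 \<le> kappa z" by (simp add: kappa_def)
  ultimately show "0 < kappa z + Im z + 1 / sqrt (N * Im z)" using z by linarith
  thus "0 < rate N z" using N z by (simp add: rate_def)
qed

theorem theorem23:
  fixes \<tau> :: real
    and M :: "'a measure"
    and H :: "nat \<Rightarrow> 'a \<Rightarrow> real mat"
    and T :: "nat \<Rightarrow> 't measure"
    and P :: "nat \<Rightarrow> 't \<Rightarrow> real measure"
  assumes "0 < \<tau>" and "\<tau> < 1"
    and "prob_space M"
    and "curie_weiss_type M H T P"
  shows "stoch_dom M
           (\<lambda>N \<omega>. complex_of_real (SUP z\<in>dom_D \<tau> N.
              max (Lambda N (H N \<omega>) z) (cmod (s_emp N (H N \<omega>) z - m_sc z)) /
              ((1 / sqrt (real N * Im z)) / sqrt (kappa z + Im z + 1 / sqrt (real N * Im z)))))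
           (\<lambda>N \<omega>. 1) \<and>
         stoch_dom M
           (\<lambda>N \<omega>. complex_of_real (SUP z\<in>dom_D_star \<tau> N.
              max (Lambda N (H N \<omega>) z) (cmod (s_emp N (H N \<omega>) z - m_sc z)) /
              (1 / sqrt (real N * Im z))))
           (\<lambda>N \<omega>. 1)"
proof
  note \<tau> = assms(1,2)
  have cont: "continuous_on {z. 0 < Im z} (\<lambda>z. 1 / sqrt (real N * Im z))" if "1 \<le> N" for N
    using that by (intro continuous_intros) auto
  have "stoch_dom M (\<lambda>N \<omega>. complex_of_real (SUP z\<in>dom_D \<tau> N. law_error N (H N \<omega>) z / rate N z)) (\<lambda>N \<omega>. 1)"
  proof (rule stoch_dom_SUP[OF assms(3,4) \<tau>])
    fix N :: nat assume N: "1 \<le> N"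
    show "compact (dom_D \<tau> N) \<and> dom_D \<tau> N \<noteq> {} \<and> dom_D \<tau> N \<subseteq> dom_D \<tau> N"
      using dom_facts[OF N \<tau>] by (auto simp: dom_D_cbox(1))
    have pos: "dom_D \<tau> N \<subseteq> {z. 0 < Im z}" using dom_facts(4)[OF N \<tau>] by auto
    show "0 < rate N z \<and> \<tau> * rate N z \<le> rate N z" if "z \<in> dom_D \<tau> N" for z
    proof -
      have "0 < rate N z" using rate_facts[OF N] pos that by auto
      thus ?thesis using \<tau> by (simp add: mult_left_le_one_le)
    qed
    have nz: "sqrt (kappa z + Im z + 1 / sqrt (real N * Im z)) \<noteq> 0" if "z \<in> dom_D \<tau> N" for z
      using rate_facts(1)[OF N, of z] pos that by auto
    have "continuous_on (dom_D \<tau> N) (\<lambda>z. sqrt (kappa z + Im z + 1 / sqrt (real N * Im z)))"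
      unfolding kappa_def
      by (intro continuous_on_real_sqrt continuous_on_add continuous_on_subset[OF cont[OF N] pos] continuous_intros)
    thus "continuous_on (dom_D \<tau> N) (rate N)"
      unfolding rate_def[abs_def]
      using nz by (intro continuous_on_divide[OF continuous_on_subset[OF cont[OF N] pos]]) auto
  qed
  thus "stoch_dom M
           (\<lambda>N \<omega>. complex_of_real (SUP z\<in>dom_D \<tau> N.
              max (Lambda N (H N \<omega>) z) (cmod (s_emp N (H N \<omega>) z - m_sc z)) /
              ((1 / sqrt (real N * Im z)) / sqrt (kappa z + Im z + 1 / sqrt (real N * Im z)))))
           (\<lambda>N \<omega>. 1)"
    unfolding law_error_def rate_def .
  have "stoch_dom M (\<lambda>N \<omega>. complex_of_real (SUP z\<in>dom_D_star \<tau> N.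
      law_error N (H N \<omega>) z / (1 / sqrt (real N * Im z)))) (\<lambda>N \<omega>. 1)"
  proof (rule stoch_dom_SUP[OF assms(3,4) \<tau>])
    fix N :: nat assume N: "1 \<le> N"
    show "compact (dom_D_star \<tau> N) \<and> dom_D_star \<tau> N \<noteq> {} \<and> dom_D_star \<tau> N \<subseteq> dom_D \<tau> N"
      using dom_facts[OF N \<tau>] by (auto simp: dom_D_cbox(2))
    have pos: "dom_D_star \<tau> N \<subseteq> {z. 0 < Im z}" using dom_facts(1,4)[OF N \<tau>] by auto
    show "continuous_on (dom_D_star \<tau> N) (\<lambda>z. 1 / sqrt (real N * Im z))"
      by (rule continuous_on_subset[OF cont[OF N] pos])
    show "0 < 1 / sqrt (real N * Im z) \<and> \<tau> * rate N z \<le> 1 / sqrt (real N * Im z)" if z: "z \<in> dom_D_star \<tau> N" for z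
    proof -
      have Im: "0 < Im z" using pos z by auto
      have psi: "0 < 1 / sqrt (real N * Im z)" using Im N by simp
      \<comment> \<open>In the smaller domain \<open>\<kappa> \<ge> \<tau>\<close>, so the denominator of \<open>rate\<close> is at least \<open>sqrt \<tau> \<ge> \<tau>\<close>.\<close>
      have "\<bar>Re z\<bar> \<le> 2 - \<tau>" using z by (auto simp: dom_D_star_def)
      hence "\<tau> \<le> kappa z + Im z + 1 / sqrt (real N * Im z)"
        using Im psi \<tau> unfolding kappa_def by linarith
      moreover have "\<tau>\<^sup>2 \<le> \<tau>" using \<tau> by (simp add: power2_eq_square mult_left_le)
      ultimately have "\<tau> \<le> sqrt (kappa z + Im z + 1 / sqrt (real N * Im z))" by (intro real_le_rsqrt) linarith
      hence "\<tau> * (1 / sqrt (real N * Im z)) \<le> sqrt (kappa z + Im z + 1 / sqrt (real N * Im z)) * (1 / sqrt (real N * Im z))"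
        using psi by (intro mult_right_mono) auto
      moreover have "0 < sqrt (kappa z + Im z + 1 / sqrt (real N * Im z))"
        using rate_facts(1)[OF N Im] by simp
      ultimately have "\<tau> * rate N z \<le> 1 / sqrt (real N * Im z)"
        unfolding rate_def times_divide_eq_right[of \<tau> "1 / sqrt (real N * Im z)"]
        by (simp only: pos_divide_le_eq mult.commute)
      with psi show ?thesis by simp
    qed
  qed
  thus "stoch_dom M
           (\<lambda>N \<omega>. complex_of_real (SUP z\<in>dom_D_star \<tau> N.
              max (Lambda N (H N \<omega>) z) (cmod (s_emp N (H N \<omega>) z - m_sc z)) /
              (1 / sqrt (real N * Im z))))
           (\<lambda>N \<omega>. 1)"
    unfolding law_error_def .
qed

end
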